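(* Let $\Omega\subset\mathbb{C}^2$ be a bounded convex Reinhardt domain and let $f\in A^2(\Omega)$ be such that the Hankel operator $H_{\overline{f}}$ is compact on $A^2(\Omega)$. If $\Gamma_1\neq\emptyset$, then $f$ is a function of $z_2$ alone (that is, $f(z_1,z_2)=f(z_1',z_2)$ whenever $(z_1,z_2),(z_1',z_2)\in\Omega$). If $\Gamma_2\neq\emptyset$, then $f$ is a function of $z_1$ alone (that is, $f(z_1,z_2)=f(z_1,z_2')$ whenever $(z_1,z_2),(z_1,z_2')\in\Omega$).
   Context: A domain $\Omega\subset\mathbb{C}^2$ is Reinhardt if $(\zeta_1z_1,\zeta_2z_2)\in\Omega$ whenever $(z_1,z_2)\in\Omega$ and $|\zeta_1|=|\zeta_2|=1$. $A^2(\Omega)$ is the Bergman space of holomorphic functions on $\Omega$ that are square integrable with respect to Lebesgue measure, a closed subspace of $L^2(\Omega)$, and $P:L^2(\Omega)\to A^2(\Omega)$ is the orthogonal (Bergman) projection. For a symbol $\phi\in L^2(\Omega)$, the Hankel operator is $H_\phi g=(I-P)(\phi g)$, a priori defined for those $g\in A^2(\Omega)$ with $\phi g\in L^2(\Omega)$, so possibly only densely defined; saying that $H_\phi$ is compact on $A^2(\Omega)$ includes that it is defined (by extension) on all of $A^2(\Omega)$ as a compact operator into $L^2(\Omega)$. Notation: $\mathbb{D}_r=\{z\in\mathbb{C}:|z|<r\}$, $\mathbb{D}=\mathbb{D}_1$, $S_t=\{z\in\mathbb{C}:|z|=t\}$, and $b\Omega$ is the boundary of $\Omega$. Define $$\Gamma_\Omega=\overline{\bigcup\{\phi(\mathbb{D})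 : \phi:\mathbb{D}\to b\Omega \text{ holomorphic and non-trivial (i.e. non-constant)}\}}.$$ For a bounded convex Reinhardt domain in $\mathbb{C}^2$ it is known that $\Gamma_\Omega=\Gamma_1\cup\Gamma_2$, where either $\Gamma_1=\emptyset$ or $\Gamma_1=\overline{\mathbb{D}_{r_1}}\times S_{s_1}$, and either $\Gamma_2=\emptyset$ or $\Gamma_2=S_{s_2}\times\overline{\mathbb{D}_{r_2}}$, for some $r_1,r_2,s_1,s_2>0$; this defines $\Gamma_1$ and $\Gamma_2$. *)

theory Defs
  imports "HOL-Analysis.Analysis"
begin

type_synonym complex2 = "complex \<times> complex"

definition is_domain :: "complex2 set \<Rightarrow> bool" where
  "is_domain \<Omega> \<longleftrightarrow> open \<Omega> \<and> connected \<Omega> \<and> \<Omega> \<noteq> {}"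

definition reinhardt :: "complex2 set \<Rightarrow> bool" where
  "reinhardt \<Omega> \<longleftrightarrow>
    (\<forall>z1 z2 \<zeta>1 \<zeta>2. (z1, z2) \<in> \<Omega> \<and> norm \<zeta>1 = 1 \<and> norm \<zeta>2 = 1
      \<longrightarrow> (\<zeta>1 * z1, \<zeta>2 * z2) \<in> \<Omega>)"

(* Complex Frechet differentiability: the maps w \<mapsto> a * fst w + b * snd w are exactly
   the complex-linear maps from complex2 to complex. *)
definition holomorphic2_on :: "(complex2 \<Rightarrow> complex) \<Rightarrow> complex2 set \<Rightarrow> bool" where
  "holomorphic2_on f \<Omega> \<longleftrightarrow>
    (\<forall>z\<in>\<Omega>. \<exists>a b. (f has_derivative (\<lambda>w. a * fst w + b * snd w)) (at z))"

(* Elements of the following spaces are total functions of which only the restriction to \<Omega>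
   is relevant; functions that agree almost everywhere on \<Omega> are not identified, so
   equations in L2 are stated with AE. *)
definition L2 :: "complex2 set \<Rightarrow> (complex2 \<Rightarrow> complex) set" where
  "L2 \<Omega> = {u. u \<in> borel_measurable (lebesgue_on \<Omega>) \<and>
              integrable (lebesgue_on \<Omega>) (\<lambda>z. (norm (u z))\<^sup>2)}"

definition L2_norm :: "complex2 set \<Rightarrow> (complex2 \<Rightarrow> complex) \<Rightarrow> real" where
  "L2_norm \<Omega> u = sqrt (\<integral>z. (norm (u z))\<^sup>2 \<partial>lebesgue_on \<Omega>)"

definition L2_inner ::
    "complex2 set \<Rightarrow> (complex2 \<Rightarrow> complex) \<Rightarrow> (complex2 \<Rightarrow> complex) \<Rightarrow> complex" where
  "L2_inner \<Omega> u v = (\<integral>z. u z * cnj (v z) \<partial>lebesgue_on \<Omega>)"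

definition bergman_space :: "complex2 set \<Rightarrow> (complex2 \<Rightarrow> complex) set" where
  "bergman_space \<Omega> = {g \<in> L2 \<Omega>. holomorphic2_on g \<Omega>}"

(* The orthogonal projection of u. For u in L2 of an open set, such an h exists and is
   determined on \<Omega>; its values outside \<Omega> are arbitrary. *)
definition bergman_projection ::
    "complex2 set \<Rightarrow> (complex2 \<Rightarrow> complex) \<Rightarrow> complex2 \<Rightarrow> complex" where
  "bergman_projection \<Omega> u =
    (SOME h. h \<in> bergman_space \<Omega> \<and>
       (\<forall>k\<in>bergman_space \<Omega>. L2_inner \<Omega> (\<lambda>z. u z - h z) k = 0))"

(* Meaningful for g in the Bergman space such that the product of \<phi> and g is in L2. *)
definition hankel ::
    "complex2 set \<Rightarrow> (complex2 \<Rightarrow> complex) \<Rightarrow> (complex2 \<Rightarrow> complex) \<Rightarrow> complex2 \<Rightarrow> complex" where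
  "hankel \<Omega> \<phi> g = (\<lambda>z. \<phi> z * g z - bergman_projection \<Omega> (\<lambda>w. \<phi> w * g w) z)"

(* Compact linear operators from the Bergman space to L2. Together, linearity and the
   sequential condition imply boundedness, and that T respects equality on \<Omega>. *)
definition compact_operator ::
    "complex2 set \<Rightarrow> ((complex2 \<Rightarrow> complex) \<Rightarrow> complex2 \<Rightarrow> complex) \<Rightarrow> bool" where
  "compact_operator \<Omega> T \<longleftrightarrow>
    (\<forall>g\<in>bergman_space \<Omega>. T g \<in> L2 \<Omega>) \<and>
    (\<forall>g\<in>bergman_space \<Omega>. \<forall>h\<in>bergman_space \<Omega>. \<forall>a b.
       AE z in lebesgue_on \<Omega>. T (\<lambda>w. a * g w + b * h w) z = a * T g z + b * T h z) \<and>
    (\<forall>G B. (\<forall>n::nat. G n \<in> bergman_space \<Omega> \<and> L2_norm \<Omega> (G n) \<le> B) \<longrightarrow>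
       (\<exists>u\<in>L2 \<Omega>. \<exists>r::nat \<Rightarrow> nat. strict_mono r \<and>
          (\<lambda>n. L2_norm \<Omega> (\<lambda>z. T (G (r n)) z - u z)) \<longlonglongrightarrow> 0))"

definition hankel_compact :: "complex2 set \<Rightarrow> (complex2 \<Rightarrow> complex) \<Rightarrow> bool" where
  "hankel_compact \<Omega> \<phi> \<longleftrightarrow>
    (\<exists>T. compact_operator \<Omega> T \<and>
      (\<forall>g\<in>bergman_space \<Omega>. (\<lambda>z. \<phi> z * g z) \<in> L2 \<Omega> \<longrightarrow>
         (AE z in lebesgue_on \<Omega>. T g z = hankel \<Omega> \<phi> g z)))"

definition analytic_disc_in :: "complex2 set \<Rightarrow> (complex \<Rightarrow> complex2) \<Rightarrow> bool" where
  "analytic_disc_in X \<phi> \<longleftrightarrow>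
    (\<lambda>\<zeta>. fst (\<phi> \<zeta>)) holomorphic_on ball 0 1 \<and> (\<lambda>\<zeta>. snd (\<phi> \<zeta>)) holomorphic_on ball 0 1 \<and>
    \<phi> ` ball 0 1 \<subseteq> X \<and> \<not> \<phi> constant_on ball 0 1"

definition Gamma :: "complex2 set \<Rightarrow> complex2 set" where
  "Gamma \<Omega> = closure (\<Union>{\<phi> ` ball 0 1 |\<phi>. analytic_disc_in (frontier \<Omega>) \<phi>})"

definition Gamma_decomposition ::
    "complex2 set \<Rightarrow> complex2 set \<Rightarrow> complex2 set \<Rightarrow> bool" where
  "Gamma_decomposition \<Omega> G1 G2 \<longleftrightarrow>
    Gamma \<Omega> = G1 \<union> G2 \<and>
    (G1 = {} \<or> (\<exists>r1>0. \<exists>s1>0. G1 = cball 0 r1 \<times> sphere 0 s1)) \<and>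
    (G2 = {} \<or> (\<exists>r2>0. \<exists>s2>0. G2 = sphere 0 s2 \<times> cball 0 r2))"

(* For a bounded convex Reinhardt domain a decomposition exists. It is unique: among the points
   of Gamma \<Omega>, those with first coordinate 0 lie in G1 only and determine s1, and then r1 is
   determined because G2 meets {(z1, z2). |z2| = s1} in at most one value of |z1|; likewise G2. *)
definition Gamma1 :: "complex2 set \<Rightarrow> complex2 set" where
  "Gamma1 \<Omega> = (THE G1. \<exists>G2. Gamma_decomposition \<Omega> G1 G2)"

definition Gamma2 :: "complex2 set \<Rightarrow> complex2 set" where
  "Gamma2 \<Omega> = (THE G2. \<exists>G1. Gamma_decomposition \<Omega> G1 G2)"

end

theory Submission
  imports Defs "HOL-Complex_Analysis.Complex_Analysis"
begin

text \<open>
  Let \<open>s\<close> be the radius for which the boundary contains a flat piece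
  \<open>{|z| \<le> r, |w| = s}\<close> (the case of \<open>\<Gamma>\<^sub>1\<close>; for \<open>\<Gamma>\<^sub>2\<close> the variables change places), and let
  \<open>a\<^sub>j\<^sub>k\<close> be the Taylor coefficients of \<open>f\<close>. It has to be shown that \<open>a\<^sub>j\<^sub>k = 0\<close> whenever \<open>j \<ge> 1\<close>.

  Test the Hankel operator \<open>H\<close> on the normalised powers \<open>G\<^sub>n = w\<^sup>n / \<parallel>w\<^sup>n\<parallel>\<close>, which concentrate on the
  flat piece, and pair the result with \<open>v\<^sub>n = cnj (z\<^sup>j w\<^sup>k) w\<^sup>n\<close>. Under rotations of \<open>z\<close> the function
  \<open>v\<^sub>n\<close> has the negative weight \<open>- j\<close>, so it is orthogonal to the Bergman space and the
  projection in \<open>H\<close> drops out of the pairing. As monomials are orthogonal on a Reinhardt domain,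
  \<open>\<langle>H G\<^sub>n, v\<^sub>n\<rangle> = cnj a\<^sub>j\<^sub>k \<parallel>z\<^sup>j w\<^bsup>k+n\<^esup>\<parallel>\<^sup>2 / \<parallel>w\<^sup>n\<parallel>\<close> while \<open>\<langle>H G\<^sub>m, v\<^sub>n\<rangle> = 0\<close> for \<open>n > k + m\<close>. By the
  Cauchy-Schwarz inequality, \<open>\<parallel>H G\<^sub>n - H G\<^sub>m\<parallel> \<ge> |a\<^sub>j\<^sub>k| \<parallel>z\<^sup>j w\<^bsup>k+n\<^esup>\<parallel> / \<parallel>w\<^sup>n\<parallel>\<close>. The flat piece keeps the last
  quotient away from \<open>0\<close>: near \<open>|w| = s\<close>, where the mass of \<open>|w|\<^bsup>2n\<^esup>\<close> sits, the slices
  in \<open>z\<close> contain a disc of fixed radius. So if \<open>a\<^sub>j\<^sub>k \<noteq> 0\<close>, then the sequence \<open>H G\<^sub>n\<close> has no convergent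
  subsequence, although the \<open>G\<^sub>n\<close> are unit vectors. This is \<open>hankel_compact_imp_taylor_coeff_eq_0\<close>.

  The analytic input is \<open>integral_monomial\<close>: integrating a holomorphic function against a
  conjugate monomial yields a Taylor coefficient. It is obtained one variable at a time, from
  Fubini's theorem and \<open>integral_ball_taylor\<close>, and it rests on the rotation invariance of
  Lebesgue measure. It also exhibits the Bergman projection of \<open>cnj f w\<^sup>n\<close> as an explicit polynomial
  in \<open>w\<close>.

  The geometric input concerns \<open>\<Gamma>\<close>. A supporting hyperplane of a convex Reinhardt domain
  can be turned into an inequality \<open>\<alpha> |z| + \<beta> |w| \<le> const\<close>, and the maximum principle forces an
  analytic disc in the boundary to be constant in every variable of positive weight
  (\<open>analytic_disc_in_frontier_cases\<close>). Hence every disc lies in one of at most two flat pieces, and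
  this gives existence and uniqueness of the decomposition that defines \<open>\<Gamma>\<^sub>1\<close> and \<open>\<Gamma>\<^sub>2\<close>.
\<close>

section \<open>Rotation invariance\<close>

text \<open>The uniqueness argument for Haar measure: evaluating the double integral of
  \<open>1\<^sub>A(x) 1\<^sub>B(T y - x)\<close> in both orders shows that the image measure is proportional to Lebesgue
  measure, and the unit ball, which is invariant under \<open>T\<close>, fixes the constant.\<close>

lemma lborel_distr_orthogonal_transformation:
  fixes T :: "'a::euclidean_space \<Rightarrow> 'a"
  assumes T: "orthogonal_transformation T"
  shows "distr lborel borel T = lborel"
proof -
  define S where "S = inv T"
  have TS: "T (S x) = x" for x
    unfolding S_def using orthogonal_transformation_surj[OF T] by (simp add: surj_f_inv_f)
  have linT: "linear T" by (rule orthogonal_transformation_linear[OF T])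
  have [measurable]: "T \<in> borel_measurable borel"
    using linT by (intro borel_measurable_continuous_onI linear_continuous_on linear_conv_bounded_linear[THEN iffD1])
  have exchange: "emeasure lborel A * emeasure lborel (T -` B) = emeasure lborel B * emeasure lborel (T -` A)"
    if [measurable]: "A \<in> sets borel" "B \<in> sets borel" for A B :: "'a set"
  proof -
    have transl: "(\<integral>\<^sup>+y. h (t + y) \<partial>lborel) = (\<integral>\<^sup>+y. h y \<partial>lborel)"
      if [measurable]: "h \<in> borel_measurable borel" for h :: "'a \<Rightarrow> ennreal" and t
    proof -
      have "(\<integral>\<^sup>+y. h y \<partial>lborel) = (\<integral>\<^sup>+y. h y \<partial>distr lborel borel ((+) t))"
        by (simp add: lborel_distr_plus)
      also have "\<dots> = (\<integral>\<^sup>+y. h (t + y) \<partial>lborel)" by (subst nn_integral_distr) auto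
      finally show ?thesis by simp
    qed
    have refl: "(\<integral>\<^sup>+y. h (t - y) \<partial>lborel) = (\<integral>\<^sup>+y. h y \<partial>lborel)"
      if [measurable]: "h \<in> borel_measurable borel" for h :: "'a \<Rightarrow> ennreal" and t
    proof -
      have "distr lborel borel (\<lambda>y. t + (-1) *\<^sub>R y) = (lborel :: 'a measure)"
        using lborel_affine[of "-1" t] by (simp add: density_1)
      then have "(\<integral>\<^sup>+y. h y \<partial>lborel) = (\<integral>\<^sup>+y. h y \<partial>distr lborel borel (\<lambda>y. t + (-1) *\<^sub>R y))"
        by simp
      also have "\<dots> = (\<integral>\<^sup>+y. h (t - y) \<partial>lborel)" by (subst nn_integral_distr) auto
      finally show ?thesis by simp
    qed
    have vim [measurable]: "T -` C \<in> sets borel" if "C \<in> sets borel" for C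
      using measurable_sets[of T borel borel C] that by simp
    have ind: "(\<integral>\<^sup>+y. indicator C (T y) \<partial>lborel) = emeasure lborel (T -` C)"
      if [measurable]: "C \<in> sets borel" for C
      using vim[OF that] by (simp add: indicator_vimage[symmetric] flip: nn_integral_indicator) 
    have shifted: "(\<integral>\<^sup>+y. indicator C (T y - x) \<partial>lborel) = emeasure lborel (T -` C)"
      if [measurable]: "C \<in> sets borel" for C x
    proof -
      have "(\<integral>\<^sup>+y. indicator C (T y - x) \<partial>lborel) = (\<integral>\<^sup>+y. indicator C (T (- S x + y)) \<partial>lborel)"
        by (simp add: linear_add[OF linT] linear_neg[OF linT] linear_diff[OF linT] TS)
      also have "\<dots> = (\<integral>\<^sup>+y. indicator C (T y) \<partial>lborel)"
        by (rule transl[where h = "\<lambda>y. indicator C (T y)"]) simp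
      finally show ?thesis by (simp add: ind)
    qed
    note 1 = shifted[OF \<open>B \<in> sets borel\<close>] and 2 = shifted[OF \<open>A \<in> sets borel\<close>]
    have "emeasure lborel A * emeasure lborel (T -` B)
        = (\<integral>\<^sup>+x. (\<integral>\<^sup>+y. indicator A x * indicator B (T y - x) \<partial>lborel) \<partial>lborel)"
      by (simp add: nn_integral_cmult nn_integral_multc 1)
    also have "\<dots> = (\<integral>\<^sup>+y. (\<integral>\<^sup>+x. indicator A x * indicator B (T y - x) \<partial>lborel) \<partial>lborel)"
      by (rule lborel_pair.Fubini') simp
    also have "\<dots> = (\<integral>\<^sup>+y. (\<integral>\<^sup>+x. indicator A (T y - x) * indicator B x \<partial>lborel) \<partial>lborel)"
    proof (rule nn_integral_cong)
      fix y
      show "(\<integral>\<^sup>+x. indicator A x * indicator B (T y - x) \<partial>lborel)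
          = (\<integral>\<^sup>+x. indicator A (T y - x) * indicator B x \<partial>lborel)"
        using refl[of "\<lambda>x. indicator A x * indicator B (T y - x)" "T y"] by simp
    qed
    also have "\<dots> = (\<integral>\<^sup>+x. (\<integral>\<^sup>+y. indicator A (T y - x) * indicator B x \<partial>lborel) \<partial>lborel)"
      by (rule lborel_pair.Fubini') simp
    also have "\<dots> = emeasure lborel B * emeasure lborel (T -` A)"
      by (simp add: nn_integral_cmult nn_integral_multc 2 mult.commute)
    finally show ?thesis .
  qed
  have vim_ball: "T -` ball 0 1 = ball 0 1"
    using orthogonal_transformation_norm[OF T] by (auto simp: dist_norm)
  have fin: "emeasure lborel (ball (0::'a) 1) \<noteq> \<infinity>"
    using emeasure_lborel_ball_finite[of "0::'a" 1] by simp
  have pos: "emeasure lborel (ball (0::'a) 1) \<noteq> 0"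
    using content_ball_pos[of 1 "0::'a"] by (auto simp: measure_def)
  show ?thesis
  proof (rule measure_eqI)
    fix A :: "'a set" assume "A \<in> sets (distr lborel borel T)"
    then have A: "A \<in> sets borel" by simp
    have "emeasure lborel (ball (0::'a) 1) * emeasure lborel (T -` A) = emeasure lborel (ball (0::'a) 1) * emeasure lborel A"
      using exchange[OF A, of "ball 0 1"] vim_ball by (simp add: mult.commute)
    then have "emeasure lborel (T -` A) = emeasure lborel A"
      using fin pos by (simp add: ennreal_mult_cancel_left)
    then show "emeasure (distr lborel borel T) A = emeasure lborel A"
      using A by (simp add: emeasure_distr)
  qed simp
qed

lemma integral_lborel_rotate:
  fixes h :: "complex \<Rightarrow> complex"
  assumes "norm \<zeta> = 1" and [measurable]: "h \<in> borel_measurable borel"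
  shows "(\<integral>z. h (\<zeta> * z) \<partial>lborel) = (\<integral>z. h z \<partial>lborel)"
proof -
  have "orthogonal_transformation ((*) \<zeta>)"
    using assms(1) by (auto simp: orthogonal_transformation norm_mult intro: linear_times)
  then have "(\<integral>z. h z \<partial>lborel) = (\<integral>z. h z \<partial>distr lborel borel ((*) \<zeta>))"
    by (simp add: lborel_distr_orthogonal_transformation)
  also have "\<dots> = (\<integral>z. h (\<zeta> * z) \<partial>lborel)"
    by (subst integral_distr) auto
  finally show ?thesis by simp
qed

lemma borel_measurable_cnj [measurable]: "cnj \<in> borel_measurable borel"
  by (intro borel_measurable_continuous_onI continuous_intros)

text \<open>A rotation by the angle \<open>\<pi> / (m - q)\<close> changes the sign of \<open>z\<^sup>m cnj z\<^sup>q\<close> and preserves the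
  integral.\<close>

lemma integral_monomials_radial_eq_0:
  fixes W :: "complex \<Rightarrow> real"
  assumes [measurable]: "W \<in> borel_measurable borel"
    and radial: "\<And>z z'. norm z = norm z' \<Longrightarrow> W z = W z'" and "m \<noteq> q"
  shows "(\<integral>z. z ^ m * cnj z ^ q * W z \<partial>lborel) = 0"
proof -
  define t where "t = pi / (real m - real q)"
  have "cis t ^ m * cnj (cis t) ^ q = cis (real m * t) * cis (real q * (- t))"
    by (simp only: cis_cnj Complex.DeMoivre) 
  also have "\<dots> = cis (t * (real m - real q))" by (simp add: cis_mult algebra_simps)
  also have "\<dots> = -1" using \<open>m \<noteq> q\<close> by (simp add: t_def)
  finally have *: "cis t ^ m * cnj (cis t) ^ q = -1" .
  have "(\<integral>z. z ^ m * cnj z ^ q * W z \<partial>lborel) = (\<integral>z. (cis t * z) ^ m * cnj (cis t * z) ^ q * W (cis t * z) \<partial>lborel)"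
    by (rule integral_lborel_rotate[symmetric]) auto
  also have "\<dots> = (\<integral>z. (cis t ^ m * cnj (cis t) ^ q) * (z ^ m * cnj z ^ q * W z) \<partial>lborel)"
  proof (rule Bochner_Integration.integral_cong[OF refl])
    fix z have "W (cis t * z) = W z" by (rule radial) (simp add: norm_mult)
    then show "(cis t * z) ^ m * cnj (cis t * z) ^ q * W (cis t * z) = (cis t ^ m * cnj (cis t) ^ q) * (z ^ m * cnj z ^ q * W z)"
      by (simp add: power_mult_distrib)
  qed
  also have "\<dots> = - (\<integral>z. z ^ m * cnj z ^ q * W z \<partial>lborel)"
    unfolding * by simp
  finally show ?thesis by simp
qed

section \<open>Taylor coefficients as integrals over discs\<close>

definition taylor_coeff :: "(complex \<Rightarrow> complex) \<Rightarrow> nat \<Rightarrow> complex" where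
  "taylor_coeff g n = (deriv ^^ n) g 0 / fact n"

lemma taylor_coeff_sums:
  assumes "g holomorphic_on ball 0 R" "z \<in> ball 0 R"
  shows "(\<lambda>n. taylor_coeff g n * z ^ n) sums g z"
  using holomorphic_power_series[OF assms] by (simp add: taylor_coeff_def)

lemma power_mult_power_cnj: "z ^ q * cnj z ^ q = complex_of_real (norm z ^ (2 * q))"
proof -
  have "z ^ q * cnj z ^ q = (z * cnj z) ^ q" by (simp add: power_mult_distrib)
  also have "\<dots> = complex_of_real ((norm z ^ 2) ^ q)"
    unfolding complex_norm_square[symmetric] by simp
  finally show ?thesis by (simp add: power_mult)
qed

text \<open>On a smaller closed disc the power series may be integrated term by term, and only the term
  of index \<open>q - p\<close> survives. The radial weight \<open>W\<close> makes the result applicable to the second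
  variable, where the slice integrals over the first variable act as a weight.\<close>

lemma integral_cball_taylor:
  fixes g :: "complex \<Rightarrow> complex" and W :: "complex \<Rightarrow> real"
  assumes g: "g holomorphic_on ball 0 R" and r: "0 \<le> r" "r < R"
    and [measurable]: "W \<in> borel_measurable borel"
    and bdd: "\<And>z. \<bar>W z\<bar> \<le> B"
    and radial: "\<And>z z'. norm z = norm z' \<Longrightarrow> W z = W z'"
  defines "V \<equiv> \<lambda>z. indicator (cball 0 r) z * W z"
  shows "(\<integral>z. g z * z ^ p * cnj z ^ q * V z \<partial>lborel)
       = (if p \<le> q then taylor_coeff g (q - p) * (\<integral>z. norm z ^ (2 * q) * V z \<partial>lborel) else 0)"
proof -
  define f where "f = (\<lambda>i z. taylor_coeff g i * (z ^ (i + p) * cnj z ^ q * V z))"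
  have [measurable]: "cball (0::complex) r \<in> sets borel" by simp
  have [measurable]: "V \<in> borel_measurable borel" unfolding V_def by simp
  have Vint: "integrable lborel (\<lambda>z. indicator (cball (0::complex) r) z * B :: real)"
    by (intro integrable_mult_left integrable_real_indicator) (simp_all add: emeasure_lborel_cball_finite[unfolded infinity_ennreal_def])
  have nf: "norm (f i z) \<le> norm (taylor_coeff g i) * r ^ (i + p + q) * (indicator (cball (0::complex) r) z * B)" for i z
  proof (cases "z \<in> cball 0 r")
    case True
    then have "norm z ^ (i + p) * norm z ^ q * \<bar>W z\<bar> \<le> r ^ (i + p) * r ^ q * B"
      using r bdd by (intro mult_mono power_mono) (auto simp: )
    then show ?thesis
      using True by (simp add: f_def V_def norm_mult norm_power power_add mult_left_mono mult.assoc)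
  qed (simp add: f_def V_def)
  have [measurable]: "f i \<in> borel_measurable lborel" for i unfolding f_def by simp
  have fint: "integrable lborel (f i)" for i
    by (rule Bochner_Integration.integrable_bound[OF integrable_mult_right[OF Vint, of "norm (taylor_coeff g i) * r ^ (i + p + q)"]])
       (auto intro!: AE_I2 order_trans[OF nf abs_ge_self])
  have sumR: "summable (\<lambda>i. norm (taylor_coeff g i) * r ^ i)"
  proof -
    obtain s where s: "r < s" "s < R" using dense[OF r(2)] by auto
    have "summable (\<lambda>n. taylor_coeff g n * of_real s ^ n)"
      using taylor_coeff_sums[OF g, of "of_real s"] r s by (auto simp: sums_iff)
    then have "summable (\<lambda>n. norm (taylor_coeff g n * of_real r ^ n))"
      by (rule powser_insidea) (use r s in auto)
    then show ?thesis using r by (simp add: norm_mult norm_power)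
  qed
  have sum0: "summable (\<lambda>i. norm (taylor_coeff g i) * r ^ (i + p + q))"
    using summable_mult2[OF sumR, of "r ^ (p + q)"] by (simp add: power_add mult.assoc)
  have s1: "AE z in lborel. summable (\<lambda>i. norm (f i z))"
    by (rule AE_I2, rule summable_comparison_test'[OF summable_mult2[OF sum0]]) (use nf in auto)
  have s2: "summable (\<lambda>i. \<integral>z. norm (f i z) \<partial>lborel)"
  proof (rule summable_comparison_test'[OF summable_mult2[OF sum0]])
    fix i
    have "(\<integral>z. norm (f i z) \<partial>lborel) \<le> (\<integral>z. norm (taylor_coeff g i) * r ^ (i + p + q) * (indicator (cball (0::complex) r) z * B) \<partial>lborel)"
      proof (rule Bochner_Integration.integral_mono)
      show "integrable lborel (\<lambda>z. norm (f i z))" by (intro integrable_norm fint)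
      show "integrable lborel (\<lambda>z. norm (taylor_coeff g i) * r ^ (i + p + q) * (indicator (cball (0::complex) r) z * B))"
        by (rule integrable_mult_right) (rule Vint)
    qed (rule nf)
    then show "norm (\<integral>z. norm (f i z) \<partial>lborel) \<le> norm (taylor_coeff g i) * r ^ (i + p + q) * (\<integral>z. indicator (cball (0::complex) r) z * B \<partial>lborel)"
      by (simp only: integral_mult_right_zero) (simp add: )
  qed
  have fsum: "(\<Sum>i. f i z) = g z * z ^ p * cnj z ^ q * V z" for z
  proof (cases "z \<in> cball 0 r")
    case True
    then have "(\<lambda>i. taylor_coeff g i * z ^ i) sums g z"
      using r by (intro taylor_coeff_sums[OF g]) auto
    then have "(\<lambda>i. (taylor_coeff g i * z ^ i) * (z ^ p * cnj z ^ q * V z)) sums (g z * (z ^ p * cnj z ^ q * V z))"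
      by (rule sums_mult2)
    then show ?thesis by (simp add: f_def sums_iff power_add mult_ac)
  qed (simp add: f_def V_def)
  have rad: "V z = V z'" if "norm z = norm z'" for z z'
    using radial[OF that] that by (simp add: V_def indicator_def)
  have orth: "(\<integral>z. f i z \<partial>lborel) = 0" if "i + p \<noteq> q" for i
    using integral_monomials_radial_eq_0[of V, OF _ rad that] by (simp add: f_def)
  have diag: "(\<integral>z. f i z \<partial>lborel) = taylor_coeff g i * (\<integral>z. norm z ^ (2 * q) * V z \<partial>lborel)" if "i + p = q" for i
  proof -
    have "f i z = taylor_coeff g i * complex_of_real (norm z ^ (2 * q) * V z)" for z
      unfolding f_def that power_mult_power_cnj of_real_mult ..
    then show ?thesis by (simp only: integral_mult_right_zero integral_complex_of_real)
  qed
  have "(\<lambda>i. \<integral>z. f i z \<partial>lborel) sums (\<integral>z. (\<Sum>i. f i z) \<partial>lborel)"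
    by (rule sums_integral[OF fint s1 s2])
  then have *: "(\<lambda>i. \<integral>z. f i z \<partial>lborel) sums (\<integral>z. g z * z ^ p * cnj z ^ q * V z \<partial>lborel)"
    by (simp add: fsum)
  show ?thesis
  proof (cases "p \<le> q")
    case True
    have "(\<lambda>i. \<integral>z. f i z \<partial>lborel) sums (\<Sum>i\<in>{q - p}. \<integral>z. f i z \<partial>lborel)"
      by (rule sums_finite) (use orth in auto)
    with * diag[of "q - p"] True show ?thesis by (simp add: sums_iff)
  next
    case False
    then have "(\<integral>z. f i z \<partial>lborel) = 0" for i using orth[of i] by simp
    with * show ?thesis using False by (simp add: sums_iff)
  qed
qed

text \<open>Exhaustion by closed discs extends the identity to an unbounded \<open>g\<close> as long as
  the integral converges absolutely.\<close>

lemma integral_ball_taylor: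
  fixes g :: "complex \<Rightarrow> complex" and W :: "complex \<Rightarrow> real"
  assumes g: "g holomorphic_on ball 0 R"
    and [measurable]: "W \<in> borel_measurable borel"
    and bdd: "\<And>z. \<bar>W z\<bar> \<le> B"
    and radial: "\<And>z z'. norm z = norm z' \<Longrightarrow> W z = W z'"
    and int: "integrable lborel (\<lambda>z. indicator (ball 0 R) z *\<^sub>R (g z * z ^ p * cnj z ^ q * W z))"
  shows "(\<integral>z. indicator (ball 0 R) z *\<^sub>R (g z * z ^ p * cnj z ^ q * W z) \<partial>lborel)
       = (if p \<le> q then taylor_coeff g (q - p) * (\<integral>z. indicator (ball 0 R) z * (norm z ^ (2 * q) * W z) \<partial>lborel) else 0)"
    (is "?L = ?rhs")
proof (cases "R > 0")
  case False
  then have [simp]: "ball (0::complex) R = {}" by (simp add: ball_empty)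
  show ?thesis by simp
next
  case True
  define r where "r = (\<lambda>n::nat. R * (real n / real (Suc n)))"
  have r: "0 \<le> r n" "r n < R" for n using True by (auto simp: r_def divide_simps)
  have "r \<longlonglongrightarrow> R * 1"
    unfolding r_def by (intro tendsto_intros LIMSEQ_n_over_Suc_n)
  then have rlim: "r \<longlonglongrightarrow> R" by simp
  have ind: "(\<lambda>n. indicator (cball 0 (r n)) z :: real) \<longlonglongrightarrow> indicator (ball 0 R) z" for z :: complex
  proof (cases "norm z < R")
    case True
    then have "eventually (\<lambda>n. norm z < r n) sequentially" by (rule order_tendstoD(1)[OF rlim])
    then have "eventually (\<lambda>n. (indicator (cball 0 (r n)) z :: real) = indicator (ball 0 R) z) sequentially"
      by eventually_elim (use True in auto)
    then show ?thesis by (rule tendsto_eventually)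
  next
    case False
    then have "\<not> norm z \<le> r n" for n using r(2)[of n] by linarith
    with False show ?thesis by simp
  qed
  have [measurable]: "cball (0::complex) (r n) \<in> sets borel" "ball (0::complex) R \<in> sets borel" for n by simp_all
  have F_meas [measurable]: "(\<lambda>z. indicator (ball 0 R) z *\<^sub>R (g z * z ^ p * cnj z ^ q * W z)) \<in> borel_measurable lborel"
    using int by simp
  have e1: "g z * z ^ p * cnj z ^ q * of_real (indicator (cball 0 (r n)) z * W z)
      = indicator (cball 0 (r n)) z *\<^sub>R (indicator (ball 0 R) z *\<^sub>R (g z * z ^ p * cnj z ^ q * W z))" for n z
    using r(2)[of n] by (auto simp: indicator_def)
  have l1: "(\<lambda>n. \<integral>z. g z * z ^ p * cnj z ^ q * of_real (indicator (cball 0 (r n)) z * W z) \<partial>lborel) \<longlonglongrightarrow> ?L"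
  proof (rule integral_dominated_convergence[where w = "\<lambda>z. norm (indicator (ball 0 R) z *\<^sub>R (g z * z ^ p * cnj z ^ q * W z))"])
    show "AE z in lborel. (\<lambda>n. g z * z ^ p * cnj z ^ q * of_real (indicator (cball 0 (r n)) z * W z)) 
        \<longlonglongrightarrow> indicator (ball 0 R) z *\<^sub>R (g z * z ^ p * cnj z ^ q * W z)"
    proof (rule AE_I2)
      fix z
      show "(\<lambda>n. g z * z ^ p * cnj z ^ q * of_real (indicator (cball 0 (r n)) z * W z)) 
        \<longlonglongrightarrow> indicator (ball 0 R) z *\<^sub>R (g z * z ^ p * cnj z ^ q * W z)"
        using tendsto_scaleR[OF ind[of z] tendsto_const[of "g z * z ^ p * cnj z ^ q * W z"]]
        by (simp add: scaleR_conv_of_real mult_ac)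
    qed
    show "(\<lambda>z. g z * z ^ p * cnj z ^ q * of_real (indicator (cball 0 (r n)) z * W z)) \<in> borel_measurable lborel" for n
      unfolding e1 by (intro borel_measurable_scaleR borel_measurable_indicator F_meas) simp
    show "AE z in lborel. norm (g z * z ^ p * cnj z ^ q * of_real (indicator (cball 0 (r n)) z * W z))
        \<le> norm (indicator (ball 0 R) z *\<^sub>R (g z * z ^ p * cnj z ^ q * W z))" for n
      unfolding e1 by (auto simp: indicator_def)
  qed (use integrable_norm[OF int] in simp_all)
  have l2: "(\<lambda>n. \<integral>z. norm z ^ (2 * q) * (indicator (cball 0 (r n)) z * W z) \<partial>lborel)
      \<longlonglongrightarrow> (\<integral>z. indicator (ball 0 R) z * (norm z ^ (2 * q) * W z) \<partial>lborel)"
  proof (rule integral_dominated_convergence[where w = "\<lambda>z. indicator (ball 0 R) z * (R ^ (2 * q) * B)"])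
    show "integrable lborel (\<lambda>z::complex. indicator (ball 0 R) z * (R ^ (2 * q) * B) :: real)"
      by (intro integrable_mult_left integrable_real_indicator) (simp_all add: emeasure_lborel_ball_finite[unfolded infinity_ennreal_def])
    show "AE z in lborel. (\<lambda>n. norm z ^ (2 * q) * (indicator (cball 0 (r n)) z * W z)) 
        \<longlonglongrightarrow> indicator (ball 0 R) z * (norm z ^ (2 * q) * W z)"
    proof (rule AE_I2)
      fix z :: complex
      show "(\<lambda>n. norm z ^ (2 * q) * (indicator (cball 0 (r n)) z * W z)) 
        \<longlonglongrightarrow> indicator (ball 0 R) z * (norm z ^ (2 * q) * W z)"
        using tendsto_mult[OF ind[of z] tendsto_const[of "norm z ^ (2 * q) * W z"]]
        by (simp add: mult_ac)
    qed
    show "AE z in lborel. norm (norm z ^ (2 * q) * (indicator (cball 0 (r n)) z * W z)) \<le> indicator (ball 0 R) z * (R ^ (2 * q) * B)" for n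
    proof (rule AE_I2)
      fix z :: complex
      show "norm (norm z ^ (2 * q) * (indicator (cball 0 (r n)) z * W z)) \<le> indicator (ball 0 R) z * (R ^ (2 * q) * B)"
      proof (cases "norm z \<le> r n")
        case True
        then have "norm z < R" using r(2)[of n] by linarith
        then have "norm z ^ (2 * q) * \<bar>W z\<bar> \<le> R ^ (2 * q) * B"
          using bdd[of z] by (intro mult_mono power_mono) auto
        with True \<open>norm z < R\<close> show ?thesis by (simp add: abs_mult)
      next
        case False
        have "0 \<le> B" using bdd[of 0] by linarith
        with False \<open>R > 0\<close> show ?thesis by simp
      qed
    qed
  qed auto
  have c: "(\<integral>z. g z * z ^ p * cnj z ^ q * of_real (indicator (cball 0 (r n)) z * W z) \<partial>lborel)
      = (if p \<le> q then taylor_coeff g (q - p) * of_real (\<integral>z. norm z ^ (2 * q) * (indicator (cball 0 (r n)) z * W z) \<partial>lborel) else 0)" for n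
    by (rule integral_cball_taylor[OF g r \<open>W \<in> borel_measurable borel\<close> bdd radial])
  have l2': "(\<lambda>n. \<integral>z. g z * z ^ p * cnj z ^ q * of_real (indicator (cball 0 (r n)) z * W z) \<partial>lborel) \<longlonglongrightarrow> ?rhs"
    unfolding c using tendsto_mult[OF tendsto_const[of "taylor_coeff g (q - p)"] tendsto_of_real[OF l2]]
    by (cases "p \<le> q") simp_all
  show ?thesis by (rule LIMSEQ_unique[OF l1 l2'])
qed

section \<open>Holomorphic functions of two variables\<close>

lemma holomorphic2_on_imp_continuous_on:
  assumes "holomorphic2_on F \<Omega>"
  shows "continuous_on \<Omega> F"
proof (rule continuous_at_imp_continuous_on, rule ballI)
  fix x assume "x \<in> \<Omega>"
  then obtain a b where "(F has_derivative (\<lambda>w. a * fst w + b * snd w)) (at x)"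
    using assms unfolding holomorphic2_on_def by blast
  then show "isCont F x" by (rule has_derivative_continuous)
qed

lemma holomorphic2_on_mult:
  assumes "holomorphic2_on F \<Omega>" "holomorphic2_on G \<Omega>"
  shows "holomorphic2_on (\<lambda>x. F x * G x) \<Omega>"
  unfolding holomorphic2_on_def
proof
  fix x assume x: "x \<in> \<Omega>"
  obtain a b where F: "(F has_derivative (\<lambda>w. a * fst w + b * snd w)) (at x)"
    using assms(1) x unfolding holomorphic2_on_def by blast
  obtain c d where G: "(G has_derivative (\<lambda>w. c * fst w + d * snd w)) (at x)"
    using assms(2) x unfolding holomorphic2_on_def by blast
  have "((\<lambda>x. F x * G x) has_derivative
      (\<lambda>w. (F x * c + a * G x) * fst w + (F x * d + b * G x) * snd w)) (at x)"
    by (rule has_derivative_eq_rhs[OF has_derivative_mult[OF F G]]) (simp add: algebra_simps)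
  then show "\<exists>a b. ((\<lambda>x. F x * G x) has_derivative (\<lambda>w. a * fst w + b * snd w)) (at x)" by blast
qed

lemma holomorphic2_on_const: "holomorphic2_on (\<lambda>x. c) \<Omega>"
  unfolding holomorphic2_on_def
proof (intro ballI exI[of _ 0])
  fix x show "((\<lambda>x. c) has_derivative (\<lambda>w. 0 * fst w + 0 * snd w)) (at x)" by simp
qed

lemma holomorphic2_on_fst: "holomorphic2_on fst \<Omega>"
  unfolding holomorphic2_on_def
  by (rule ballI, rule exI[of _ 1], rule exI[of _ 0]) (auto intro!: derivative_eq_intros)

lemma holomorphic2_on_snd: "holomorphic2_on snd \<Omega>"
  unfolding holomorphic2_on_def
  by (rule ballI, rule exI[of _ 0], rule exI[of _ 1]) (auto intro!: derivative_eq_intros)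

lemma holomorphic2_on_power: "holomorphic2_on F \<Omega> \<Longrightarrow> holomorphic2_on (\<lambda>x. F x ^ n) \<Omega>"
  by (induction n) (simp_all add: holomorphic2_on_const holomorphic2_on_mult)

lemma holomorphic2_on_add:
  assumes "holomorphic2_on F \<Omega>" "holomorphic2_on G \<Omega>"
  shows "holomorphic2_on (\<lambda>x. F x + G x) \<Omega>"
  unfolding holomorphic2_on_def
proof
  fix x assume x: "x \<in> \<Omega>"
  obtain a b where F: "(F has_derivative (\<lambda>w. a * fst w + b * snd w)) (at x)"
    using assms(1) x unfolding holomorphic2_on_def by blast
  obtain c d where G: "(G has_derivative (\<lambda>w. c * fst w + d * snd w)) (at x)"
    using assms(2) x unfolding holomorphic2_on_def by blast
  have "((\<lambda>x. F x + G x) has_derivative (\<lambda>w. (a + c) * fst w + (b + d) * snd w)) (at x)"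
    by (rule has_derivative_eq_rhs[OF has_derivative_add[OF F G]]) (simp add: algebra_simps)
  then show "\<exists>a b. ((\<lambda>x. F x + G x) has_derivative (\<lambda>w. a * fst w + b * snd w)) (at x)" by blast
qed

lemma holomorphic2_on_sum:
  "(\<And>i. i \<in> A \<Longrightarrow> holomorphic2_on (F i) \<Omega>) \<Longrightarrow> holomorphic2_on (\<lambda>x. \<Sum>i\<in>A. F i x) \<Omega>"
  by (induction A rule: infinite_finite_induct) (simp_all add: holomorphic2_on_const holomorphic2_on_add)

lemma open_slice_fst: "open \<Omega> \<Longrightarrow> open {z. (z, w) \<in> \<Omega>}"
  using open_vimage[of \<Omega> "\<lambda>z. (z, w)"] by (auto simp: vimage_def continuous_on_Pair)

lemma open_slice_snd: "open \<Omega> \<Longrightarrow> open {w. (z, w) \<in> \<Omega>}"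
  using open_vimage[of \<Omega> "\<lambda>w. (z, w)"] by (auto simp: vimage_def continuous_on_Pair)

lemma holomorphic_on_slice_fst:
  assumes "holomorphic2_on F \<Omega>"
  shows "(\<lambda>z. F (z, w)) holomorphic_on {z. (z, w) \<in> \<Omega>}"
proof (rule holomorphic_onI)
  fix z assume "z \<in> {z. (z, w) \<in> \<Omega>}"
  then obtain a b where F: "(F has_derivative (\<lambda>h. a * fst h + b * snd h)) (at (z, w))"
    using assms unfolding holomorphic2_on_def by fastforce
  have "((\<lambda>z. (z, w)) has_derivative (\<lambda>h. (h, 0::complex))) (at z)"
    by (auto intro!: derivative_eq_intros)
  from has_derivative_compose[OF this, of F "\<lambda>h. a * fst h + b * snd h"] F
  have "((\<lambda>z. F (z, w)) has_derivative (\<lambda>h. a * fst (h, 0::complex) + b * snd (h, 0::complex))) (at z)"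
    by simp
  then have "((\<lambda>z. F (z, w)) has_field_derivative a) (at z)"
    by (simp add: has_field_derivative_def)
  then show "(\<lambda>z. F (z, w)) field_differentiable at z within {z. (z, w) \<in> \<Omega>}"
    by (auto simp: field_differentiable_def intro: has_field_derivative_at_within)
qed

lemma holomorphic_on_slice_snd:
  assumes "holomorphic2_on F \<Omega>"
  shows "(\<lambda>w. F (z, w)) holomorphic_on {w. (z, w) \<in> \<Omega>}"
proof (rule holomorphic_onI)
  fix w assume "w \<in> {w. (z, w) \<in> \<Omega>}"
  then obtain a b where F: "(F has_derivative (\<lambda>h. a * fst h + b * snd h)) (at (z, w))"
    using assms unfolding holomorphic2_on_def by fastforce
  have "((\<lambda>w. (z, w)) has_derivative (\<lambda>h. (0::complex, h))) (at w)"
    by (auto intro!: derivative_eq_intros)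
  from has_derivative_compose[OF this, of F "\<lambda>h. a * fst h + b * snd h"] F
  have "((\<lambda>w. F (z, w)) has_derivative (\<lambda>h. a * fst (0::complex, h) + b * snd (0::complex, h))) (at w)"
    by simp
  then have "((\<lambda>w. F (z, w)) has_field_derivative b) (at w)"
    by (simp add: has_field_derivative_def)
  then show "(\<lambda>w. F (z, w)) field_differentiable at w within {w. (z, w) \<in> \<Omega>}"
    by (auto simp: field_differentiable_def intro: has_field_derivative_at_within)
qed

text \<open>The constant depends on \<open>g\<close> only through the bound \<open>C\<close>; this makes the divided differences in
  the next lemma converge uniformly in the second variable.\<close>

lemma taylor_remainder_bound:
  assumes g: "g holomorphic_on ball 0 e" and bd: "\<And>z. z \<in> ball 0 e \<Longrightarrow> norm (g z) < C"
    and h: "norm h < e / 2"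
  shows "norm (g h - (\<Sum>i\<le>j. taylor_coeff g i * h ^ i)) \<le> (fact (Suc j) * C / (e / 4) ^ Suc j / fact j) * norm h ^ Suc j"
proof -
  have e: "e > 0" using h norm_ge_zero[of h] by linarith
  have "norm ((deriv ^^ 0) g h - (\<Sum>i\<le>j. (deriv ^^ i) g 0 * (h - 0) ^ i / fact i))
      \<le> (fact (Suc j) * C / (e / 4) ^ Suc j) * norm (h - 0) ^ Suc j / fact j"
  proof (rule complex_Taylor[of "ball 0 (e/2)"])
    show "((deriv ^^ i) g has_field_derivative (deriv ^^ Suc i) g x) (at x within ball 0 (e / 2))"
      if x: "x \<in> ball 0 (e/2)" for i x
    proof -
      have "(deriv ^^ i) g holomorphic_on ball 0 e" by (intro holomorphic_higher_deriv g) auto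
      moreover have "x \<in> ball 0 e" using x e by auto
      ultimately have "((deriv ^^ i) g has_field_derivative deriv ((deriv ^^ i) g) x) (at x)"
        by (intro holomorphic_derivI) auto
      then show ?thesis by (simp add: has_field_derivative_at_within)
    qed
    show "norm ((deriv ^^ Suc j) g x) \<le> fact (Suc j) * C / (e / 4) ^ Suc j" if x: "x \<in> ball 0 (e/2)" for x
    proof -
      have sub: "cball x (e/4) \<subseteq> ball 0 e"
      proof
        fix y assume "y \<in> cball x (e/4)"
        then have "norm (y - x) \<le> e/4" by (simp add: dist_norm norm_minus_commute)
        then show "y \<in> ball 0 e"
          using norm_triangle_ineq[of x "y - x"] x e by simp
      qed
      have sub': "ball x (e/4) \<subseteq> ball 0 e" using sub ball_subset_cball by blast
      show ?thesis
      proof (rule Cauchy_higher_deriv_bound[where y = 0])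
        show "g holomorphic_on ball x (e/4)" by (rule holomorphic_on_subset[OF g sub'])
        show "continuous_on (cball x (e/4)) g"
          by (rule continuous_on_subset[OF holomorphic_on_imp_continuous_on[OF g] sub])
        show "g w \<in> ball 0 C" if "w \<in> ball x (e/4)" for w using bd sub' that by auto
      qed (use e in auto)
    qed
  qed (use h e in auto)
  then show ?thesis by (simp add: taylor_coeff_def)
qed

text \<open>Induction on \<open>j\<close>: the coefficient of \<open>z\<^sup>j\<close> is the locally uniform limit, as \<open>h \<rightarrow> 0\<close>, of
  \<open>(F(h, w) - \<Sum>i<j. F\<^sub>i(w) h\<^sup>i) / h\<^sup>j\<close>, where the lower coefficients \<open>F\<^sub>i\<close> are already known to be
  holomorphic.\<close>

lemma holomorphic_on_taylor_coeff_slice: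
  assumes F: "holomorphic2_on F \<Omega>" and \<Omega>: "open \<Omega>"
  shows "(\<lambda>w. taylor_coeff (\<lambda>z. F (z, w)) j) holomorphic_on {w. (0, w) \<in> \<Omega>}"
proof -
  have loc: "\<exists>e>0. (\<lambda>w. taylor_coeff (\<lambda>z. F (z, w)) j) holomorphic_on ball w0 e" if w0: "(0, w0) \<in> \<Omega>" for w0
  proof -
    obtain A B where AB: "open A" "open B" "(0, w0) \<in> A \<times> B" "A \<times> B \<subseteq> \<Omega>"
      using open_prod_elim[OF \<Omega> w0] by metis
    obtain e1 e2 where "e1 > 0" "cball 0 e1 \<subseteq> A" "e2 > 0" "cball w0 e2 \<subseteq> B"
      using AB by (meson mem_Sigma_iff open_contains_cball)
    moreover define e where "e = min e1 e2"
    moreover have "cball 0 e \<subseteq> cball (0::complex) e1" "cball w0 e \<subseteq> cball w0 e2"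
      unfolding e_def by (intro subset_cball min.cobounded1 min.cobounded2)+
    ultimately have e: "e > 0" "cball 0 e \<times> cball w0 e \<subseteq> \<Omega>"
      using AB(4) by (simp, blast)
    have "bounded (F ` (cball 0 e \<times> cball w0 e))"
      by (intro compact_imp_bounded compact_continuous_image continuous_on_subset[OF holomorphic2_on_imp_continuous_on[OF F] e(2)] compact_Times compact_cball)
    then obtain C where "\<forall>y \<in> F ` (cball 0 e \<times> cball w0 e). norm y \<le> C"
      unfolding bounded_iff by blast
    then have C: "norm (F (z, w)) < C + 1" if "z \<in> cball 0 e" "w \<in> cball w0 e" for z w
      using that by (auto intro!: le_less_trans[OF _ less_add_one])
    have slice: "(\<lambda>z. F (z, w)) holomorphic_on ball 0 e" if "w \<in> ball w0 e" for w
      by (rule holomorphic_on_subset[OF holomorphic_on_slice_fst[OF F]]) (use that e in auto)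
    have "(\<lambda>w. taylor_coeff (\<lambda>z. F (z, w)) j) holomorphic_on ball w0 e"
    proof (induction j rule: less_induct)
      case (less j)
      define h where "h = (\<lambda>n. of_real (e / 4) * inverse (of_nat (Suc n)) :: complex)"
      define K where "K = fact (Suc j) * (C + 1) / (e / 4) ^ Suc j / fact j"
      have hnz: "h n \<noteq> 0" for n using e by (simp add: h_def del: of_nat_Suc)
      have hle: "norm (h n) \<le> e / 4" for n
      proof -
        have "norm (h n) = norm (complex_of_real (e / 4 * inverse (real (Suc n))))"
          unfolding h_def by (simp del: of_nat_Suc)
        also have "\<dots> = e / 4 * inverse (real (Suc n))"
          unfolding norm_of_real using e(1) by (intro abs_of_nonneg) auto
        also have "\<dots> \<le> e / 4 * 1"
          using e(1) by (intro mult_left_mono inverse_le_1_iff[THEN iffD2]) auto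
        finally show ?thesis by simp
      qed
      have hsm: "norm (h n) < e / 2" for n using hle[of n] e(1) by linarith
      have h0: "h \<longlonglongrightarrow> 0"
        unfolding h_def by (rule tendsto_mult_right_zero[OF LIMSEQ_Suc[OF lim_inverse_n]])
      have bound: "norm ((F (h n, w) - (\<Sum>i<j. taylor_coeff (\<lambda>z. F (z, w)) i * h n ^ i)) / h n ^ j - taylor_coeff (\<lambda>z. F (z, w)) j)
          \<le> K * norm (h n)" if w: "w \<in> ball w0 e" for n w
      proof -
        let ?t = "taylor_coeff (\<lambda>z. F (z, w))"
        have "norm (F (h n, w) - (\<Sum>i\<le>j. ?t i * h n ^ i)) \<le> K * norm (h n) ^ Suc j"
          unfolding K_def by (rule taylor_remainder_bound[OF slice[OF w] _ hsm]) (use C w in auto)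
        moreover have "(F (h n, w) - (\<Sum>i<j. ?t i * h n ^ i)) / h n ^ j - ?t j = (F (h n, w) - (\<Sum>i\<le>j. ?t i * h n ^ i)) / h n ^ j"
          using hnz[of n] by (simp add: lessThan_Suc_atMost[symmetric] diff_divide_distrib add_divide_distrib)
        moreover have "norm (h n) ^ j > 0" using hnz[of n] by simp
        ultimately show ?thesis
          by (simp add: norm_divide norm_power divide_le_eq mult_ac)
      qed
      show ?case
      proof (rule holomorphic_uniform_sequence[where f = "\<lambda>n w. (F (h n, w) - (\<Sum>i<j. taylor_coeff (\<lambda>z. F (z, w)) i * h n ^ i)) / h n ^ j"])
        fix n
        have "(\<lambda>w. F (h n, w)) holomorphic_on ball w0 e"
          by (rule holomorphic_on_subset[OF holomorphic_on_slice_snd[OF F]]) (use hle[of n] e in auto)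
        then show "(\<lambda>w. (F (h n, w) - (\<Sum>i<j. taylor_coeff (\<lambda>z. F (z, w)) i * h n ^ i)) / h n ^ j) holomorphic_on ball w0 e"
          using hnz by (intro holomorphic_intros less.IH) auto
      next
        fix x assume x: "x \<in> ball w0 e"
        then obtain d where d: "d > 0" "cball x d \<subseteq> ball w0 e"
          by (meson open_ball open_contains_cball)
        have "uniform_limit (cball x d) (\<lambda>n w. (F (h n, w) - (\<Sum>i<j. taylor_coeff (\<lambda>z. F (z, w)) i * h n ^ i)) / h n ^ j)
             (\<lambda>w. taylor_coeff (\<lambda>z. F (z, w)) j) sequentially"
        proof (rule uniform_limitI)
          fix \<epsilon> :: real assume "\<epsilon> > 0"
          have "(\<lambda>n. K * norm (h n)) \<longlonglongrightarrow> K * 0"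
            by (intro tendsto_intros tendsto_norm_zero h0)
          then have "eventually (\<lambda>n. K * norm (h n) < \<epsilon>) sequentially"
            using \<open>\<epsilon> > 0\<close> by (intro order_tendstoD(2)) auto
          then show "eventually (\<lambda>n. \<forall>w\<in>cball x d. dist ((F (h n, w) - (\<Sum>i<j. taylor_coeff (\<lambda>z. F (z, w)) i * h n ^ i)) / h n ^ j)
              (taylor_coeff (\<lambda>z. F (z, w)) j) < \<epsilon>) sequentially"
          proof eventually_elim
            case (elim n)
            show ?case
            proof
              fix w assume "w \<in> cball x d"
              then have "w \<in> ball w0 e" using d by blast
              from le_less_trans[OF bound[OF this] elim]
              show "dist ((F (h n, w) - (\<Sum>i<j. taylor_coeff (\<lambda>z. F (z, w)) i * h n ^ i)) / h n ^ j)
                (taylor_coeff (\<lambda>z. F (z, w)) j) < \<epsilon>" by (simp add: dist_norm)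
            qed
          qed
        qed
        with d show "\<exists>d>0. cball x d \<subseteq> ball w0 e \<and> uniform_limit (cball x d) (\<lambda>n w. (F (h n, w) - (\<Sum>i<j. taylor_coeff (\<lambda>z. F (z, w)) i * h n ^ i)) / h n ^ j)
             (\<lambda>w. taylor_coeff (\<lambda>z. F (z, w)) j) sequentially" by blast
      qed auto
    qed
    then show ?thesis using e by blast
  qed
  show ?thesis
  proof (rule holomorphic_onI)
    fix w0 assume "w0 \<in> {w. (0, w) \<in> \<Omega>}"
    then obtain e where "e > 0" "(\<lambda>w. taylor_coeff (\<lambda>z. F (z, w)) j) holomorphic_on ball w0 e"
      using loc by auto
    then have "(\<lambda>w. taylor_coeff (\<lambda>z. F (z, w)) j) field_differentiable at w0"
      by (intro holomorphic_on_imp_differentiable_at[of _ "ball w0 e"]) auto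
    then show "(\<lambda>w. taylor_coeff (\<lambda>z. F (z, w)) j) field_differentiable at w0 within {w. (0, w) \<in> \<Omega>}"
      by (rule field_differentiable_at_within)
  qed
qed

section \<open>Orthogonality of monomials on complete Reinhardt domains\<close>

lemma
  fixes X :: "'a::euclidean_space \<Rightarrow> 'b::{banach, second_countable_topology}"
  assumes "open \<Omega>" "continuous_on \<Omega> X"
  shows integrable_lebesgue_on_open: "integrable (lebesgue_on \<Omega>) X \<longleftrightarrow> integrable lborel (\<lambda>x. indicator \<Omega> x *\<^sub>R X x)"
    and integral_lebesgue_on_open: "integral\<^sup>L (lebesgue_on \<Omega>) X = (\<integral>x. indicator \<Omega> x *\<^sub>R X x \<partial>lborel)"
proof -
  have m: "(\<lambda>x. indicator \<Omega> x *\<^sub>R X x) \<in> borel_measurable lborel"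
    using borel_measurable_continuous_on_indicator[of \<Omega> X] assms by simp
  have s: "\<Omega> \<inter> space lebesgue \<in> sets lebesgue"
    using assms by (simp add: borel_open)
  show "integrable (lebesgue_on \<Omega>) X \<longleftrightarrow> integrable lborel (\<lambda>x. indicator \<Omega> x *\<^sub>R X x)"
    by (simp add: integrable_restrict_space[OF s] integrable_completion[OF m])
  show "integral\<^sup>L (lebesgue_on \<Omega>) X = (\<integral>x. indicator \<Omega> x *\<^sub>R X x \<partial>lborel)"
    by (simp add: integral_restrict_space[OF s] integral_completion[OF m])
qed

lemma borel_measurable_lebesgue_on_open:
  fixes X :: "'a::euclidean_space \<Rightarrow> 'b::{banach, second_countable_topology}"
  assumes "open \<Omega>" "continuous_on \<Omega> X"
  shows "X \<in> borel_measurable (lebesgue_on \<Omega>)"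
  using assms by (intro continuous_imp_measurable_on_sets_lebesgue) (simp_all add: borel_open)

lemma circular_set_eq_ball:
  fixes D :: "complex set"
  assumes "open D" "bounded D" and circ: "\<And>z z'. z \<in> D \<Longrightarrow> norm z' \<le> norm z \<Longrightarrow> z' \<in> D"
  obtains R where "D = ball 0 R"
proof (cases "D = {}")
  case True
  then show ?thesis using that[of 0] by simp
next
  case False
  have bdd: "bdd_above (norm ` D)" using assms(2) by (auto simp: bdd_above_norm)
  have "D = ball 0 (Sup (norm ` D))"
  proof (intro set_eqI iffI)
    fix z assume z: "z \<in> D"
    then obtain e where e: "e > 0" "ball z e \<subseteq> D" using assms(1) by (meson open_contains_ball)
    define u where "u = (if z = 0 then 1 else sgn z)"
    have u: "norm u = 1" "z = of_real (norm z) * u"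
      by (simp_all add: u_def norm_sgn) (simp add: sgn_eq)
    define z' where "z' = z + of_real (e / 2) * u"
    have "z' \<in> ball z e" using e u by (simp add: z'_def dist_norm norm_mult)
    then have "z' \<in> D" using e by blast
    moreover have "norm z' = norm z + e / 2"
    proof -
      have "z' = of_real (norm z + e / 2) * u"
        unfolding z'_def of_real_add distrib_right u(2)[symmetric] ..
      then have "norm z' = \<bar>norm z + e / 2\<bar>" by (simp only: norm_mult u(1) norm_of_real mult_1_right)
      then show ?thesis using e(1) by simp
    qed
    ultimately have "norm z + e / 2 \<le> Sup (norm ` D)"
      using bdd by (metis cSup_upper imageI)
    then show "z \<in> ball 0 (Sup (norm ` D))" using e by simp
  next
    fix z :: complex assume "z \<in> ball 0 (Sup (norm ` D))"
    then have "norm z < Sup (norm ` D)" by simp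
    then obtain y where "y \<in> D" "norm z < norm y"
      using less_cSup_iff[OF _ bdd] False by auto
    then show "z \<in> D" using circ[of y z] by simp
  qed
  then show ?thesis using that by blast
qed

definition taylor_coeff2 :: "(complex2 \<Rightarrow> complex) \<Rightarrow> nat \<Rightarrow> nat \<Rightarrow> complex" where
  "taylor_coeff2 F j k = taylor_coeff (\<lambda>w. taylor_coeff (\<lambda>z. F (z, w)) j) k"

locale bounded_complete_reinhardt =
  fixes \<Omega> :: "complex2 set"
  assumes open_domain: "open \<Omega>" and bounded_domain: "bounded \<Omega>" and nonempty: "\<Omega> \<noteq> {}"
    and complete: "\<lbrakk>(z, w) \<in> \<Omega>; norm z' \<le> norm z; norm w' \<le> norm w\<rbrakk> \<Longrightarrow> (z', w') \<in> \<Omega>"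
begin

lemma slice_fst_ball: "\<exists>R. {z. (z, w) \<in> \<Omega>} = ball 0 R"
proof -
  have "bounded {z. (z, w) \<in> \<Omega>}"
    by (rule bounded_subset[OF bounded_fst[OF bounded_domain]]) force
  then obtain R where "{z. (z, w) \<in> \<Omega>} = ball 0 R"
    by (rule circular_set_eq_ball[OF open_slice_fst[OF open_domain]]) (auto intro: complete)
  then show ?thesis ..
qed

lemma slice_snd_ball: "\<exists>R. {w. (z, w) \<in> \<Omega>} = ball 0 R"
proof -
  have "bounded {w. (z, w) \<in> \<Omega>}"
    by (rule bounded_subset[OF bounded_snd[OF bounded_domain]]) force
  then obtain R where "{w. (z, w) \<in> \<Omega>} = ball 0 R"
    by (rule circular_set_eq_ball[OF open_slice_snd[OF open_domain]]) (auto intro: complete)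
  then show ?thesis ..
qed

lemma coordinate_bound:
  obtains B where "B > 0" "\<And>z w. (z, w) \<in> \<Omega> \<Longrightarrow> norm z \<le> B" "\<And>z w. (z, w) \<in> \<Omega> \<Longrightarrow> norm w \<le> B"
proof -
  obtain B where B: "B > 0" "\<And>x. x \<in> \<Omega> \<Longrightarrow> norm x \<le> B"
    using bounded_domain unfolding bounded_pos by blast
  show ?thesis
  proof (rule that[OF B(1)])
    fix z w assume "(z, w) \<in> \<Omega>"
    from B(2)[OF this] show "norm z \<le> B" "norm w \<le> B"
      using norm_fst_le[of z w] norm_snd_le[of w z] by linarith+
  qed
qed

lemma integrable_bounded:
  fixes X :: "complex2 \<Rightarrow> 'b::{banach, second_countable_topology}"
  assumes "X \<in> borel_measurable (lebesgue_on \<Omega>)" "\<And>x. x \<in> \<Omega> \<Longrightarrow> norm (X x) \<le> C"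
  shows "integrable (lebesgue_on \<Omega>) X"
proof -
  have "\<Omega> \<in> lmeasurable" by (rule bounded_set_imp_lmeasurable[OF bounded_domain]) (simp add: borel_open open_domain)
  then interpret finite_measure "lebesgue_on \<Omega>" by (rule finite_measure_lebesgue_on)
  show ?thesis by (rule integrable_const_bound[of _ C]) (use assms in auto)
qed

definition monomial_norm2 :: "nat \<Rightarrow> nat \<Rightarrow> real" where
  "monomial_norm2 a b = (\<integral>x. norm (fst x) ^ (2 * a) * norm (snd x) ^ (2 * b) \<partial>lebesgue_on \<Omega>)"

lemma monomial_norm2_eq_lborel:
  "monomial_norm2 a b = (\<integral>x. indicator \<Omega> x * (norm (fst x) ^ (2 * a) * norm (snd x) ^ (2 * b)) \<partial>lborel)"
  unfolding monomial_norm2_def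
  by (subst integral_lebesgue_on_open) (auto intro!: open_domain continuous_intros)

lemma integrable_monomial:
  "integrable lborel (\<lambda>x. indicator \<Omega> x * (norm (fst x) ^ (2 * a) * norm (snd x) ^ (2 * b)))"
proof -
  obtain B where B: "B > 0" "\<And>z w. (z, w) \<in> \<Omega> \<Longrightarrow> norm z \<le> B" "\<And>z w. (z, w) \<in> \<Omega> \<Longrightarrow> norm w \<le> B"
    by (rule coordinate_bound) (rule that; assumption)
  have cont: "continuous_on \<Omega> (\<lambda>x. norm (fst x) ^ (2 * a) * norm (snd x) ^ (2 * b))"
    by (intro continuous_intros)
  have "integrable (lebesgue_on \<Omega>) (\<lambda>x. norm (fst x) ^ (2 * a) * norm (snd x) ^ (2 * b))"
  proof (rule integrable_bounded[where C = "B ^ (2 * a) * B ^ (2 * b)"])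
    fix x assume "x \<in> \<Omega>"
    then have "norm (fst x) \<le> B" "norm (snd x) \<le> B" using B(2,3)[of "fst x" "snd x"] by auto
    then show "norm (norm (fst x) ^ (2 * a) * norm (snd x) ^ (2 * b)) \<le> B ^ (2 * a) * B ^ (2 * b)"
      using B(1) by (auto simp: abs_mult intro!: mult_mono power_mono)
  qed (rule borel_measurable_lebesgue_on_open[OF open_domain cont])
  then show ?thesis using integrable_lebesgue_on_open[OF open_domain cont] by simp
qed

lemma integrable_monomial_mult:
  assumes F: "continuous_on \<Omega> F" and int: "integrable (lebesgue_on \<Omega>) F"
  shows "integrable (lebesgue_on \<Omega>) (\<lambda>x. F x * fst x ^ a * cnj (fst x) ^ a' * snd x ^ b * cnj (snd x) ^ b')"
proof -
  obtain B where B: "B > 0" "\<And>z w. (z, w) \<in> \<Omega> \<Longrightarrow> norm z \<le> B" "\<And>z w. (z, w) \<in> \<Omega> \<Longrightarrow> norm w \<le> B"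
    by (rule coordinate_bound) (rule that; assumption)
  show ?thesis
  proof (rule Bochner_Integration.integrable_bound[of _ "\<lambda>x. (B ^ a * B ^ a' * B ^ b * B ^ b') * norm (F x)"])
    show "integrable (lebesgue_on \<Omega>) (\<lambda>x. (B ^ a * B ^ a' * B ^ b * B ^ b') * norm (F x))"
      using int by simp
    show "(\<lambda>x. F x * fst x ^ a * cnj (fst x) ^ a' * snd x ^ b * cnj (snd x) ^ b') \<in> borel_measurable (lebesgue_on \<Omega>)"
      by (intro borel_measurable_lebesgue_on_open open_domain continuous_intros F)
    show "AE x in lebesgue_on \<Omega>. norm (F x * fst x ^ a * cnj (fst x) ^ a' * snd x ^ b * cnj (snd x) ^ b')
      \<le> norm ((B ^ a * B ^ a' * B ^ b * B ^ b') * norm (F x))"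
    proof (rule AE_I2)
      fix x assume "x \<in> space (lebesgue_on \<Omega>)"
      then have x: "norm (fst x) \<le> B" "norm (snd x) \<le> B" using B(2,3)[of "fst x" "snd x"] by auto
      have "norm (fst x) ^ a * norm (fst x) ^ a' * norm (snd x) ^ b * norm (snd x) ^ b' \<le> B ^ a * B ^ a' * B ^ b * B ^ b'"
        by (intro mult_mono power_mono mult_nonneg_nonneg x) (use B in auto)
      from mult_right_mono[OF this norm_ge_zero[of "F x"]]
      show "norm (F x * fst x ^ a * cnj (fst x) ^ a' * snd x ^ b * cnj (snd x) ^ b')
        \<le> norm ((B ^ a * B ^ a' * B ^ b * B ^ b') * norm (F x))"
        using B(1) by (simp add: norm_mult norm_power abs_mult mult_ac)
    qed
  qed
qed

text \<open>Apply the one-variable identity to the slices in \<open>z\<close>, then to the resulting function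
  of \<open>w\<close>, for which the moments \<open>I w\<close> of the slices are a radial weight. Admitting the
  factors \<open>z\<^sup>a\<close> and \<open>w\<^sup>b\<close> covers products of \<open>F\<close> with monomials.\<close>

lemma integral_monomial:
  assumes F: "holomorphic2_on F \<Omega>" and int: "integrable (lebesgue_on \<Omega>) F"
  shows "(\<integral>x. F x * fst x ^ a * cnj (fst x) ^ a' * snd x ^ b * cnj (snd x) ^ b' \<partial>lebesgue_on \<Omega>)
       = (if a \<le> a' \<and> b \<le> b' then taylor_coeff2 F (a' - a) (b' - b) * monomial_norm2 a' b' else 0)"
proof -
  have contF: "continuous_on \<Omega> F" by (rule holomorphic2_on_imp_continuous_on[OF F])
  obtain R where R: "\<And>w. {z. (z, w) \<in> \<Omega>} = ball 0 (R w)"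
    using choice[of "\<lambda>w R. {z. (z, w) \<in> \<Omega>} = ball 0 R"] slice_fst_ball by blast
  have indR: "indicator \<Omega> (z, w) = (indicator (ball 0 (R w)) z :: real)" for z w
    using R[of w] by (auto simp: indicator_def)
  obtain M where M: "{w. (0, w) \<in> \<Omega>} = ball 0 M" using slice_snd_ball[of 0] by blast
  obtain B where B: "B > 0" "\<And>z w. (z, w) \<in> \<Omega> \<Longrightarrow> norm z \<le> B" "\<And>z w. (z, w) \<in> \<Omega> \<Longrightarrow> norm w \<le> B"
    by (rule coordinate_bound) (rule that; assumption)
  have [measurable]: "\<Omega> \<in> sets (borel \<Otimes>\<^sub>M borel)"
    unfolding borel_prod using open_domain by (rule borel_open)
  \<comment> \<open>The weight left over for the second variable after integrating over the slices.\<close>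
  define I where "I = (\<lambda>w. \<integral>z. indicator \<Omega> (z, w) * norm z ^ (2 * a') \<partial>lborel)"
  have [measurable]: "I \<in> borel_measurable borel"
    unfolding I_def by measurable
  have I_ball: "I w = (\<integral>z. indicator (ball (0::complex) (R w)) z * norm z ^ (2 * a') \<partial>lborel)" for w
    by (simp add: I_def indR)
  have I_rad: "I w = I w'" if "norm w = norm w'" for w w'
  proof -
    have "(z, w) \<in> \<Omega> \<longleftrightarrow> (z, w') \<in> \<Omega>" for z
      using complete[of z w z w'] complete[of z w' z w] that by auto
    then show ?thesis by (simp add: I_def indicator_def)
  qed
  have intB: "integrable lborel (\<lambda>z. indicator (cball (0::complex) B) z * B ^ (2 * a'))"
    by (intro integrable_mult_left integrable_real_indicator) (simp_all add: emeasure_lborel_cball_finite[unfolded infinity_ennreal_def])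
  have I_int_bd: "indicator \<Omega> (z, w) * norm z ^ (2 * a') \<le> indicator (cball (0::complex) B) z * B ^ (2 * a')" for z w
    using B(2)[of z w] B(1) by (auto simp: indicator_def intro: power_mono)
  have I_int: "integrable lborel (\<lambda>z. indicator \<Omega> (z, w) * norm z ^ (2 * a') :: real)" for w
  proof (rule Bochner_Integration.integrable_bound[OF intB])
    have "0 \<le> indicator \<Omega> (z, w) * norm z ^ (2 * a')" for z by simp
    then show "AE z in lborel. norm (indicator \<Omega> (z, w) * norm z ^ (2 * a')) \<le> norm (indicator (cball 0 B) z * B ^ (2 * a'))"
      using order_trans[OF I_int_bd abs_ge_self] by (intro AE_I2) (simp only: real_norm_def abs_of_nonneg)
  qed measurable
  have I_bd: "\<bar>I w\<bar> \<le> (\<integral>z. indicator (cball (0::complex) B) z * B ^ (2 * a') \<partial>lborel)" for w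
  proof -
    have "I w \<ge> 0" unfolding I_def by (intro integral_nonneg_AE AE_I2) simp
    moreover have "I w \<le> (\<integral>z. indicator (cball (0::complex) B) z * B ^ (2 * a') \<partial>lborel)"
      unfolding I_def by (rule Bochner_Integration.integral_mono[OF I_int intB I_int_bd])
    ultimately show ?thesis by simp
  qed
  have I_out: "indicator (ball 0 M) w * I w = I w" for w
  proof (cases "w \<in> ball 0 M")
    case False
    then have "(0, w) \<notin> \<Omega>" using M by auto
    then have "(z, w) \<notin> \<Omega>" for z using complete[of z w 0 w] by auto
    then have "I w = 0" by (simp add: I_def)
    then show ?thesis by simp
  qed simp
  have inner: "AE w in lborel. (\<integral>z. indicator \<Omega> (z, w) *\<^sub>R (F (z, w) * z ^ a * cnj z ^ a' * w ^ b * cnj w ^ b') \<partial>lborel)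
      = (if a \<le> a' then taylor_coeff (\<lambda>z. F (z, w)) (a' - a) * w ^ b * cnj w ^ b' * I w else 0)" for b b'
  proof -
    have "integrable lborel (\<lambda>x. indicator \<Omega> x *\<^sub>R (F x * fst x ^ a * cnj (fst x) ^ a' * snd x ^ 0 * cnj (snd x) ^ 0))"
      using integrable_monomial_mult[OF contF int, of a a' 0 0]
      by (subst (asm) integrable_lebesgue_on_open) (auto intro!: open_domain continuous_intros contF)
    then have "integrable (lborel \<Otimes>\<^sub>M lborel) (\<lambda>(z, w). indicator \<Omega> (z, w) *\<^sub>R (F (z, w) * z ^ a * cnj z ^ a'))"
      by (simp add: lborel_prod case_prod_beta')
    from lborel_pair.AE_integrable_snd[OF this]
    show ?thesis
    proof eventually_elim
      case (elim w)
      have hol: "(\<lambda>z. F (z, w)) holomorphic_on ball 0 (R w)"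
        using holomorphic_on_slice_fst[OF F, of w] by (simp add: R)
      have "(\<integral>z. indicator \<Omega> (z, w) *\<^sub>R (F (z, w) * z ^ a * cnj z ^ a' * w ^ b * cnj w ^ b') \<partial>lborel)
          = (\<integral>z. (indicator (ball 0 (R w)) z *\<^sub>R (F (z, w) * z ^ a * cnj z ^ a' * complex_of_real 1)) * (w ^ b * cnj w ^ b') \<partial>lborel)"
        by (simp add: indR mult_ac)
      also have "\<dots> = (\<integral>z. indicator (ball 0 (R w)) z *\<^sub>R (F (z, w) * z ^ a * cnj z ^ a' * complex_of_real 1) \<partial>lborel) * (w ^ b * cnj w ^ b')"
        by (rule integral_mult_left_zero)
      also have "\<dots> = (if a \<le> a' then taylor_coeff (\<lambda>z. F (z, w)) (a' - a) * I w else 0) * (w ^ b * cnj w ^ b')"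
        using integral_ball_taylor[OF hol, of "\<lambda>_. 1" 1 a a'] elim by (simp add: I_ball indR)
      finally show ?case by simp
    qed
  qed
  have X: "integrable (lborel \<Otimes>\<^sub>M lborel) (\<lambda>(z, w). indicator \<Omega> (z, w) *\<^sub>R (F (z, w) * z ^ a * cnj z ^ a' * w ^ b * cnj w ^ b'))"
  proof -
    have "integrable lborel (\<lambda>x. indicator \<Omega> x *\<^sub>R (F x * fst x ^ a * cnj (fst x) ^ a' * snd x ^ b * cnj (snd x) ^ b'))"
      using integrable_monomial_mult[OF contF int, of a a' b b']
      by (subst (asm) integrable_lebesgue_on_open) (auto intro!: open_domain continuous_intros contF)
    then show ?thesis by (simp add: lborel_prod case_prod_beta')
  qed
  have "(\<integral>x. F x * fst x ^ a * cnj (fst x) ^ a' * snd x ^ b * cnj (snd x) ^ b' \<partial>lebesgue_on \<Omega>)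
      = (\<integral>x. indicator \<Omega> x *\<^sub>R (F x * fst x ^ a * cnj (fst x) ^ a' * snd x ^ b * cnj (snd x) ^ b') \<partial>lborel)"
    by (intro integral_lebesgue_on_open open_domain continuous_intros contF)
  also have "\<dots> = (\<integral>w. (\<integral>z. indicator \<Omega> (z, w) *\<^sub>R (F (z, w) * z ^ a * cnj z ^ a' * w ^ b * cnj w ^ b') \<partial>lborel) \<partial>lborel)"
    using lborel_pair.integral_snd[OF X] by (simp add: lborel_prod case_prod_beta')
  finally have lhs: "(\<integral>x. F x * fst x ^ a * cnj (fst x) ^ a' * snd x ^ b * cnj (snd x) ^ b' \<partial>lebesgue_on \<Omega>)
      = (\<integral>w. (\<integral>z. indicator \<Omega> (z, w) *\<^sub>R (F (z, w) * z ^ a * cnj z ^ a' * w ^ b * cnj w ^ b') \<partial>lborel) \<partial>lborel)" .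
  show ?thesis
  proof (cases "a \<le> a'")
    case False
    have "(\<integral>w. (\<integral>z. indicator \<Omega> (z, w) *\<^sub>R (F (z, w) * z ^ a * cnj z ^ a' * w ^ b * cnj w ^ b') \<partial>lborel) \<partial>lborel) = (\<integral>w. 0 \<partial>(lborel :: complex measure))"
      by (rule integral_cong_AE) (use inner[of b b'] False borel_measurable_integrable[OF lborel_pair.integrable_snd[OF X]] in auto)
    with lhs False show ?thesis by simp
  next
    case True
    define G where "G = (\<lambda>w. taylor_coeff (\<lambda>z. F (z, w)) (a' - a))"
    have G: "G holomorphic_on ball 0 M"
      unfolding G_def M[symmetric] by (rule holomorphic_on_taylor_coeff_slice[OF F open_domain])
    define Y where "Y = (\<lambda>w. indicator (ball 0 M) w *\<^sub>R (G w * w ^ b * cnj w ^ b' * complex_of_real (I w)))"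
    have mY: "Y \<in> borel_measurable lborel"
    proof -
      have "continuous_on (ball 0 M) (\<lambda>w. G w * w ^ b * cnj w ^ b')"
        by (intro continuous_intros holomorphic_on_imp_continuous_on[OF G])
      then have [measurable]: "(\<lambda>w. indicator (ball 0 M) w *\<^sub>R (G w * w ^ b * cnj w ^ b')) \<in> borel_measurable borel"
        by (intro borel_measurable_continuous_on_indicator) auto
      have "Y = (\<lambda>w. (indicator (ball 0 M) w *\<^sub>R (G w * w ^ b * cnj w ^ b')) * complex_of_real (I w))"
        by (simp add: Y_def)
      also have "\<dots> \<in> borel_measurable lborel" by measurable
      finally show ?thesis .
    qed
    have aeY: "AE w in lborel. (\<integral>z. indicator \<Omega> (z, w) *\<^sub>R (F (z, w) * z ^ a * cnj z ^ a' * w ^ b * cnj w ^ b') \<partial>lborel) = Y w"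
      using inner[of b b']
    proof eventually_elim
      case (elim w)
      have "Y w = G w * w ^ b * cnj w ^ b' * complex_of_real (indicator (ball 0 M) w * I w)"
        by (simp add: Y_def scaleR_conv_of_real)
      with elim True show ?case by (simp only: I_out G_def if_True)
    qed
    have mL: "(\<lambda>w. \<integral>z. indicator \<Omega> (z, w) *\<^sub>R (F (z, w) * z ^ a * cnj z ^ a' * w ^ b * cnj w ^ b') \<partial>lborel) \<in> borel_measurable lborel"
      by (rule borel_measurable_integrable[OF lborel_pair.integrable_snd[OF X]])
    have intY: "integrable lborel Y"
      using integrable_cong_AE[OF mL mY aeY] lborel_pair.integrable_snd[OF X] by simp
    have "(\<integral>w. (\<integral>z. indicator \<Omega> (z, w) *\<^sub>R (F (z, w) * z ^ a * cnj z ^ a' * w ^ b * cnj w ^ b') \<partial>lborel) \<partial>lborel) = (\<integral>w. Y w \<partial>lborel)"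
      by (rule integral_cong_AE[OF mL mY aeY])
    also have "\<dots> = (if b \<le> b' then taylor_coeff G (b' - b) * (\<integral>w. indicator (ball 0 M) w * (norm w ^ (2 * b') * I w) \<partial>lborel) else 0)"
      unfolding Y_def
      by (rule integral_ball_taylor[OF G _ I_bd I_rad]) (use intY in \<open>simp_all add: Y_def\<close>)
    also have "taylor_coeff G (b' - b) = taylor_coeff2 F (a' - a) (b' - b)"
      by (simp add: taylor_coeff2_def G_def)
    also have "(\<integral>w. indicator (ball 0 M) w * (norm w ^ (2 * b') * I w) \<partial>lborel) = monomial_norm2 a' b'"
    proof -
      have P: "integrable (lborel \<Otimes>\<^sub>M lborel) (\<lambda>(z, w). indicator \<Omega> (z, w) * (norm z ^ (2 * a') * norm w ^ (2 * b')) :: real)"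
        using integrable_monomial[of a' b'] by (simp add: lborel_prod case_prod_beta')
      have "monomial_norm2 a' b' = (\<integral>x. indicator \<Omega> x * (norm (fst x) ^ (2 * a') * norm (snd x) ^ (2 * b')) \<partial>lborel)"
        by (rule monomial_norm2_eq_lborel)
      also have "\<dots> = (\<integral>w. (\<integral>z. indicator \<Omega> (z, w) * (norm z ^ (2 * a') * norm w ^ (2 * b')) \<partial>lborel) \<partial>lborel)"
        using lborel_pair.integral_snd[OF P] by (simp add: lborel_prod case_prod_beta')
      also have "\<dots> = (\<integral>w. norm w ^ (2 * b') * I w \<partial>lborel)"
      proof (rule Bochner_Integration.integral_cong[OF refl])
        fix w
        have "(\<integral>z. indicator \<Omega> (z, w) * (norm z ^ (2 * a') * norm w ^ (2 * b')) \<partial>lborel)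
            = (\<integral>z. (indicator \<Omega> (z, w) * norm z ^ (2 * a')) * norm w ^ (2 * b') \<partial>lborel)"
          by (simp add: mult.assoc)
        then show "(\<integral>z. indicator \<Omega> (z, w) * (norm z ^ (2 * a') * norm w ^ (2 * b')) \<partial>lborel) = norm w ^ (2 * b') * I w"
          by (simp add: I_def mult.commute)
      qed
      also have "\<dots> = (\<integral>w. norm w ^ (2 * b') * (indicator (ball 0 M) w * I w) \<partial>lborel)"
        unfolding I_out ..
      finally show ?thesis by (simp add: mult_ac)
    qed
    finally show ?thesis using lhs True by simp
  qed
qed

end

section \<open>Moments and Taylor coefficients\<close>

lemma integral_lborel_mult_fst_snd:
  fixes A B :: "complex \<Rightarrow> real"
  assumes A: "integrable lborel A" and B: "integrable lborel B"
  shows "integrable lborel (\<lambda>x. A (fst x) * B (snd x))"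
    and "(\<integral>x. A (fst x) * B (snd x) \<partial>lborel) = (\<integral>z. A z \<partial>lborel) * (\<integral>w. B w \<partial>lborel)"
proof -
  have [measurable]: "A \<in> borel_measurable borel" "B \<in> borel_measurable borel"
    using A B by simp_all
  have int: "integrable (lborel \<Otimes>\<^sub>M lborel) (\<lambda>(z, w). A z * B w)"
  proof (rule lborel_pair.Fubini_integrable)
    have "(\<lambda>z. \<integral>w. norm (A z * B w) \<partial>lborel) = (\<lambda>z. \<bar>A z\<bar> * (\<integral>w. \<bar>B w\<bar> \<partial>lborel))"
      by (simp add: abs_mult)
    then show "integrable lborel (\<lambda>z. \<integral>w. norm (case (z, w) of (z, w) \<Rightarrow> A z * B w) \<partial>lborel)"
      using A by simp
    show "AE z in lborel. integrable lborel (\<lambda>w. case (z, w) of (z, w) \<Rightarrow> A z * B w)"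
      using B by simp
  qed measurable
  then show "integrable lborel (\<lambda>x. A (fst x) * B (snd x))"
    by (simp add: lborel_prod case_prod_beta')
  show "(\<integral>x. A (fst x) * B (snd x) \<partial>lborel) = (\<integral>z. A z \<partial>lborel) * (\<integral>w. B w \<partial>lborel)"
    using lborel_pair.integral_fst[OF int] by (simp add: lborel_prod case_prod_beta')
qed

text \<open>The annulus \<open>s/2 \<le> |w| < s\<close> carries at least half of the mass of \<open>|w|\<^bsup>2n\<^esup>\<close> on the disc of radius
  \<open>s\<close>, uniformly in \<open>n\<close>, and on it \<open>|w|\<^bsup>2k\<^esup>\<close> is bounded below.\<close>

definition annulus_moment :: "real \<Rightarrow> nat \<Rightarrow> real" where
  "annulus_moment s n = (\<integral>w. indicator (ball (0::complex) s - ball 0 (s / 2)) w * norm w ^ (2 * n) \<partial>lborel)"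

lemma integrable_indicator_power_norm:
  assumes "A \<in> sets borel" "A \<subseteq> cball (0::complex) s"
  shows "integrable lborel (\<lambda>w. indicator A w * norm w ^ (2 * n) :: real)"
proof (rule Bochner_Integration.integrable_bound[of _ "\<lambda>w. indicator (cball (0::complex) s) w * s ^ (2 * n)"])
  have [measurable]: "A \<in> sets borel" by (rule assms)
  show "integrable lborel (\<lambda>w. indicator (cball (0::complex) s) w * s ^ (2 * n) :: real)"
    by (intro integrable_mult_left integrable_real_indicator) (simp_all add: emeasure_lborel_cball_finite[unfolded infinity_ennreal_def])
  show "(\<lambda>w. indicator A w * norm w ^ (2 * n) :: real) \<in> borel_measurable lborel" by measurable
  show "AE w in lborel. norm (indicator A w * norm w ^ (2 * n)) \<le> norm (indicator (cball 0 s) w * s ^ (2 * n))"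
    using assms(2) by (intro AE_I2) (auto simp: indicator_def intro!: power_mono)
qed

lemma measure_lborel_annulus:
  assumes "s > 0"
  shows "measure lborel (ball (0::complex) s - ball 0 (s / 2)) = 3 * measure lborel (ball (0::complex) (s / 2))"
proof -
  have "measure lborel (ball (0::complex) s - ball 0 (s / 2)) = measure lborel (ball (0::complex) s) - measure lborel (ball (0::complex) (s / 2))"
    using assms emeasure_lborel_ball_finite[of "0::complex" s] by (intro measure_Diff) auto
  then show ?thesis using assms by (simp add: content_ball power_divide)
qed

lemma annulus_moment_ge:
  assumes "s > 0"
  shows "3 * measure lborel (ball (0::complex) (s / 2)) * (s / 2) ^ (2 * n) \<le> annulus_moment s n"
proof -
  have "3 * measure lborel (ball (0::complex) (s / 2)) * (s / 2) ^ (2 * n)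
      = (\<integral>w. indicator (ball (0::complex) s - ball 0 (s / 2)) w * (s / 2) ^ (2 * n) \<partial>lborel)"
    by (simp add: measure_lborel_annulus[OF assms])
  also have "\<dots> \<le> annulus_moment s n"
    unfolding annulus_moment_def
  proof (rule Bochner_Integration.integral_mono)
    have "emeasure lborel (ball (0::complex) s - ball 0 (s / 2)) \<le> emeasure lborel (ball (0::complex) s)"
      by (intro emeasure_mono) auto
    also have "\<dots> < \<infinity>" by (rule emeasure_lborel_ball_finite)
    finally show "integrable lborel (\<lambda>w::complex. indicator (ball 0 s - ball 0 (s / 2)) w * (s / 2) ^ (2 * n) :: real)"
      by (intro integrable_mult_left integrable_real_indicator) simp_all
    show "integrable lborel (\<lambda>w::complex. indicator (ball 0 s - ball 0 (s / 2)) w * norm w ^ (2 * n) :: real)"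
      by (rule integrable_indicator_power_norm[of _ s]) auto
    show "indicator (ball 0 s - ball 0 (s / 2)) w * (s / 2) ^ (2 * n) \<le> indicator (ball 0 s - ball 0 (s / 2)) w * norm w ^ (2 * n)" for w :: complex
      using assms by (auto simp: indicator_def intro!: power_mono)
  qed
  finally show ?thesis .
qed

lemma annulus_moment_pos: "s > 0 \<Longrightarrow> annulus_moment s n > 0"
  using annulus_moment_ge[of s n] content_ball_pos[of "s / 2" "0::complex"]
  by (intro less_le_trans[OF _ annulus_moment_ge]) simp_all

lemma disc_moment_le:
  assumes "s > 0"
  shows "(\<integral>w. indicator (ball (0::complex) s) w * norm w ^ (2 * n) \<partial>lborel) \<le> 2 * annulus_moment s n"
proof -
  let ?I = "\<lambda>A. (\<integral>w. indicator A w * norm (w::complex) ^ (2 * n) \<partial>lborel)"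
  have "?I (ball 0 s) = (\<integral>w. indicator (ball (0::complex) (s / 2)) w * norm w ^ (2 * n)
      + indicator (ball (0::complex) s - ball 0 (s / 2)) w * norm w ^ (2 * n) \<partial>lborel)"
    using assms by (intro Bochner_Integration.integral_cong refl) (auto simp: indicator_def)
  also have "\<dots> = ?I (ball 0 (s / 2)) + annulus_moment s n"
    unfolding annulus_moment_def
    by (intro Bochner_Integration.integral_add integrable_indicator_power_norm[of _ s]) (use assms in auto)
  also have "?I (ball 0 (s / 2)) \<le> (\<integral>w. indicator (ball (0::complex) (s / 2)) w * (s / 2) ^ (2 * n) \<partial>lborel)"
  proof (rule Bochner_Integration.integral_mono)
    show "integrable lborel (\<lambda>w::complex. indicator (ball 0 (s / 2)) w * (s / 2) ^ (2 * n) :: real)"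
      by (intro integrable_mult_left integrable_real_indicator) (simp_all add: emeasure_lborel_ball_finite[unfolded infinity_ennreal_def])
    show "integrable lborel (\<lambda>w::complex. indicator (ball 0 (s / 2)) w * norm w ^ (2 * n) :: real)"
      by (rule integrable_indicator_power_norm[of _ "s / 2"]) auto
    show "indicator (ball 0 (s / 2)) w * norm w ^ (2 * n) \<le> indicator (ball 0 (s / 2)) w * (s / 2) ^ (2 * n)" for w :: complex
      by (auto simp: indicator_def intro!: power_mono)
  qed
  also have "\<dots> = measure lborel (ball (0::complex) (s / 2)) * (s / 2) ^ (2 * n)" by simp
  also have "\<dots> \<le> annulus_moment s n"
  proof -
    have "0 \<le> measure lborel (ball (0::complex) (s / 2)) * (s / 2) ^ (2 * n)" using assms by simp
    then show ?thesis using annulus_moment_ge[OF assms, of n] by linarith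
  qed
  finally show ?thesis by simp
qed

lemma annulus_moment_add_ge:
  assumes "s > 0"
  shows "(s / 2) ^ (2 * k) * annulus_moment s n \<le> annulus_moment s (k + n)"
proof -
  have "(s / 2) ^ (2 * k) * annulus_moment s n
    = (\<integral>w. (s / 2) ^ (2 * k) * (indicator (ball (0::complex) s - ball 0 (s / 2)) w * norm w ^ (2 * n)) \<partial>lborel)"
    unfolding annulus_moment_def by simp
  also have "\<dots> \<le> annulus_moment s (k + n)"
    unfolding annulus_moment_def
  proof (rule Bochner_Integration.integral_mono)
    show "integrable lborel (\<lambda>w::complex. (s / 2) ^ (2 * k) * (indicator (ball 0 s - ball 0 (s / 2)) w * norm w ^ (2 * n)) :: real)"
      by (intro integrable_mult_right integrable_indicator_power_norm[of _ s]) auto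
    show "integrable lborel (\<lambda>w::complex. indicator (ball 0 s - ball 0 (s / 2)) w * norm w ^ (2 * (k + n)) :: real)"
      by (rule integrable_indicator_power_norm[of _ s]) auto
    show "(s / 2) ^ (2 * k) * (indicator (ball 0 s - ball 0 (s / 2)) w * norm w ^ (2 * n))
        \<le> indicator (ball 0 s - ball 0 (s / 2)) w * norm w ^ (2 * (k + n))" for w :: complex
    proof (cases "w \<in> ball 0 s - ball 0 (s / 2)")
      case True
      then have "(s / 2) ^ (2 * k) \<le> norm w ^ (2 * k)" using assms by (intro power_mono) auto
      then show ?thesis using True
        by (simp add: power_add distrib_left mult_right_mono)
    qed simp
  qed
  finally show ?thesis .
qed

lemma taylor_coeff_mult:
  assumes "f holomorphic_on S" "g holomorphic_on S" "open S" "0 \<in> S"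
  shows "taylor_coeff (\<lambda>w. f w * g w) n = (\<Sum>i\<le>n. taylor_coeff f i * taylor_coeff g (n - i))"
proof -
  have "taylor_coeff (\<lambda>w. f w * g w) n = (\<Sum>i\<le>n. of_nat (n choose i) * (deriv ^^ i) f 0 * (deriv ^^ (n - i)) g 0 / fact n)"
    unfolding taylor_coeff_def higher_deriv_mult[OF assms] by (simp add: sum_divide_distrib atMost_atLeast0)
  also have "\<dots> = (\<Sum>i\<le>n. taylor_coeff f i * taylor_coeff g (n - i))"
    by (intro sum.cong refl) (simp add: taylor_coeff_def binomial_fact)
  finally show ?thesis .
qed

lemma taylor_coeff_0 [simp]: "taylor_coeff g 0 = g 0"
  by (simp add: taylor_coeff_def)

lemma taylor_coeff2_0_left: "taylor_coeff2 F 0 n = taylor_coeff (\<lambda>w. F (0, w)) n"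
  by (simp add: taylor_coeff2_def)

lemma taylor_coeff2_0_right: "taylor_coeff2 F n 0 = taylor_coeff (\<lambda>z. F (z, 0)) n"
  by (simp add: taylor_coeff2_def)

context bounded_complete_reinhardt
begin

lemma zero_mem: "(0, 0) \<in> \<Omega>"
proof -
  obtain z w where "(z, w) \<in> \<Omega>" using nonempty by auto
  then show ?thesis by (rule complete) auto
qed

lemma taylor_coeff2_mult_0_left:
  assumes "holomorphic2_on F \<Omega>" "holomorphic2_on G \<Omega>"
  shows "taylor_coeff2 (\<lambda>x. F x * G x) 0 n = (\<Sum>i\<le>n. taylor_coeff2 F 0 i * taylor_coeff2 G 0 (n - i))"
  unfolding taylor_coeff2_0_left
  by (rule taylor_coeff_mult[of _ "{w. (0, w) \<in> \<Omega>}"])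
     (use assms zero_mem in \<open>auto intro: holomorphic_on_slice_snd open_slice_snd[OF open_domain]\<close>)

lemma taylor_coeff2_mult_0_right:
  assumes "holomorphic2_on F \<Omega>" "holomorphic2_on G \<Omega>"
  shows "taylor_coeff2 (\<lambda>x. F x * G x) n 0 = (\<Sum>i\<le>n. taylor_coeff2 F i 0 * taylor_coeff2 G (n - i) 0)"
  unfolding taylor_coeff2_0_right
  by (rule taylor_coeff_mult[of _ "{z. (z, 0) \<in> \<Omega>}"])
     (use assms zero_mem in \<open>auto intro: holomorphic_on_slice_fst open_slice_fst[OF open_domain]\<close>)

lemma slice_taylor_sums:
  assumes "holomorphic2_on F \<Omega>" "(z, w) \<in> \<Omega>"
  shows "(\<lambda>j. taylor_coeff (\<lambda>z. F (z, w)) j * z ^ j) sums F (z, w)"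
proof -
  obtain R where R: "{z. (z, w) \<in> \<Omega>} = ball 0 R" using slice_fst_ball by blast
  show ?thesis
    using taylor_coeff_sums[of "\<lambda>z. F (z, w)" R z] holomorphic_on_slice_fst[OF assms(1), of w] assms(2)
    unfolding R[symmetric] by simp
qed

lemma taylor_coeff_slice_sums:
  assumes "holomorphic2_on F \<Omega>" "(z, w) \<in> \<Omega>"
  shows "(\<lambda>k. taylor_coeff2 F j k * w ^ k) sums taylor_coeff (\<lambda>z. F (z, w)) j"
proof -
  obtain M where M: "{w. (0, w) \<in> \<Omega>} = ball 0 M" using slice_snd_ball by blast
  have "w \<in> {w. (0, w) \<in> \<Omega>}" using complete[OF assms(2), of 0 w] by simp
  then show ?thesis
    using taylor_coeff_sums[of "\<lambda>w. taylor_coeff (\<lambda>z. F (z, w)) j" M w] holomorphic_on_taylor_coeff_slice[OF assms(1) open_domain, of j]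
    unfolding M[symmetric] taylor_coeff2_def by simp
qed

lemma independent_fst:
  assumes F: "holomorphic2_on F \<Omega>" and 0: "\<And>j k. j \<ge> 1 \<Longrightarrow> taylor_coeff2 F j k = 0"
    and "(z, w) \<in> \<Omega>" "(z', w) \<in> \<Omega>"
  shows "F (z, w) = F (z', w)"
proof -
  have *: "F (z, w) = F (0, w)" if z: "(z, w) \<in> \<Omega>" for z
  proof -
    have "taylor_coeff (\<lambda>z. F (z, w)) j = 0" if "j \<ge> 1" for j
      using taylor_coeff_slice_sums[OF F z, of j] 0[OF that] by (simp add: sums_iff)
    then have "(\<lambda>j. taylor_coeff (\<lambda>z. F (z, w)) j * z ^ j) sums (\<Sum>j\<in>{0}. taylor_coeff (\<lambda>z. F (z, w)) j * z ^ j)"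
      by (intro sums_finite) auto
    from sums_unique2[OF this slice_taylor_sums[OF F z]] show ?thesis by simp
  qed
  show ?thesis using *[OF assms(3)] *[OF assms(4)] by simp
qed

text \<open>The expansion in \<open>z\<close> at fixed \<open>w\<close> has the coefficients \<open>F\<^sub>j(w)\<close>, and each \<open>F\<^sub>j\<close> is constant
  because its own Taylor series stops after the first term.\<close>

lemma independent_snd:
  assumes F: "holomorphic2_on F \<Omega>" and 0: "\<And>j k. k \<ge> 1 \<Longrightarrow> taylor_coeff2 F j k = 0"
    and "(z, w) \<in> \<Omega>" "(z, w') \<in> \<Omega>"
  shows "F (z, w) = F (z, w')"
proof -
  have *: "taylor_coeff (\<lambda>z. F (z, w)) j = taylor_coeff2 F j 0" if z: "(z, w) \<in> \<Omega>" for w j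
  proof -
    have "(\<lambda>k. taylor_coeff2 F j k * w ^ k) sums (\<Sum>k\<in>{0}. taylor_coeff2 F j k * w ^ k)"
      by (intro sums_finite) (use 0[of _ j] in auto)
    from sums_unique2[OF this taylor_coeff_slice_sums[OF F z]] show ?thesis by simp
  qed
  show ?thesis
    using sums_unique2[OF slice_taylor_sums[OF F assms(3), unfolded *[OF assms(3)]]
        slice_taylor_sums[OF F assms(4), unfolded *[OF assms(4)]]] .
qed

text \<open>A product of two annuli inside the domain bounds the norms of all monomials from below.\<close>

lemma monomial_norm2_ge_moments:
  assumes box: "\<And>z w. norm z \<in> {\<rho> / 2..<\<rho>} \<Longrightarrow> norm w \<in> {s / 2..<s} \<Longrightarrow> (z, w) \<in> \<Omega>"
  shows "annulus_moment \<rho> a * annulus_moment s b \<le> monomial_norm2 a b"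
proof -
  let ?A = "\<lambda>z::complex. indicator (ball 0 \<rho> - ball 0 (\<rho> / 2)) z * norm z ^ (2 * a) :: real"
  let ?B = "\<lambda>w::complex. indicator (ball 0 s - ball 0 (s / 2)) w * norm w ^ (2 * b) :: real"
  have A: "integrable lborel ?A" by (rule integrable_indicator_power_norm[of _ \<rho>]) auto
  have B: "integrable lborel ?B" by (rule integrable_indicator_power_norm[of _ s]) auto
  have "annulus_moment \<rho> a * annulus_moment s b = (\<integral>x. ?A (fst x) * ?B (snd x) \<partial>lborel)"
    unfolding integral_lborel_mult_fst_snd(2)[OF A B] annulus_moment_def ..
  also have "\<dots> \<le> monomial_norm2 a b"
    unfolding monomial_norm2_eq_lborel
  proof (rule Bochner_Integration.integral_mono[OF integral_lborel_mult_fst_snd(1)[OF A B] integrable_monomial])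
    fix x :: complex2
    show "?A (fst x) * ?B (snd x) \<le> indicator \<Omega> x * (norm (fst x) ^ (2 * a) * norm (snd x) ^ (2 * b))"
      using box[of "fst x" "snd x"] by (auto simp: indicator_def)
  qed
  finally show ?thesis .
qed

text \<open>The domain lies in a product of two discs, and the exponent in one variable is \<open>0\<close>; hence one
  constant \<open>V\<close>, the area of a disc, serves all \<open>n\<close>.\<close>

lemma monomial_norm2_le_moment:
  obtains V where "V > 0"
    "\<And>s n. \<lbrakk>s > 0; \<And>z w. (z, w) \<in> \<Omega> \<Longrightarrow> norm w < s\<rbrakk> \<Longrightarrow> monomial_norm2 0 n \<le> V * annulus_moment s n"
    "\<And>s n. \<lbrakk>s > 0; \<And>z w. (z, w) \<in> \<Omega> \<Longrightarrow> norm z < s\<rbrakk> \<Longrightarrow> monomial_norm2 n 0 \<le> V * annulus_moment s n"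
proof -
  obtain B where B: "B > 0" "\<And>z w. (z, w) \<in> \<Omega> \<Longrightarrow> norm z \<le> B" "\<And>z w. (z, w) \<in> \<Omega> \<Longrightarrow> norm w \<le> B"
    by (rule coordinate_bound) (rule that; assumption)
  let ?A = "\<lambda>z::complex. indicator (cball 0 B) z * norm z ^ (2 * 0) :: real"
  define v where "v = (\<integral>z. ?A z \<partial>lborel)"
  have v: "v > 0" using B(1) content_cball_pos[of B "0::complex"] by (simp add: v_def)
  have A: "integrable lborel ?A" by (rule integrable_indicator_power_norm[of _ B]) auto
  have le2: "v * (\<integral>w. indicator (ball (0::complex) s) w * norm w ^ (2 * n) \<partial>lborel) \<le> 2 * v * annulus_moment s n"
    if "s > 0" for s n
    using mult_left_mono[OF disc_moment_le[OF that, of n], of v] v by simp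
  show ?thesis
  proof (rule that[of "2 * v"])
    show "0 < 2 * v" using v by simp
  next
    fix s :: real and n :: nat assume s: "s > 0" and sb: "\<And>z w. (z, w) \<in> \<Omega> \<Longrightarrow> norm w < s"
    let ?B = "\<lambda>w::complex. indicator (ball 0 s) w * norm w ^ (2 * n) :: real"
    have B': "integrable lborel ?B" by (rule integrable_indicator_power_norm[of _ s]) auto
    have "monomial_norm2 0 n \<le> (\<integral>x. ?A (fst x) * ?B (snd x) \<partial>lborel)"
      unfolding monomial_norm2_eq_lborel
    proof (rule Bochner_Integration.integral_mono[OF integrable_monomial integral_lborel_mult_fst_snd(1)[OF A B']])
      fix x :: complex2
      show "indicator \<Omega> x * (norm (fst x) ^ (2 * 0) * norm (snd x) ^ (2 * n)) \<le> ?A (fst x) * ?B (snd x)"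
        using B(2)[of "fst x" "snd x"] sb[of "fst x" "snd x"] by (auto simp: indicator_def)
    qed
    also have "\<dots> \<le> 2 * v * annulus_moment s n"
      unfolding integral_lborel_mult_fst_snd(2)[OF A B'] using le2[OF s] by (simp add: v_def)
    finally show "monomial_norm2 0 n \<le> 2 * v * annulus_moment s n" .
  next
    fix s :: real and n :: nat assume s: "s > 0" and sb: "\<And>z w. (z, w) \<in> \<Omega> \<Longrightarrow> norm z < s"
    let ?B = "\<lambda>w::complex. indicator (ball 0 s) w * norm w ^ (2 * n) :: real"
    have B': "integrable lborel ?B" by (rule integrable_indicator_power_norm[of _ s]) auto
    have "monomial_norm2 n 0 \<le> (\<integral>x. ?B (fst x) * ?A (snd x) \<partial>lborel)"
      unfolding monomial_norm2_eq_lborel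
    proof (rule Bochner_Integration.integral_mono[OF integrable_monomial integral_lborel_mult_fst_snd(1)[OF B' A]])
      fix x :: complex2
      show "indicator \<Omega> x * (norm (fst x) ^ (2 * n) * norm (snd x) ^ (2 * 0)) \<le> ?B (fst x) * ?A (snd x)"
        using B(3)[of "fst x" "snd x"] sb[of "fst x" "snd x"] by (auto simp: indicator_def)
    qed
    also have "\<dots> \<le> 2 * v * annulus_moment s n"
      unfolding integral_lborel_mult_fst_snd(2)[OF B' A] using le2[OF s] by (simp add: v_def mult.commute)
    finally show "monomial_norm2 n 0 \<le> 2 * v * annulus_moment s n" .
  qed
qed

end

section \<open>Hankel operators\<close>

lemma discriminant_bound:
  fixes a b c :: real
  assumes "\<And>x. 0 \<le> a * x\<^sup>2 - 2 * b * x + c" "a \<ge> 0"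
  shows "b\<^sup>2 \<le> a * c"
proof (cases "a = 0")
  case True
  have "b = 0"
  proof (rule ccontr)
    assume "b \<noteq> 0"
    then show False using assms(1)[of "(c + 1) / (2 * b)"] True by (simp add: field_simps)
  qed
  then show ?thesis using True by simp
next
  case False
  then have "a > 0" using assms(2) by simp
  then show ?thesis using assms(1)[of "b / a"]
    by (simp add: field_simps power2_eq_square)
qed

lemma L2_measurable: "u \<in> L2 \<Omega> \<Longrightarrow> u \<in> borel_measurable (lebesgue_on \<Omega>)"
  by (simp add: L2_def)

lemma L2_integrable_square: "u \<in> L2 \<Omega> \<Longrightarrow> integrable (lebesgue_on \<Omega>) (\<lambda>z. (norm (u z))\<^sup>2)"
  by (simp add: L2_def)

lemma L2_norm_square: "(L2_norm \<Omega> u)\<^sup>2 = (\<integral>z. (norm (u z))\<^sup>2 \<partial>lebesgue_on \<Omega>)"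
  unfolding L2_norm_def by (intro real_sqrt_pow2 integral_nonneg_AE) simp

lemma L2_norm_nonneg: "L2_norm \<Omega> u \<ge> 0"
  unfolding L2_norm_def by (simp add: integral_nonneg_AE)

lemma L2_mult_integrable:
  assumes u: "u \<in> L2 \<Omega>" and v: "v \<in> L2 \<Omega>"
  shows "integrable (lebesgue_on \<Omega>) (\<lambda>z. u z * v z)"
proof (rule Bochner_Integration.integrable_bound[of _ "\<lambda>z. (norm (u z))\<^sup>2 + (norm (v z))\<^sup>2"])
  show "integrable (lebesgue_on \<Omega>) (\<lambda>z. (norm (u z))\<^sup>2 + (norm (v z))\<^sup>2)"
    by (intro Bochner_Integration.integrable_add L2_integrable_square u v)
  show "(\<lambda>z. u z * v z) \<in> borel_measurable (lebesgue_on \<Omega>)"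
    using L2_measurable[OF u] L2_measurable[OF v] by measurable
  show "AE z in lebesgue_on \<Omega>. norm (u z * v z) \<le> norm ((norm (u z))\<^sup>2 + (norm (v z))\<^sup>2)"
  proof (rule AE_I2)
    fix z
    have "2 * (norm (u z) * norm (v z)) \<le> (norm (u z))\<^sup>2 + (norm (v z))\<^sup>2"
      using sum_squares_bound[of "norm (u z)" "norm (v z)"] by simp
    moreover have "0 \<le> norm (u z) * norm (v z)" by simp
    ultimately have "norm (u z) * norm (v z) \<le> (norm (u z))\<^sup>2 + (norm (v z))\<^sup>2" by linarith
    then show "norm (u z * v z) \<le> norm ((norm (u z))\<^sup>2 + (norm (v z))\<^sup>2)"
      by (simp add: norm_mult)
  qed
qed

lemma L2_cnj: "u \<in> L2 \<Omega> \<Longrightarrow> (\<lambda>z. cnj (u z)) \<in> L2 \<Omega>"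
  unfolding L2_def by (simp add: measurable_compose[OF _ borel_measurable_cnj])

lemma L2_diff:
  assumes u: "u \<in> L2 \<Omega>" and v: "v \<in> L2 \<Omega>"
  shows "(\<lambda>z. u z - v z) \<in> L2 \<Omega>"
proof -
  have [measurable]: "u \<in> borel_measurable (lebesgue_on \<Omega>)" "v \<in> borel_measurable (lebesgue_on \<Omega>)"
    using u v by (simp_all add: L2_measurable)
  have "integrable (lebesgue_on \<Omega>) (\<lambda>z. (norm (u z - v z))\<^sup>2)"
  proof (rule Bochner_Integration.integrable_bound[of _ "\<lambda>z. 2 * (norm (u z))\<^sup>2 + 2 * (norm (v z))\<^sup>2"])
    show "integrable (lebesgue_on \<Omega>) (\<lambda>z. 2 * (norm (u z))\<^sup>2 + 2 * (norm (v z))\<^sup>2)"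
      by (intro Bochner_Integration.integrable_add integrable_mult_right L2_integrable_square u v)
    show "(\<lambda>z. (norm (u z - v z))\<^sup>2) \<in> borel_measurable (lebesgue_on \<Omega>)" by measurable
    show "AE z in lebesgue_on \<Omega>. norm ((norm (u z - v z))\<^sup>2) \<le> norm (2 * (norm (u z))\<^sup>2 + 2 * (norm (v z))\<^sup>2)"
    proof (rule AE_I2)
      fix z
      have "(norm (u z - v z))\<^sup>2 \<le> (norm (u z) + norm (v z))\<^sup>2"
        by (intro power_mono norm_triangle_ineq4) simp
      also have "\<dots> \<le> 2 * (norm (u z))\<^sup>2 + 2 * (norm (v z))\<^sup>2"
        using sum_squares_bound[of "norm (u z)" "norm (v z)"] by (simp add: power2_sum)
      finally show "norm ((norm (u z - v z))\<^sup>2) \<le> norm (2 * (norm (u z))\<^sup>2 + 2 * (norm (v z))\<^sup>2)"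
        by simp
    qed
  qed
  then show ?thesis by (simp add: L2_def)
qed

text \<open>The function \<open>v\<close> enters without a conjugate, as in the pairings with \<open>cnj v\<^sub>n\<close> below.\<close>

lemma L2_Cauchy_Schwarz:
  assumes u: "u \<in> L2 \<Omega>" and v: "v \<in> L2 \<Omega>"
  shows "norm (\<integral>z. u z * v z \<partial>lebesgue_on \<Omega>) \<le> L2_norm \<Omega> u * L2_norm \<Omega> v"
proof -
  let ?I = "\<integral>z. norm (u z) * norm (v z) \<partial>lebesgue_on \<Omega>"
  have int: "integrable (lebesgue_on \<Omega>) (\<lambda>z. norm (u z) * norm (v z))"
    using integrable_norm[OF L2_mult_integrable[OF u v]] by (simp add: norm_mult)
  have "0 \<le> (L2_norm \<Omega> u)\<^sup>2 * x\<^sup>2 - 2 * ?I * x + (L2_norm \<Omega> v)\<^sup>2" for x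
  proof -
    have "0 \<le> (\<integral>z. (x * norm (u z) - norm (v z))\<^sup>2 \<partial>lebesgue_on \<Omega>)"
      by (intro integral_nonneg_AE) simp
    also have "\<dots> = (\<integral>z. x\<^sup>2 * (norm (u z))\<^sup>2 - (2 * x) * (norm (u z) * norm (v z)) + (norm (v z))\<^sup>2 \<partial>lebesgue_on \<Omega>)"
      by (intro Bochner_Integration.integral_cong refl) (simp add: power2_eq_square algebra_simps)
    also have "\<dots> = x\<^sup>2 * (L2_norm \<Omega> u)\<^sup>2 - (2 * x) * ?I + (L2_norm \<Omega> v)\<^sup>2"
      using int L2_integrable_square[OF u] L2_integrable_square[OF v]
      by (simp add: L2_norm_square)
    finally show ?thesis by (simp add: mult_ac)
  qed
  then have "?I\<^sup>2 \<le> (L2_norm \<Omega> u)\<^sup>2 * (L2_norm \<Omega> v)\<^sup>2"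
    by (rule discriminant_bound) simp
  then have "?I\<^sup>2 \<le> (L2_norm \<Omega> u * L2_norm \<Omega> v)\<^sup>2" by (simp add: power_mult_distrib)
  then have "?I \<le> L2_norm \<Omega> u * L2_norm \<Omega> v"
    by (rule power2_le_imp_le) (simp add: L2_norm_nonneg)
  moreover have "norm (\<integral>z. u z * v z \<partial>lebesgue_on \<Omega>) \<le> ?I"
    using integral_norm_bound[of "lebesgue_on \<Omega>" "\<lambda>z. u z * v z"] by (simp add: norm_mult)
  ultimately show ?thesis by linarith
qed

lemma bergman_space_L2: "g \<in> bergman_space \<Omega> \<Longrightarrow> g \<in> L2 \<Omega>"
  and bergman_space_holomorphic: "g \<in> bergman_space \<Omega> \<Longrightarrow> holomorphic2_on g \<Omega>"
  by (auto simp: bergman_space_def)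

context bounded_complete_reinhardt
begin

lemma L2_bounded:
  assumes "X \<in> borel_measurable (lebesgue_on \<Omega>)" "\<And>x. x \<in> \<Omega> \<Longrightarrow> norm (X x) \<le> C"
  shows "X \<in> L2 \<Omega>"
proof -
  have "integrable (lebesgue_on \<Omega>) (\<lambda>z. (norm (X z))\<^sup>2)"
    by (rule integrable_bounded[where C = "C\<^sup>2"]) (use assms in \<open>auto intro!: power_mono\<close>)
  with assms(1) show ?thesis by (simp add: L2_def)
qed

lemma L2_mult_bounded:
  assumes u: "u \<in> L2 \<Omega>" and X: "X \<in> borel_measurable (lebesgue_on \<Omega>)" "\<And>x. x \<in> \<Omega> \<Longrightarrow> norm (X x) \<le> C"
  shows "(\<lambda>x. u x * X x) \<in> L2 \<Omega>"
proof -
  have [measurable]: "u \<in> borel_measurable (lebesgue_on \<Omega>)" "X \<in> borel_measurable (lebesgue_on \<Omega>)"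
    using u X by (simp_all add: L2_measurable)
  have "integrable (lebesgue_on \<Omega>) (\<lambda>z. (norm (u z * X z))\<^sup>2)"
  proof (rule Bochner_Integration.integrable_bound[of _ "\<lambda>z. (norm (u z))\<^sup>2 * C\<^sup>2"])
    show "integrable (lebesgue_on \<Omega>) (\<lambda>z. (norm (u z))\<^sup>2 * C\<^sup>2)"
      by (intro integrable_mult_left L2_integrable_square u)
    show "AE z in lebesgue_on \<Omega>. norm ((norm (u z * X z))\<^sup>2) \<le> norm ((norm (u z))\<^sup>2 * C\<^sup>2)"
    proof (rule AE_I2)
      fix z assume "z \<in> space (lebesgue_on \<Omega>)"
      then have "(norm (X z))\<^sup>2 \<le> C\<^sup>2" using X(2)[of z] by (intro power_mono) auto
      then show "norm ((norm (u z * X z))\<^sup>2) \<le> norm ((norm (u z))\<^sup>2 * C\<^sup>2)"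
        by (simp add: norm_mult power_mult_distrib mult_left_mono)
    qed
  qed measurable
  then show ?thesis by (simp add: L2_def)
qed

lemma L2_imp_integrable:
  assumes "u \<in> L2 \<Omega>"
  shows "integrable (lebesgue_on \<Omega>) u"
  using L2_mult_integrable[OF assms L2_bounded[of "\<lambda>_. 1" 1]] by simp

lemma bergman_space_bounded:
  assumes "holomorphic2_on g \<Omega>" "\<And>x. x \<in> \<Omega> \<Longrightarrow> norm (g x) \<le> C"
  shows "g \<in> bergman_space \<Omega>"
  unfolding bergman_space_def
  using assms L2_bounded[OF borel_measurable_lebesgue_on_open[OF open_domain holomorphic2_on_imp_continuous_on[OF assms(1)]] assms(2)]
  by simp

text \<open>The pair \<open>(p, q)\<close> stands for the coordinates in either order, so that one argument serves
  both \<open>\<Gamma>\<^sub>1\<close> and \<open>\<Gamma>\<^sub>2\<close>; \<open>N\<close> and \<open>c\<close> are the squared norms of the monomials \<open>p\<^sup>a q\<^sup>b\<close> and the Taylor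
  coefficients indexed accordingly. The constant \<open>\<kappa>\<close> says that \<open>\<parallel>p\<^sup>j q\<^bsup>k+n\<^esup>\<parallel> / \<parallel>q\<^sup>n\<parallel>\<close> stays away from \<open>0\<close>.
  A convergent subsequence of the images of \<open>q\<^sup>n / \<parallel>q\<^sup>n\<parallel>\<close> is then refuted by pairing
  with \<open>cnj (p\<^sup>j q\<^sup>k) q\<^sup>n\<close>.\<close>

lemma hankel_compact_imp_taylor_coeff_eq_0:
  fixes p q :: "complex2 \<Rightarrow> complex"
  assumes pq: "p = fst \<and> q = snd \<and> N = monomial_norm2 \<and> c = taylor_coeff2 \<or>
      p = snd \<and> q = fst \<and> N = (\<lambda>a b. monomial_norm2 b a) \<and> c = (\<lambda>F j k. taylor_coeff2 F k j)"
    and \<kappa>: "\<kappa> > 0" "\<And>n. \<kappa> * N 0 n \<le> N j (k + n)"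
    and Npos: "\<And>n. N 0 n > 0"
    and f: "f \<in> bergman_space \<Omega>" and H: "hankel_compact \<Omega> (\<lambda>z. cnj (f z))"
    and j: "j \<ge> 1"
  shows "c f j k = 0"
proof (rule ccontr)
  assume nz: "c f j k \<noteq> 0"
  let ?\<mu> = "lebesgue_on \<Omega>"
  have fL2: "f \<in> L2 \<Omega>" and fh: "holomorphic2_on f \<Omega>"
    using f by (simp_all add: bergman_space_L2 bergman_space_holomorphic)
  obtain B where "B > 0" "\<And>z w. (z, w) \<in> \<Omega> \<Longrightarrow> norm z \<le> B" "\<And>z w. (z, w) \<in> \<Omega> \<Longrightarrow> norm w \<le> B"
    by (rule coordinate_bound) (rule that; assumption)
  then have B: "B > 0" "\<And>x. x \<in> \<Omega> \<Longrightarrow> norm (p x) \<le> B" "\<And>x. x \<in> \<Omega> \<Longrightarrow> norm (q x) \<le> B"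
    using pq by auto
  have hol [simp]: "holomorphic2_on p \<Omega>" "holomorphic2_on q \<Omega>"
    using pq holomorphic2_on_fst holomorphic2_on_snd by auto
  have cont: "continuous_on \<Omega> p" "continuous_on \<Omega> q"
    by (simp_all add: holomorphic2_on_imp_continuous_on)
  have coeff: "(\<integral>x. F x * p x ^ a * cnj (p x) ^ a' * q x ^ b * cnj (q x) ^ b' \<partial>?\<mu>)
       = (if a \<le> a' \<and> b \<le> b' then c F (a' - a) (b' - b) * N a' b' else 0)"
    if F: "holomorphic2_on F \<Omega>" "integrable ?\<mu> F" for F a a' b b'
    using pq
  proof
    assume *: "p = snd \<and> q = fst \<and> N = (\<lambda>a b. monomial_norm2 b a) \<and> c = (\<lambda>F j k. taylor_coeff2 F k j)"
    have "(\<integral>x. F x * p x ^ a * cnj (p x) ^ a' * q x ^ b * cnj (q x) ^ b' \<partial>?\<mu>)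
        = (\<integral>x. F x * fst x ^ b * cnj (fst x) ^ b' * snd x ^ a * cnj (snd x) ^ a' \<partial>?\<mu>)"
      using * by (simp add: mult_ac)
    then show ?thesis using * integral_monomial[OF F, of b b' a a'] by auto
  qed (use integral_monomial[OF F] in auto)
  have coeff_mult: "c (\<lambda>x. F x * G x) 0 n = (\<Sum>i\<le>n. c F 0 i * c G 0 (n - i))"
    if "holomorphic2_on F \<Omega>" "holomorphic2_on G \<Omega>" for F G n
    using pq taylor_coeff2_mult_0_left[OF that] taylor_coeff2_mult_0_right[OF that] by auto
  have N_eq: "N a b = (\<integral>x. norm (p x) ^ (2 * a) * norm (q x) ^ (2 * b) \<partial>?\<mu>)" for a b
    using pq by (auto simp: monomial_norm2_def mult.commute)
  have meas: "(\<lambda>x. p x ^ a * cnj (p x) ^ a' * q x ^ b * cnj (q x) ^ b') \<in> borel_measurable ?\<mu>" for a a' b b'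
    by (intro borel_measurable_lebesgue_on_open open_domain continuous_intros cont)
  have bd: "norm (p x ^ a * cnj (p x) ^ a' * q x ^ b * cnj (q x) ^ b') \<le> B ^ a * B ^ a' * B ^ b * B ^ b'"
    if "x \<in> \<Omega>" for x a a' b b'
    unfolding norm_mult norm_power complex_mod_cnj
    by (intro mult_mono power_mono mult_nonneg_nonneg B that) (use B in auto)
  have monoL2: "(\<lambda>x. p x ^ a * cnj (p x) ^ a' * q x ^ b * cnj (q x) ^ b') \<in> L2 \<Omega>" for a a' b b'
    by (rule L2_bounded[OF meas bd])
  have monoA: "(\<lambda>x. s * q x ^ n) \<in> bergman_space \<Omega>" for s n
  proof (rule bergman_space_bounded)
    show "holomorphic2_on (\<lambda>x. s * q x ^ n) \<Omega>"
      by (intro holomorphic2_on_mult holomorphic2_on_const holomorphic2_on_power hol)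
    show "norm (s * q x ^ n) \<le> norm s * B ^ n" if "x \<in> \<Omega>" for x
      unfolding norm_mult norm_power by (intro mult_left_mono power_mono B that) auto
  qed
  define s where "s = (\<lambda>n. 1 / sqrt (N 0 n))"
  have s_pos: "s n > 0" for n using Npos by (simp add: s_def)
  define G where "G = (\<lambda>n x. complex_of_real (s n) * q x ^ n)"
  have G: "G n \<in> bergman_space \<Omega>" for n unfolding G_def by (rule monoA)
  have Gnorm: "L2_norm \<Omega> (G n) \<le> 1" for n
  proof -
    have "(norm (G n x))\<^sup>2 = (s n)\<^sup>2 * (norm (p x) ^ (2 * 0) * norm (q x) ^ (2 * n))" for x
      by (simp add: G_def norm_mult norm_power power_mult_distrib mult.commute flip: power_mult)
    then have "(L2_norm \<Omega> (G n))\<^sup>2 = (s n)\<^sup>2 * N 0 n"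
      by (simp only: L2_norm_square integral_mult_right_zero N_eq)
    also have "\<dots> = 1" using Npos[of n] by (simp add: s_def power_divide)
    finally show ?thesis using L2_norm_nonneg[of \<Omega> "G n"] by (simp add: power2_eq_1_iff)
  qed
  have fG: "(\<lambda>x. cnj (f x) * G n x) \<in> L2 \<Omega>" for n
    unfolding G_def
  proof (rule L2_mult_bounded[OF L2_cnj[OF fL2]])
    show "norm (complex_of_real (s n) * q x ^ n) \<le> s n * B ^ n" if "x \<in> \<Omega>" for x
      unfolding norm_mult norm_power using s_pos[of n] B(2,3)[OF that] by (auto intro!: mult_left_mono power_mono)
    show "(\<lambda>x. complex_of_real (s n) * q x ^ n) \<in> borel_measurable ?\<mu>"
      by (intro borel_measurable_lebesgue_on_open open_domain continuous_intros cont)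
  qed
  have int_cnj_mono: "(\<integral>x. q x ^ n * cnj (F x) \<partial>?\<mu>) = cnj (c F 0 n) * N 0 n"
    if F: "holomorphic2_on F \<Omega>" "integrable ?\<mu> F" for F n
  proof -
    have "(\<integral>x. q x ^ n * cnj (F x) \<partial>?\<mu>) = (\<integral>x. cnj (F x * p x ^ 0 * cnj (p x) ^ 0 * q x ^ 0 * cnj (q x) ^ n) \<partial>?\<mu>)"
      by (simp add: mult.commute)
    also have "\<dots> = cnj (\<integral>x. F x * p x ^ 0 * cnj (p x) ^ 0 * q x ^ 0 * cnj (q x) ^ n \<partial>?\<mu>)"
      by (rule Bochner_Integration.integral_cnj)
    also have "\<dots> = cnj (c F 0 n) * N 0 n" unfolding coeff[OF F] by simp
    finally show ?thesis .
  qed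
  \<comment> \<open>Comparing coefficients, the projection of \<open>cnj f q\<^sup>n\<close> is the polynomial
    \<open>\<Sum>i\<le>n. cnj (c f 0 i) (N 0 n / N 0 (n - i)) q\<^bsup>n-i\<^esup>\<close>.\<close>
  have proj_ex: "\<exists>h. h \<in> bergman_space \<Omega> \<and> (\<forall>g\<in>bergman_space \<Omega>. L2_inner \<Omega> (\<lambda>x. cnj (f x) * G n x - h x) g = 0)" for n
  proof -
    define d where "d = (\<lambda>i. s n * cnj (c f 0 i) * N 0 n / N 0 (n - i))"
    define h where "h = (\<lambda>x. \<Sum>i\<le>n. d i * q x ^ (n - i))"
    have hA: "h \<in> bergman_space \<Omega>"
      unfolding h_def
    proof (rule bergman_space_bounded)
      show "holomorphic2_on (\<lambda>x. \<Sum>i\<le>n. d i * q x ^ (n - i)) \<Omega>"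
        by (intro holomorphic2_on_sum holomorphic2_on_mult holomorphic2_on_const holomorphic2_on_power hol)
      show "norm (\<Sum>i\<le>n. d i * q x ^ (n - i)) \<le> (\<Sum>i\<le>n. norm (d i) * B ^ (n - i))" if "x \<in> \<Omega>" for x
        by (intro order_trans[OF norm_sum] sum_mono)
           (auto simp: norm_mult norm_power intro!: mult_left_mono power_mono B that)
    qed
    have "L2_inner \<Omega> (\<lambda>x. cnj (f x) * G n x - h x) g = 0" if g: "g \<in> bergman_space \<Omega>" for g
    proof -
      have gL2: "g \<in> L2 \<Omega>" and gh: "holomorphic2_on g \<Omega>"
        using g by (simp_all add: bergman_space_L2 bergman_space_holomorphic)
      have i1: "integrable ?\<mu> (\<lambda>x. cnj (f x) * G n x * cnj (g x))"
        by (rule L2_mult_integrable[OF fG L2_cnj[OF gL2]])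
      have i2: "integrable ?\<mu> (\<lambda>x. d i * (q x ^ (n - i) * cnj (g x)))" for i
        by (intro integrable_mult_right) (use L2_mult_integrable[OF bergman_space_L2[OF monoA[of 1]] L2_cnj[OF gL2]] in simp)
      have "L2_inner \<Omega> (\<lambda>x. cnj (f x) * G n x - h x) g
          = (\<integral>x. cnj (f x) * G n x * cnj (g x) - (\<Sum>i\<le>n. d i * (q x ^ (n - i) * cnj (g x))) \<partial>?\<mu>)"
        unfolding L2_inner_def h_def by (simp add: left_diff_distrib sum_distrib_right mult.assoc)
      also have "\<dots> = (\<integral>x. cnj (f x) * G n x * cnj (g x) \<partial>?\<mu>) - (\<Sum>i\<le>n. \<integral>x. d i * (q x ^ (n - i) * cnj (g x)) \<partial>?\<mu>)"
        using i1 i2 by simp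
      also have "(\<integral>x. cnj (f x) * G n x * cnj (g x) \<partial>?\<mu>) = s n * (\<integral>x. q x ^ n * cnj (f x * g x) \<partial>?\<mu>)"
        unfolding G_def by (simp add: mult_ac flip: integral_mult_right_zero)
      also have "(\<integral>x. q x ^ n * cnj (f x * g x) \<partial>?\<mu>) = cnj (c (\<lambda>x. f x * g x) 0 n) * N 0 n"
        by (rule int_cnj_mono[OF holomorphic2_on_mult[OF fh gh] L2_mult_integrable[OF fL2 gL2]])
      also have "(\<Sum>i\<le>n. \<integral>x. d i * (q x ^ (n - i) * cnj (g x)) \<partial>?\<mu>) = (\<Sum>i\<le>n. s n * (cnj (c f 0 i) * cnj (c g 0 (n - i))) * N 0 n)"
      proof (rule sum.cong[OF refl])
        fix i
        have "(\<integral>x. d i * (q x ^ (n - i) * cnj (g x)) \<partial>?\<mu>) = d i * (cnj (c g 0 (n - i)) * N 0 (n - i))"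
          by (simp add: int_cnj_mono[OF gh L2_imp_integrable[OF gL2]])
        then show "(\<integral>x. d i * (q x ^ (n - i) * cnj (g x)) \<partial>?\<mu>) = s n * (cnj (c f 0 i) * cnj (c g 0 (n - i))) * N 0 n"
          using Npos[of "n - i"] by (simp add: d_def)
      qed
      also have "s n * (cnj (c (\<lambda>x. f x * g x) 0 n) * N 0 n) - (\<Sum>i\<le>n. s n * (cnj (c f 0 i) * cnj (c g 0 (n - i))) * N 0 n) = 0"
        by (simp add: coeff_mult[OF fh gh] sum_distrib_left sum_distrib_right mult_ac)
      finally show ?thesis .
    qed
    with hA show ?thesis by blast
  qed
  define h where "h = (\<lambda>n. bergman_projection \<Omega> (\<lambda>w. cnj (f w) * G n w))"
  have hA: "h n \<in> bergman_space \<Omega>" for n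
    unfolding h_def bergman_projection_def using someI_ex[OF proj_ex[of n]] by blast
  obtain T where T: "compact_operator \<Omega> T"
    and TH: "\<And>g. g \<in> bergman_space \<Omega> \<Longrightarrow> (\<lambda>z. cnj (f z) * g z) \<in> L2 \<Omega> \<Longrightarrow> AE z in ?\<mu>. T g z = hankel \<Omega> (\<lambda>z. cnj (f z)) g z"
    using H unfolding hankel_compact_def by blast
  have TL2: "T (G n) \<in> L2 \<Omega>" for n using T G[of n] unfolding compact_operator_def by blast
  have "\<forall>n. G n \<in> bergman_space \<Omega> \<and> L2_norm \<Omega> (G n) \<le> 1" using G Gnorm by blast
  then obtain u r where u: "u \<in> L2 \<Omega>" and r: "strict_mono r"
    and lim: "(\<lambda>n. L2_norm \<Omega> (\<lambda>z. T (G (r n)) z - u z)) \<longlonglongrightarrow> 0"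
    using T unfolding compact_operator_def by blast
  \<comment> \<open>\<open>V n\<close> is the conjugate of the test function \<open>v\<^sub>n\<close>.\<close>
  define V where "V = (\<lambda>n x. p x ^ j * q x ^ k * cnj (q x) ^ n)"
  have V: "V n \<in> L2 \<Omega>" for n using monoL2[of j 0 k n] by (simp add: V_def)
  have Vnorm: "L2_norm \<Omega> (V n) = sqrt (N j (k + n))" for n
  proof -
    have "(norm (V n x))\<^sup>2 = norm (p x) ^ (2 * j) * norm (q x) ^ (2 * (k + n))" for x
      by (simp add: V_def norm_mult norm_power power_mult_distrib power_add distrib_left mult.commute flip: power_mult)
    then show ?thesis by (simp add: L2_norm_def N_eq)
  qed
  have pairing: "(\<integral>x. T (G m) x * V n x \<partial>?\<mu>) = s m * cnj (if n \<le> k + m then c f j (k + m - n) * N j (k + m) else 0)" for m n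
  proof -
    have [measurable]: "T (G m) \<in> borel_measurable ?\<mu>" "V n \<in> borel_measurable ?\<mu>"
      "(\<lambda>x. cnj (f x) * G m x) \<in> borel_measurable ?\<mu>" "h m \<in> borel_measurable ?\<mu>"
      by (intro L2_measurable TL2 V fG bergman_space_L2 hA)+
    have ae: "AE x in ?\<mu>. T (G m) x * V n x = cnj (f x) * G m x * V n x - h m x * V n x"
      using TH[OF G fG, of m] by eventually_elim (simp add: hankel_def h_def left_diff_distrib)
    have "(\<integral>x. T (G m) x * V n x \<partial>?\<mu>) = (\<integral>x. cnj (f x) * G m x * V n x - h m x * V n x \<partial>?\<mu>)"
      by (rule integral_cong_AE[OF _ _ ae]) measurable
    also have "\<dots> = (\<integral>x. cnj (f x) * G m x * V n x \<partial>?\<mu>) - (\<integral>x. h m x * V n x \<partial>?\<mu>)"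
      by (intro Bochner_Integration.integral_diff L2_mult_integrable fG V bergman_space_L2 hA)
    \<comment> \<open>The projection part drops out, since \<open>h m * p ^ j\<close> has no term of degree \<open>0\<close> in \<open>p\<close>.\<close>
    also have "(\<integral>x. h m x * V n x \<partial>?\<mu>) = (\<integral>x. h m x * p x ^ j * cnj (p x) ^ 0 * q x ^ k * cnj (q x) ^ n \<partial>?\<mu>)"
      by (simp add: V_def mult_ac)
    also have "\<dots> = 0"
      unfolding coeff[OF bergman_space_holomorphic[OF hA] L2_imp_integrable[OF bergman_space_L2[OF hA]]] using j by simp
    also have "(\<integral>x. cnj (f x) * G m x * V n x \<partial>?\<mu>)
        = (\<integral>x. s m * cnj (f x * p x ^ 0 * cnj (p x) ^ j * q x ^ n * cnj (q x) ^ (k + m)) \<partial>?\<mu>)"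
      by (simp add: V_def G_def power_add mult_ac)
    also have "\<dots> = s m * cnj (\<integral>x. f x * p x ^ 0 * cnj (p x) ^ j * q x ^ n * cnj (q x) ^ (k + m) \<partial>?\<mu>)"
      by (simp only: integral_mult_right_zero Bochner_Integration.integral_cnj)
    also have "\<dots> = s m * cnj (if n \<le> k + m then c f j (k + m - n) * N j (k + m) else 0)"
      unfolding coeff[OF fh L2_imp_integrable[OF fL2]] by simp
    finally show ?thesis by simp
  qed
  have CS: "norm (\<integral>x. (T (G m) x - u x) * V n x \<partial>?\<mu>) \<le> L2_norm \<Omega> (\<lambda>z. T (G m) z - u z) * sqrt (N j (k + n))" for m n
    using L2_Cauchy_Schwarz[OF L2_diff[OF TL2 u] V, of m n] by (simp add: Vnorm)
  \<comment> \<open>Both images are compared with the limit \<open>u\<close>; its pairing with \<open>v\<^sub>n\<close> cancels.\<close>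
  have key: "norm (c f j k) * sqrt \<kappa> \<le> L2_norm \<Omega> (\<lambda>z. T (G n) z - u z) + L2_norm \<Omega> (\<lambda>z. T (G m) z - u z)"
    if mn: "n > k + m" for m n
  proof -
    let ?en = "L2_norm \<Omega> (\<lambda>z. T (G n) z - u z)" and ?em = "L2_norm \<Omega> (\<lambda>z. T (G m) z - u z)"
    have Njpos: "N j (k + n) > 0" using \<kappa>(1) \<kappa>(2)[of n] Npos[of n] by (meson mult_pos_pos less_le_trans)
    have split: "(\<integral>x. (T (G l) x - u x) * V n x \<partial>?\<mu>) = (\<integral>x. T (G l) x * V n x \<partial>?\<mu>) - (\<integral>x. u x * V n x \<partial>?\<mu>)" for l
      using L2_mult_integrable[OF TL2 V, of l n] L2_mult_integrable[OF u V, of n] by (simp add: left_diff_distrib)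
    have eq: "s n * cnj (c f j k * N j (k + n))
        = (\<integral>x. (T (G n) x - u x) * V n x \<partial>?\<mu>) - (\<integral>x. (T (G m) x - u x) * V n x \<partial>?\<mu>)"
      unfolding split pairing using mn by simp
    have "norm (s n * cnj (c f j k * N j (k + n))) \<le> ?en * sqrt (N j (k + n)) + ?em * sqrt (N j (k + n))"
      unfolding eq using norm_triangle_ineq4[of "\<integral>x. (T (G n) x - u x) * V n x \<partial>?\<mu>" "\<integral>x. (T (G m) x - u x) * V n x \<partial>?\<mu>"]
        CS[of n n] CS[of m n] by linarith
    moreover have "norm (s n * cnj (c f j k * N j (k + n))) = (norm (c f j k) * sqrt (N j (k + n) / N 0 n)) * sqrt (N j (k + n))"
    proof -
      have "norm (s n * cnj (c f j k * N j (k + n))) = s n * (norm (c f j k) * N j (k + n))"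
        using s_pos[of n] Njpos by (simp add: norm_mult)
      moreover have "(norm (c f j k) * sqrt (N j (k + n) / N 0 n)) * sqrt (N j (k + n))
          = norm (c f j k) * (sqrt (N j (k + n)) * sqrt (N j (k + n))) / sqrt (N 0 n)"
        by (simp add: real_sqrt_divide)
      moreover have "sqrt (N j (k + n)) * sqrt (N j (k + n)) = N j (k + n)" using Njpos by simp
      ultimately show ?thesis by (simp add: s_def)
    qed
    ultimately have "(norm (c f j k) * sqrt (N j (k + n) / N 0 n)) * sqrt (N j (k + n)) \<le> (?en + ?em) * sqrt (N j (k + n))"
      by (simp add: distrib_right)
    then have "norm (c f j k) * sqrt (N j (k + n) / N 0 n) \<le> ?en + ?em"
      using Njpos by (simp add: mult_le_cancel_right)
    moreover have "norm (c f j k) * sqrt \<kappa> \<le> norm (c f j k) * sqrt (N j (k + n) / N 0 n)"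
      using \<kappa>(2)[of n] Npos[of n] by (intro mult_left_mono) (simp_all add: le_divide_eq)
    ultimately show ?thesis by linarith
  qed
  define \<delta> where "\<delta> = norm (c f j k) * sqrt \<kappa>"
  have "\<delta> > 0" using nz \<kappa>(1) by (simp add: \<delta>_def)
  then have "eventually (\<lambda>n. L2_norm \<Omega> (\<lambda>z. T (G (r n)) z - u z) < \<delta> / 2) sequentially"
    by (intro order_tendstoD(2)[OF lim]) simp
  then obtain n0 where n0: "\<And>n. n \<ge> n0 \<Longrightarrow> L2_norm \<Omega> (\<lambda>z. T (G (r n)) z - u z) < \<delta> / 2"
    by (auto simp: eventually_sequentially)
  \<comment> \<open>An index far enough out that the image of \<open>G (r n0)\<close> pairs to \<open>0\<close> with \<open>v\<^bsub>r l\<^esub>\<close>.\<close>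
  define l where "l = max n0 (Suc (k + r n0))"
  have "r l \<ge> l" by (rule strict_mono_imp_increasing[OF r])
  then have "r l > k + r n0" by (simp add: l_def)
  from key[OF this] n0[of l] n0[of n0] show False
    unfolding \<delta>_def[symmetric] by (simp add: l_def)
qed

end

section \<open>Analytic discs in the boundary\<close>

text \<open>If \<open>|z'| \<le> |z|\<close>, then \<open>z'\<close> lies on the segment between two antipodal points of the circle of
  radius \<open>|z|\<close>, both of which are rotations of \<open>z\<close>.\<close>

lemma convex_reinhardt_imp_complete:
  assumes "is_domain \<Omega>" "bounded \<Omega>" "convex \<Omega>" "reinhardt \<Omega>"
  shows "bounded_complete_reinhardt \<Omega>"
proof
  show "open \<Omega>" "bounded \<Omega>" "\<Omega> \<noteq> {}" using assms by (auto simp: is_domain_def)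
  have rot: "\<exists>\<zeta>. norm \<zeta> = 1 \<and> \<zeta> * a = b" if "norm a = norm b" for a b :: complex
  proof (cases "a = 0")
    case True
    then show ?thesis using that by (intro exI[of _ 1]) auto
  next
    case False
    then show ?thesis using that by (intro exI[of _ "b / a"]) (auto simp: norm_divide)
  qed
  have same_norm: "(z', w') \<in> \<Omega>" if A: "(z, w) \<in> \<Omega>" "norm z = norm z'" "norm w = norm w'" for z w z' w'
  proof -
    obtain \<zeta>1 \<zeta>2 where "norm \<zeta>1 = 1" "\<zeta>1 * z = z'" "norm \<zeta>2 = 1" "\<zeta>2 * w = w'"
      using rot[OF A(2)] rot[OF A(3)] by blast
    moreover have "(\<zeta>1 * z, \<zeta>2 * w) \<in> \<Omega>"
      using assms(4) A(1) \<open>norm \<zeta>1 = 1\<close> \<open>norm \<zeta>2 = 1\<close> unfolding reinhardt_def by blast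
    ultimately show ?thesis by simp
  qed
  have seg: "\<exists>v t. norm v = norm a \<and> 0 \<le> t \<and> t \<le> 1 \<and> b = t *\<^sub>R v + (1 - t) *\<^sub>R (- v)"
    if "norm b \<le> norm a" for a b :: complex
  proof (cases "a = 0")
    case True
    then show ?thesis using that by (intro exI[of _ 0] exI[of _ 1]) auto
  next
    case False
    define u where "u = (if b = 0 then 1 else sgn b)"
    have u: "norm u = 1" "b = norm b *\<^sub>R u"
      by (simp_all add: u_def norm_sgn) (simp add: sgn_div_norm)
    have "(1 + norm b / norm a) / 2 - (1 - (1 + norm b / norm a) / 2) = norm b / norm a"
      by (simp add: field_simps)
    then have "((1 + norm b / norm a) / 2) *\<^sub>R (norm a *\<^sub>R u) + (1 - (1 + norm b / norm a) / 2) *\<^sub>R (- (norm a *\<^sub>R u))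
      = (norm b / norm a) *\<^sub>R (norm a *\<^sub>R u)"
      by (simp only: scaleR_minus_right scaleR_left_diff_distrib[symmetric] diff_conv_add_uminus[symmetric])
    also have "\<dots> = b" using False u(2) by simp
    finally have "b = ((1 + norm b / norm a) / 2) *\<^sub>R (norm a *\<^sub>R u) + (1 - (1 + norm b / norm a) / 2) *\<^sub>R (- (norm a *\<^sub>R u))" ..
    moreover have "norm (norm a *\<^sub>R u) = norm a" using u(1) by simp
    moreover have "0 \<le> (1 + norm b / norm a) / 2" "(1 + norm b / norm a) / 2 \<le> 1"
      using that False by (simp_all add: divide_simps)
    ultimately show ?thesis by blast
  qed
  show "(z', w') \<in> \<Omega>" if zw: "(z, w) \<in> \<Omega>" and "norm z' \<le> norm z" "norm w' \<le> norm w" for z w z' w'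
  proof -
    obtain v t where v: "norm v = norm z" "0 \<le> t" "t \<le> 1" "z' = t *\<^sub>R v + (1 - t) *\<^sub>R (- v)"
      using seg[OF \<open>norm z' \<le> norm z\<close>] by blast
    have "(v, w) \<in> \<Omega>" "(- v, w) \<in> \<Omega>" using v(1) by (auto intro: same_norm[OF zw])
    then have "t *\<^sub>R (v, w) + (1 - t) *\<^sub>R (- v, w) \<in> \<Omega>"
      using v by (intro convexD[OF assms(3)]) auto
    moreover have "t *\<^sub>R (v, w) + (1 - t) *\<^sub>R (- v, w) = (z', w)"
      using v(4) by (simp add: scaleR_left_diff_distrib)
    ultimately have z'w: "(z', w) \<in> \<Omega>" by simp
    obtain v t where v: "norm v = norm w" "0 \<le> t" "t \<le> 1" "w' = t *\<^sub>R v + (1 - t) *\<^sub>R (- v)"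
      using seg[OF \<open>norm w' \<le> norm w\<close>] by blast
    have "(z', v) \<in> \<Omega>" "(z', - v) \<in> \<Omega>" using v(1) by (auto intro: same_norm[OF z'w])
    then have "t *\<^sub>R (z', v) + (1 - t) *\<^sub>R (z', - v) \<in> \<Omega>"
      using v by (intro convexD[OF assms(3)]) auto
    moreover have "t *\<^sub>R (z', v) + (1 - t) *\<^sub>R (z', - v) = (z', w')"
      using v(4) by (simp add: scaleR_left_diff_distrib)
    ultimately show ?thesis by simp
  qed
qed

text \<open>A subset of the real line has empty interior, against the open mapping theorem.\<close>

lemma holomorphic_real_valued_constant:
  assumes h: "h holomorphic_on S" and S: "open S" "connected S"
    and real: "\<And>z. z \<in> S \<Longrightarrow> Im (h z) = 0"
  shows "h constant_on S"
proof (rule ccontr)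
  assume nc: "\<not> h constant_on S"
  then have "S \<noteq> {}" by (auto simp: constant_on_def)
  then obtain z where z: "z \<in> S" by blast
  have "open (h ` S)" by (rule open_mapping_thm[OF h S S(1) _ nc]) simp
  then obtain e where e: "e > 0" "ball (h z) e \<subseteq> h ` S"
    using z by (meson imageI open_contains_ball)
  have "h z + \<i> * of_real (e / 2) \<in> ball (h z) e" using e(1) by (simp add: dist_norm norm_mult)
  then obtain y where "y \<in> S" "h y = h z + \<i> * of_real (e / 2)" using e(2) by (metis imageE subsetD)
  then show False using real[of y] real[of z] z e(1) by simp
qed

context bounded_complete_reinhardt
begin

lemma closure_complete:
  assumes "(z, w) \<in> closure \<Omega>" "norm z' \<le> norm z" "norm w' \<le> norm w"
  shows "(z', w') \<in> closure \<Omega>"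
proof -
  have mult: "\<exists>a. norm a \<le> 1 \<and> y' = a * y" if "norm y' \<le> norm y" for y y' :: complex
  proof (cases "y = 0")
    case True
    then show ?thesis using that by (intro exI[of _ 0]) auto
  next
    case False
    then show ?thesis using that by (intro exI[of _ "y' / y"]) (auto simp: norm_divide)
  qed
  obtain a b where ab: "norm a \<le> 1" "z' = a * z" "norm b \<le> 1" "w' = b * w"
    using mult[OF assms(2)] mult[OF assms(3)] by blast
  obtain X where X: "\<And>n. X n \<in> \<Omega>" "X \<longlonglongrightarrow> (z, w)"
    using assms(1) unfolding closure_sequential by blast
  define Y where "Y = (\<lambda>n. (a * fst (X n), b * snd (X n)))"
  have "Y n \<in> \<Omega>" for n
  proof -
    have "(fst (X n), snd (X n)) \<in> \<Omega>" using X(1)[of n] by simp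
    then show ?thesis
      unfolding Y_def by (rule complete) (use ab in \<open>auto simp: norm_mult intro: mult_left_le_one_le\<close>)
  qed
  moreover have "Y \<longlonglongrightarrow> (z', w')"
    unfolding Y_def ab using tendsto_fst[OF X(2)] tendsto_snd[OF X(2)] by (intro tendsto_intros) simp_all
  ultimately show ?thesis unfolding closure_sequential by blast
qed

text \<open>Take a supporting hyperplane with normal \<open>a\<close>. Rotating both coordinates of \<open>y\<close> so that they are
  antiparallel to those of \<open>a\<close> replaces the inner product by \<open>- (|a\<^sub>1| |y\<^sub>1| + |a\<^sub>2| |y\<^sub>2|)\<close>.\<close>

lemma frontier_supporting_weights:
  assumes "convex \<Omega>" "x \<in> frontier \<Omega>"
  obtains \<alpha> \<beta> where "\<alpha> \<ge> 0" "\<beta> \<ge> 0" "\<alpha> > 0 \<or> \<beta> > 0"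
    "\<And>y. y \<in> closure \<Omega> \<Longrightarrow> \<alpha> * norm (fst y) + \<beta> * norm (snd y) \<le> \<alpha> * norm (fst x) + \<beta> * norm (snd x)"
proof -
  have "x \<in> closure \<Omega>" "x \<notin> rel_interior \<Omega>"
    using assms(2) open_domain by (auto simp: frontier_def rel_interior_open interior_open)
  then obtain a where a: "a \<noteq> 0" "\<And>y. y \<in> closure \<Omega> \<Longrightarrow> a \<bullet> x \<le> a \<bullet> y"
    using supporting_hyperplane_relative_frontier[OF assms(1)] by metis
  define \<alpha> \<beta> where "\<alpha> = norm (fst a)" and "\<beta> = norm (snd a)"
  have opp: "\<exists>b. norm b = norm z \<and> d \<bullet> b = - (norm d * norm z)" for d z :: complex
  proof (cases "d = 0")
    case False
    then have "norm (- norm z *\<^sub>R sgn d) = norm z" by (simp add: norm_sgn)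
    moreover have "d \<bullet> (- norm z *\<^sub>R sgn d) = - (norm d * norm z)"
      using False by (simp add: sgn_div_norm dot_square_norm power2_eq_square)
    ultimately show ?thesis by blast
  qed auto
  have le: "\<alpha> * norm (fst y) + \<beta> * norm (snd y) \<le> - (a \<bullet> x)" if y: "y \<in> \<Omega>" for y
  proof -
    obtain b1 b2 where b: "norm b1 = norm (fst y)" "fst a \<bullet> b1 = - (norm (fst a) * norm (fst y))"
      "norm b2 = norm (snd y)" "snd a \<bullet> b2 = - (norm (snd a) * norm (snd y))"
      using opp by metis
    have "(b1, b2) \<in> \<Omega>" using complete[of "fst y" "snd y" b1 b2] y b by simp
    then have "a \<bullet> x \<le> a \<bullet> (b1, b2)" using a(2) closure_subset by blast
    also have "\<dots> = - (\<alpha> * norm (fst y) + \<beta> * norm (snd y))"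
      using b by (simp add: inner_prod_def \<alpha>_def \<beta>_def)
    finally show ?thesis by simp
  qed
  have "closure \<Omega> \<subseteq> {y. \<alpha> * norm (fst y) + \<beta> * norm (snd y) \<le> - (a \<bullet> x)}"
    using le by (intro closure_minimal closed_Collect_le continuous_intros) auto
  moreover have "- (a \<bullet> x) \<le> \<alpha> * norm (fst x) + \<beta> * norm (snd x)"
    using Cauchy_Schwarz_ineq2[of "fst a" "fst x"] Cauchy_Schwarz_ineq2[of "snd a" "snd x"]
    by (simp add: inner_prod_def \<alpha>_def \<beta>_def abs_le_iff)
  ultimately have "\<alpha> * norm (fst y) + \<beta> * norm (snd y) \<le> \<alpha> * norm (fst x) + \<beta> * norm (snd x)" if "y \<in> closure \<Omega>" for y
    using that by (auto intro: order_trans)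
  moreover have "\<alpha> > 0 \<or> \<beta> > 0" using a(1) by (auto simp: \<alpha>_def \<beta>_def prod_eq_iff)
  ultimately show ?thesis using that[of \<alpha> \<beta>] by (simp add: \<alpha>_def \<beta>_def)
qed

text \<open>With the weights of a supporting inequality at \<open>\<phi> 0\<close> and rotations \<open>u\<^sub>1, u\<^sub>2\<close> that make the
  coordinates of \<open>\<phi> 0\<close> nonnegative, \<open>\<alpha> u\<^sub>1 \<phi>\<^sub>1 + \<beta> u\<^sub>2 \<phi>\<^sub>2\<close> attains its maximum modulus at \<open>0\<close>, hence is
  constant. Equality in \<open>Re \<le> |.|\<close> then makes each \<open>u\<^sub>i \<phi>\<^sub>i\<close> of positive weight real, so constant. As
  the disc is not trivial, only one weight is positive, and the supporting inequality says
  that the constant coordinate has the largest modulus on the domain.\<close>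

lemma analytic_disc_in_frontier_cases:
  assumes "convex \<Omega>" and \<phi>: "analytic_disc_in (frontier \<Omega>) \<phi>"
  shows "(\<exists>c. (\<forall>\<zeta>\<in>ball 0 1. snd (\<phi> \<zeta>) = c) \<and> (\<forall>y\<in>closure \<Omega>. norm (snd y) \<le> norm c)) \<or>
         (\<exists>c. (\<forall>\<zeta>\<in>ball 0 1. fst (\<phi> \<zeta>) = c) \<and> (\<forall>y\<in>closure \<Omega>. norm (fst y) \<le> norm c))"
proof -
  have h1: "(\<lambda>\<zeta>. fst (\<phi> \<zeta>)) holomorphic_on ball 0 1" and h2: "(\<lambda>\<zeta>. snd (\<phi> \<zeta>)) holomorphic_on ball 0 1"
    and sub: "\<phi> ` ball 0 1 \<subseteq> frontier \<Omega>" and nc: "\<not> \<phi> constant_on ball 0 1"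
    using \<phi> by (auto simp: analytic_disc_in_def)
  have cl: "\<phi> \<zeta> \<in> closure \<Omega>" if "\<zeta> \<in> ball 0 1" for \<zeta>
    using sub that unfolding frontier_def by blast
  have "\<phi> 0 \<in> frontier \<Omega>" using sub by auto
  then obtain \<alpha> \<beta> where ab: "\<alpha> \<ge> 0" "\<beta> \<ge> 0" "\<alpha> > 0 \<or> \<beta> > 0"
    and le: "\<And>y. y \<in> closure \<Omega> \<Longrightarrow> \<alpha> * norm (fst y) + \<beta> * norm (snd y) \<le> \<alpha> * norm (fst (\<phi> 0)) + \<beta> * norm (snd (\<phi> 0))"
    using frontier_supporting_weights[OF assms(1)] by blast
  have unit: "\<exists>u. norm u = 1 \<and> u * z = of_real (norm z)" for z :: complex
  proof (cases "z = 0")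
    case False
    then show ?thesis by (intro exI[of _ "of_real (norm z) / z"]) (auto simp: norm_divide)
  qed (auto intro: exI[of _ 1])
  obtain u1 u2 where u: "norm u1 = 1" "u1 * fst (\<phi> 0) = of_real (norm (fst (\<phi> 0)))"
    "norm u2 = 1" "u2 * snd (\<phi> 0) = of_real (norm (snd (\<phi> 0)))"
    using unit by metis
  define c where "c = \<alpha> * norm (fst (\<phi> 0)) + \<beta> * norm (snd (\<phi> 0))"
  have "c \<ge> 0" using ab by (simp add: c_def)
  define g where "g = (\<lambda>\<zeta>. of_real \<alpha> * (u1 * fst (\<phi> \<zeta>)) + of_real \<beta> * (u2 * snd (\<phi> \<zeta>)))"
  have g0: "g 0 = of_real c" by (simp add: g_def u c_def)
  have gle: "norm (g \<zeta>) \<le> c" if "\<zeta> \<in> ball 0 1" for \<zeta>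
  proof -
    have "norm (g \<zeta>) \<le> \<alpha> * norm (fst (\<phi> \<zeta>)) + \<beta> * norm (snd (\<phi> \<zeta>))"
      unfolding g_def by (rule order_trans[OF norm_triangle_ineq]) (use ab u in \<open>simp add: norm_mult\<close>)
    also have "\<dots> \<le> c" unfolding c_def by (rule le[OF cl[OF that]])
    finally show ?thesis .
  qed
  have "g constant_on ball 0 1"
  proof (rule maximum_modulus_principle[where U = "ball 0 1" and \<xi> = 0])
    show "g holomorphic_on ball 0 1" unfolding g_def by (intro holomorphic_intros h1 h2)
    show "norm (g \<zeta>) \<le> norm (g 0)" if "\<zeta> \<in> ball 0 1" for \<zeta>
      using gle[OF that] \<open>c \<ge> 0\<close> by (simp add: g0)
  qed auto
  then have g: "g \<zeta> = of_real c" if "\<zeta> \<in> ball 0 1" for \<zeta>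
    using g0 that unfolding constant_on_def by (metis centre_in_ball zero_less_one)
  have real: "\<alpha> * (norm (fst (\<phi> \<zeta>)) - Re (u1 * fst (\<phi> \<zeta>))) = 0" "\<beta> * (norm (snd (\<phi> \<zeta>)) - Re (u2 * snd (\<phi> \<zeta>))) = 0"
    if z: "\<zeta> \<in> ball 0 1" for \<zeta>
  proof -
    have "\<alpha> * Re (u1 * fst (\<phi> \<zeta>)) + \<beta> * Re (u2 * snd (\<phi> \<zeta>)) = Re (g \<zeta>)"
      by (simp add: g_def)
    also have "\<dots> = c" by (simp add: g[OF z])
    finally have 1: "\<alpha> * Re (u1 * fst (\<phi> \<zeta>)) + \<beta> * Re (u2 * snd (\<phi> \<zeta>)) = c" .
    have 2: "\<alpha> * norm (fst (\<phi> \<zeta>)) + \<beta> * norm (snd (\<phi> \<zeta>)) \<le> c"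
      unfolding c_def by (rule le[OF cl[OF z]])
    have 3: "Re (u1 * fst (\<phi> \<zeta>)) \<le> norm (fst (\<phi> \<zeta>))" "Re (u2 * snd (\<phi> \<zeta>)) \<le> norm (snd (\<phi> \<zeta>))"
      using complex_Re_le_cmod[of "u1 * fst (\<phi> \<zeta>)"] complex_Re_le_cmod[of "u2 * snd (\<phi> \<zeta>)"] u by (simp_all add: norm_mult)
    have "0 \<le> \<alpha> * (norm (fst (\<phi> \<zeta>)) - Re (u1 * fst (\<phi> \<zeta>)))" "0 \<le> \<beta> * (norm (snd (\<phi> \<zeta>)) - Re (u2 * snd (\<phi> \<zeta>)))"
      using ab 3 by simp_all
    with 1 2 show "\<alpha> * (norm (fst (\<phi> \<zeta>)) - Re (u1 * fst (\<phi> \<zeta>))) = 0" "\<beta> * (norm (snd (\<phi> \<zeta>)) - Re (u2 * snd (\<phi> \<zeta>))) = 0"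
      unfolding right_diff_distrib by linarith+
  qed
  have rigid: "\<exists>c. \<forall>\<zeta>\<in>ball 0 1. k \<zeta> = c"
    if k: "k holomorphic_on ball 0 1" and v: "norm v = 1" and re: "\<And>\<zeta>. \<zeta> \<in> ball 0 1 \<Longrightarrow> norm (k \<zeta>) = Re (v * k \<zeta>)"
    for k :: "complex \<Rightarrow> complex" and v
  proof -
    have "(\<lambda>\<zeta>. v * k \<zeta>) constant_on ball 0 1"
    proof (rule holomorphic_real_valued_constant)
      show "Im (v * k \<zeta>) = 0" if "\<zeta> \<in> ball 0 1" for \<zeta>
      proof -
        have "norm (v * k \<zeta>) = Re (v * k \<zeta>)" using re[OF that] v by (simp add: norm_mult)
        then have "(Re (v * k \<zeta>))\<^sup>2 = (Re (v * k \<zeta>))\<^sup>2 + (Im (v * k \<zeta>))\<^sup>2"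
          using cmod_power2[of "v * k \<zeta>"] by simp
        then show ?thesis by simp
      qed
    qed (auto intro!: holomorphic_intros k)
    then obtain d where "\<forall>\<zeta>\<in>ball 0 1. v * k \<zeta> = d" by (auto simp: constant_on_def)
    moreover have "v \<noteq> 0" using v by auto
    ultimately have "\<forall>\<zeta>\<in>ball 0 1. k \<zeta> = d / v" by (auto simp: field_simps)
    then show ?thesis by blast
  qed
  have c1: "\<exists>c. \<forall>\<zeta>\<in>ball 0 1. fst (\<phi> \<zeta>) = c" if "\<alpha> > 0"
    using real(1) that by (intro rigid[OF h1 u(1)]) auto
  have c2: "\<exists>c. \<forall>\<zeta>\<in>ball 0 1. snd (\<phi> \<zeta>) = c" if "\<beta> > 0"
    using real(2) that by (intro rigid[OF h2 u(3)]) auto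
  have "\<not> (\<alpha> > 0 \<and> \<beta> > 0)"
  proof
    assume "\<alpha> > 0 \<and> \<beta> > 0"
    then obtain d1 d2 where "\<forall>\<zeta>\<in>ball 0 1. fst (\<phi> \<zeta>) = d1" "\<forall>\<zeta>\<in>ball 0 1. snd (\<phi> \<zeta>) = d2"
      using c1 c2 by blast
    then have "\<forall>\<zeta>\<in>ball 0 1. \<phi> \<zeta> = (d1, d2)" by (simp add: prod_eq_iff)
    then show False using nc unfolding constant_on_def by blast
  qed
  with ab consider "\<alpha> = 0" "\<beta> > 0" | "\<beta> = 0" "\<alpha> > 0" by linarith
  then show ?thesis
  proof cases
    case 1
    then obtain d where d: "\<forall>\<zeta>\<in>ball 0 1. snd (\<phi> \<zeta>) = d" using c2 by blast
    then have "\<forall>y\<in>closure \<Omega>. norm (snd y) \<le> norm d" using le 1 by simp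
    then show ?thesis using d by blast
  next
    case 2
    then obtain d where d: "\<forall>\<zeta>\<in>ball 0 1. fst (\<phi> \<zeta>) = d" using c1 by blast
    then have "\<forall>y\<in>closure \<Omega>. norm (fst y) \<le> norm d" using le 2 by simp
    then show ?thesis using d by blast
  qed
qed

end

section \<open>Flat faces\<close>

context bounded_complete_reinhardt
begin

text \<open>The face \<open>{|q| = max |q|}\<close> of the closure is a circle times a disc whose radius \<open>r\<close> is positive
  because the face contains the nonconstant disc \<open>\<phi>\<close>. It is filled by the discs
  \<open>\<zeta> \<mapsto> (r \<zeta>, b)\<close> up to its relative boundary. The function \<open>mk\<close> assembles a point from its \<open>p\<close>- and \<open>q\<close>-coordinates.\<close>

lemma flat_face:
  fixes p q :: "complex2 \<Rightarrow> complex" and mk :: "complex \<Rightarrow> complex \<Rightarrow> complex2"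
  assumes pq: "p = fst \<and> q = snd \<and> mk = Pair \<or> p = snd \<and> q = fst \<and> mk = (\<lambda>a b. (b, a))"
    and \<phi>: "analytic_disc_in (frontier \<Omega>) \<phi>"
    and const: "\<And>\<zeta>. \<zeta> \<in> ball 0 1 \<Longrightarrow> q (\<phi> \<zeta>) = c" and max: "\<And>y. y \<in> closure \<Omega> \<Longrightarrow> norm (q y) \<le> norm c"
  obtains r s where "r > 0" "s > 0" "{x. norm (p x) \<le> r \<and> norm (q x) = s} \<subseteq> Gamma \<Omega>"
    "\<And>\<psi> d \<zeta>. \<lbrakk>analytic_disc_in (frontier \<Omega>) \<psi>; \<zeta> \<in> ball 0 1; \<And>\<zeta>. \<zeta> \<in> ball 0 1 \<Longrightarrow> q (\<psi> \<zeta>) = d;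
      \<And>y. y \<in> closure \<Omega> \<Longrightarrow> norm (q y) \<le> norm d\<rbrakk> \<Longrightarrow> norm (p (\<psi> \<zeta>)) \<le> r \<and> norm (q (\<psi> \<zeta>)) = s"
proof -
  have mk [simp]: "p (mk a b) = a" "q (mk a b) = b" "mk (p x) (q x) = x" for a b x
    using pq by auto
  have cont_p: "continuous_on A p" and cont_q: "continuous_on A q" for A
    using pq by (auto intro: continuous_intros)
  have mk_tendsto: "(\<lambda>n. mk (a n) b) \<longlonglongrightarrow> mk l b" if "a \<longlonglongrightarrow> l" for a :: "nat \<Rightarrow> complex" and l b
    using pq tendsto_Pair[OF that tendsto_const[of b]] tendsto_Pair[OF tendsto_const[of b] that] by auto
  have cl: "mk a b \<in> closure \<Omega>" if "x \<in> closure \<Omega>" "norm a \<le> norm (p x)" "norm b \<le> norm (q x)" for x a b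
    using pq closure_complete[of "fst x" "snd x"] that by auto
  have disc_cl: "\<psi> \<zeta> \<in> closure \<Omega>" if "analytic_disc_in (frontier \<Omega>) \<psi>" "\<zeta> \<in> ball 0 1" for \<psi> \<zeta>
    using that unfolding analytic_disc_in_def frontier_def by blast
  define s where "s = norm c"
  have not_in: "x \<notin> \<Omega>" if x: "norm (q x) = s" for x
  proof
    assume xin: "x \<in> \<Omega>"
    obtain R where "{b. mk (p x) b \<in> \<Omega>} = ball 0 R"
      using pq slice_snd_ball[of "p x"] slice_fst_ball[of "p x"] by auto
    then have R: "mk (p x) b \<in> \<Omega> \<longleftrightarrow> norm b < R" for b by auto
    have "norm (q x) < R" using R[of "q x"] xin by simp
    then have sR: "s < R" "0 \<le> s" using x by (auto simp: s_def)
    then have "mk (p x) (of_real ((s + R) / 2)) \<in> \<Omega>" unfolding R norm_of_real by simp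
    then have "norm (q (mk (p x) (of_real ((s + R) / 2)))) \<le> s"
      unfolding s_def using max closure_subset by blast
    then have "(s + R) / 2 \<le> s" using sR by (simp only: mk norm_of_real)
    then show False using sR by simp
  qed
  have "s > 0"
  proof (rule ccontr)
    assume "\<not> s > 0"
    then have "s = 0" by (simp add: s_def)
    then show False using not_in[of "(0, 0)"] zero_mem pq by auto
  qed
  define K where "K = {x \<in> closure \<Omega>. norm (q x) = s}"
  have "compact K"
  proof -
    have "closed {x. norm (q x) = s}"
      by (intro closed_Collect_eq continuous_intros cont_q)
    moreover have "compact (closure \<Omega>)" using bounded_domain by (simp add: compact_closure)
    moreover have "K = closure \<Omega> \<inter> {x. norm (q x) = s}" by (auto simp: K_def)
    ultimately show ?thesis by (simp add: compact_Int_closed)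
  qed
  moreover have "\<phi> 0 \<in> K" using disc_cl[OF \<phi>, of 0] const[of 0] by (simp add: K_def s_def)
  ultimately have "\<exists>x\<in>K. \<forall>y\<in>K. norm (p y) \<le> norm (p x)"
    by (intro continuous_attains_sup continuous_on_norm cont_p) auto
  then obtain x0 where x0: "x0 \<in> K" "\<And>x. x \<in> K \<Longrightarrow> norm (p x) \<le> norm (p x0)" by blast
  define r where "r = norm (p x0)"
  have disc_face: "norm (p (\<psi> \<zeta>)) \<le> r \<and> norm (q (\<psi> \<zeta>)) = s"
    if \<psi>: "analytic_disc_in (frontier \<Omega>) \<psi>" and \<zeta>: "\<zeta> \<in> ball 0 1"
      and d: "\<And>\<zeta>. \<zeta> \<in> ball 0 1 \<Longrightarrow> q (\<psi> \<zeta>) = d" "\<And>y. y \<in> closure \<Omega> \<Longrightarrow> norm (q y) \<le> norm d" for \<psi> \<zeta> d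
  proof -
    have "norm d = s"
    proof (rule antisym)
      show "norm d \<le> s" using max[OF disc_cl[OF \<psi> \<zeta>]] d(1)[OF \<zeta>] by (simp add: s_def)
      show "s \<le> norm d" using d(2)[OF disc_cl[OF \<phi>, of 0]] const[of 0] by (simp add: s_def)
    qed
    then have "\<psi> \<zeta> \<in> K" using disc_cl[OF \<psi> \<zeta>] d(1)[OF \<zeta>] by (simp add: K_def)
    then show ?thesis using x0(2) by (auto simp: r_def K_def)
  qed
  have "r > 0"
  proof (rule ccontr)
    assume "\<not> r > 0"
    then have "r = 0" by (simp add: r_def)
    then have "p (\<phi> \<zeta>) = 0" if "\<zeta> \<in> ball 0 1" for \<zeta>
      using disc_face[OF \<phi> that const max] by simp
    then have "\<phi> \<zeta> = mk 0 c" if "\<zeta> \<in> ball 0 1" for \<zeta>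
      using const[OF that] that mk(3)[of "\<phi> \<zeta>"] by simp
    then show False using \<phi> by (auto simp: analytic_disc_in_def constant_on_def)
  qed
  have face: "mk a b \<in> frontier \<Omega>" if "norm a \<le> r" "norm b = s" for a b
  proof -
    have "mk a b \<in> closure \<Omega>" using that x0(1) by (intro cl[of x0]) (auto simp: r_def K_def)
    moreover have "mk a b \<notin> \<Omega>" using that by (intro not_in) simp
    ultimately show ?thesis using open_domain by (simp add: frontier_def interior_open)
  qed
  have open_face: "mk a b \<in> (\<Union>{\<psi> ` ball 0 1 |\<psi>. analytic_disc_in (frontier \<Omega>) \<psi>})" if "norm a < r" "norm b = s" for a b
  proof -
    define \<psi> where "\<psi> = (\<lambda>\<zeta>. mk (of_real r * \<zeta>) b)"
    have "analytic_disc_in (frontier \<Omega>) \<psi>"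
      unfolding analytic_disc_in_def
    proof (intro conjI)
      show "(\<lambda>\<zeta>. fst (\<psi> \<zeta>)) holomorphic_on ball 0 1" "(\<lambda>\<zeta>. snd (\<psi> \<zeta>)) holomorphic_on ball 0 1"
        using pq by (auto simp: \<psi>_def intro!: holomorphic_intros)
      show "\<psi> ` ball 0 1 \<subseteq> frontier \<Omega>"
        using \<open>r > 0\<close> that(2) by (auto simp: \<psi>_def norm_mult intro!: face)
      show "\<not> \<psi> constant_on ball 0 1"
      proof
        assume "\<psi> constant_on ball 0 1"
        then have "\<psi> 0 = \<psi> (1/2)" by (auto simp: constant_on_def)
        then have "p (\<psi> 0) = p (\<psi> (1/2))" by simp
        then show False using \<open>r > 0\<close> by (simp add: \<psi>_def)
      qed
    qed
    moreover have "mk a b = \<psi> (a / of_real r)" using \<open>r > 0\<close> by (simp add: \<psi>_def)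
    moreover have "a / of_real r \<in> ball 0 1" using \<open>r > 0\<close> that(1) by (simp add: norm_divide)
    ultimately show ?thesis by blast
  qed
  have face_Gamma: "{x. norm (p x) \<le> r \<and> norm (q x) = s} \<subseteq> Gamma \<Omega>"
  proof
    fix x assume "x \<in> {x. norm (p x) \<le> r \<and> norm (q x) = s}"
    then have x: "norm (p x) \<le> r" "norm (q x) = s" by auto
    define X where "X = (\<lambda>n. mk (of_real (real n / real (Suc n)) * p x) (q x))"
    have "norm (of_real (real n / real (Suc n)) * p x) < r" for n
    proof -
      have t: "0 \<le> real n / real (Suc n)" "real n / real (Suc n) < 1" by (auto simp: divide_simps)
      have "norm (of_real (real n / real (Suc n)) * p x) = real n / real (Suc n) * norm (p x)"
        using t by (simp only: norm_mult norm_of_real abs_of_nonneg)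
      also have "\<dots> \<le> real n / real (Suc n) * r" by (intro mult_left_mono x t)
      also have "\<dots> < 1 * r" by (intro mult_strict_right_mono t \<open>r > 0\<close>)
      finally show ?thesis by simp
    qed
    then have "X n \<in> (\<Union>{\<psi> ` ball 0 1 |\<psi>. analytic_disc_in (frontier \<Omega>) \<psi>})" for n
      unfolding X_def by (rule open_face) (rule x(2))
    moreover have "X \<longlonglongrightarrow> x"
    proof -
      have "(\<lambda>n. complex_of_real (real n / real (Suc n)) * p x) \<longlonglongrightarrow> of_real 1 * p x"
        by (intro tendsto_intros LIMSEQ_n_over_Suc_n)
      then have "(\<lambda>n. complex_of_real (real n / real (Suc n)) * p x) \<longlonglongrightarrow> p x" by simp
      then have "X \<longlonglongrightarrow> mk (p x) (q x)"
        unfolding X_def by (rule mk_tendsto)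
      then show ?thesis by simp
    qed
    ultimately show "x \<in> Gamma \<Omega>" unfolding Gamma_def closure_sequential by blast
  qed
  show ?thesis
  proof (rule that[of r s])
    show "r > 0" "s > 0" "{x. norm (p x) \<le> r \<and> norm (q x) = s} \<subseteq> Gamma \<Omega>" by fact+
  qed (rule disc_face; assumption)
qed

lemma flat_face_covers_discs:
  fixes p q :: "complex2 \<Rightarrow> complex"
  assumes pq: "p = fst \<and> q = snd \<or> p = snd \<and> q = fst"
  shows "\<exists>G. (G = {} \<or> (\<exists>r>0. \<exists>s>0. G = {x. norm (p x) \<le> r \<and> norm (q x) = s})) \<and> G \<subseteq> Gamma \<Omega> \<and>
    (\<forall>\<phi>. analytic_disc_in (frontier \<Omega>) \<phi> \<longrightarrow>
      (\<exists>c. (\<forall>\<zeta>\<in>ball 0 1. q (\<phi> \<zeta>) = c) \<and> (\<forall>y\<in>closure \<Omega>. norm (q y) \<le> norm c)) \<longrightarrow> \<phi> ` ball 0 1 \<subseteq> G)"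
proof (cases "\<exists>\<phi> c. analytic_disc_in (frontier \<Omega>) \<phi> \<and> (\<forall>\<zeta>\<in>ball 0 1. q (\<phi> \<zeta>) = c) \<and> (\<forall>y\<in>closure \<Omega>. norm (q y) \<le> norm c)")
  case True
  then obtain \<phi> c where \<phi>: "analytic_disc_in (frontier \<Omega>) \<phi>" "\<And>\<zeta>. \<zeta> \<in> ball 0 1 \<Longrightarrow> q (\<phi> \<zeta>) = c"
    "\<And>y. y \<in> closure \<Omega> \<Longrightarrow> norm (q y) \<le> norm c"
    by blast
  define mk where "mk = (if p = fst \<and> q = snd then Pair else (\<lambda>a b. (b, a :: complex)))"
  have pq': "p = fst \<and> q = snd \<and> mk = Pair \<or> p = snd \<and> q = fst \<and> mk = (\<lambda>a b. (b, a))"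
    using pq by (cases "p = fst \<and> q = snd") (simp_all add: mk_def)
  show ?thesis
  proof (rule flat_face[OF pq' \<phi>])
    fix r s :: real
    assume rs: "r > 0" "s > 0" "{x. norm (p x) \<le> r \<and> norm (q x) = s} \<subseteq> Gamma \<Omega>"
      and sub: "\<And>\<psi> d \<zeta>. \<lbrakk>analytic_disc_in (frontier \<Omega>) \<psi>; \<zeta> \<in> ball 0 1; \<And>\<zeta>. \<zeta> \<in> ball 0 1 \<Longrightarrow> q (\<psi> \<zeta>) = d;
        \<And>y. y \<in> closure \<Omega> \<Longrightarrow> norm (q y) \<le> norm d\<rbrakk> \<Longrightarrow> norm (p (\<psi> \<zeta>)) \<le> r \<and> norm (q (\<psi> \<zeta>)) = s"
    show ?thesis
    proof (intro exI[of _ "{x. norm (p x) \<le> r \<and> norm (q x) = s}"] conjI allI impI disjI2)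
      show "\<exists>r'>0. \<exists>s'>0. {x. norm (p x) \<le> r \<and> norm (q x) = s} = {x. norm (p x) \<le> r' \<and> norm (q x) = s'}"
        using rs(1,2) by blast
      show "{x. norm (p x) \<le> r \<and> norm (q x) = s} \<subseteq> Gamma \<Omega>" by (rule rs(3))
      fix \<psi> assume \<psi>: "analytic_disc_in (frontier \<Omega>) \<psi>"
        "\<exists>d. (\<forall>\<zeta>\<in>ball 0 1. q (\<psi> \<zeta>) = d) \<and> (\<forall>y\<in>closure \<Omega>. norm (q y) \<le> norm d)"
      then obtain d where d: "\<forall>\<zeta>\<in>ball 0 1. q (\<psi> \<zeta>) = d" "\<forall>y\<in>closure \<Omega>. norm (q y) \<le> norm d" by blast
      have "norm (p (\<psi> \<zeta>)) \<le> r \<and> norm (q (\<psi> \<zeta>)) = s" if "\<zeta> \<in> ball 0 1" for \<zeta>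
        by (rule sub[OF \<psi>(1) that]) (use d in blast)+
      then show "\<psi> ` ball 0 1 \<subseteq> {x. norm (p x) \<le> r \<and> norm (q x) = s}" by blast
    qed
  qed
next
  case False
  then show ?thesis by (intro exI[of _ "{}"]) blast
qed

lemma Gamma_decomposition_exists:
  assumes "convex \<Omega>"
  shows "\<exists>G1 G2. Gamma_decomposition \<Omega> G1 G2"
proof -
  have eq1: "{x. norm (fst x) \<le> r \<and> norm (snd x) = s} = cball (0::complex) r \<times> sphere (0::complex) s"
    and eq2: "{x. norm (snd x) \<le> r \<and> norm (fst x) = s} = sphere (0::complex) s \<times> cball (0::complex) r" for r s
    by auto
  obtain G1 where G1: "(G1 = {} \<or> (\<exists>r>0. \<exists>s>0. G1 = cball 0 r \<times> sphere 0 s)) \<and> G1 \<subseteq> Gamma \<Omega> \<and>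
    (\<forall>\<phi>. analytic_disc_in (frontier \<Omega>) \<phi> \<longrightarrow>
      (\<exists>c. (\<forall>\<zeta>\<in>ball 0 1. snd (\<phi> \<zeta>) = c) \<and> (\<forall>y\<in>closure \<Omega>. norm (snd y) \<le> norm c)) \<longrightarrow> \<phi> ` ball 0 1 \<subseteq> G1)"
    using flat_face_covers_discs[OF disjI1[OF conjI[OF refl refl]], unfolded eq1] by (rule exE)
  obtain G2 where G2: "(G2 = {} \<or> (\<exists>r>0. \<exists>s>0. G2 = sphere 0 s \<times> cball 0 r)) \<and> G2 \<subseteq> Gamma \<Omega> \<and>
    (\<forall>\<phi>. analytic_disc_in (frontier \<Omega>) \<phi> \<longrightarrow>
      (\<exists>c. (\<forall>\<zeta>\<in>ball 0 1. fst (\<phi> \<zeta>) = c) \<and> (\<forall>y\<in>closure \<Omega>. norm (fst y) \<le> norm c)) \<longrightarrow> \<phi> ` ball 0 1 \<subseteq> G2)"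
    using flat_face_covers_discs[OF disjI2[OF conjI[OF refl refl]], unfolded eq2] by (rule exE)
  have "Gamma \<Omega> \<subseteq> G1 \<union> G2"
    unfolding Gamma_def
  proof (rule closure_minimal)
    show "\<Union>{\<phi> ` ball 0 1 |\<phi>. analytic_disc_in (frontier \<Omega>) \<phi>} \<subseteq> G1 \<union> G2"
    proof (rule Union_least)
      fix D assume "D \<in> {\<phi> ` ball 0 1 |\<phi>. analytic_disc_in (frontier \<Omega>) \<phi>}"
      then obtain \<phi> where D: "D = \<phi> ` ball 0 1" and \<phi>: "analytic_disc_in (frontier \<Omega>) \<phi>" by blast
      have "\<phi> ` ball 0 1 \<subseteq> G1 \<or> \<phi> ` ball 0 1 \<subseteq> G2"
        using analytic_disc_in_frontier_cases[OF assms \<phi>] conjunct2[OF conjunct2[OF G1]] conjunct2[OF conjunct2[OF G2]] \<phi>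
        by meson
      then show "D \<subseteq> G1 \<union> G2" unfolding D by blast
    qed
    have "closed G1"
      using conjunct1[OF G1] by (elim disjE exE conjE) (simp_all add: closed_Times)
    moreover have "closed G2"
      using conjunct1[OF G2] by (elim disjE exE conjE) (simp_all add: closed_Times)
    ultimately show "closed (G1 \<union> G2)" by (rule closed_Un)
  qed
  moreover have "G1 \<union> G2 \<subseteq> Gamma \<Omega>" using G1 G2 by simp
  ultimately have "Gamma \<Omega> = G1 \<union> G2" by simp
  then show ?thesis using conjunct1[OF G1] conjunct1[OF G2] unfolding Gamma_decomposition_def by blast
qed

end

text \<open>Points with first coordinate \<open>0\<close> belong to the first piece only and determine \<open>s\<close>. On
  the circle \<open>|w| = s\<close> the second piece meets only one value of \<open>|z|\<close>, which is too little to account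
  for an interval \<open>(r', r]\<close>.\<close>

lemma cball_times_sphere_determined:
  fixes A B A' B' :: "complex2 set"
  assumes eq: "A \<union> B = A' \<union> B'"
    and A: "A = {} \<or> (\<exists>r>0. \<exists>s>0. A = cball 0 r \<times> sphere 0 s)"
    and A': "A' = {} \<or> (\<exists>r>0. \<exists>s>0. A' = cball 0 r \<times> sphere 0 s)"
    and B': "B' = {} \<or> (\<exists>r>0. \<exists>s>0. B' = sphere 0 s \<times> cball 0 r)"
  shows "A \<subseteq> A'"
proof (cases "A = {}")
  case False
  then obtain r s where rs: "r > 0" "s > 0" "A = cball 0 r \<times> sphere 0 s" using A by blast
  have "(0, complex_of_real s) \<in> A" using rs by simp
  moreover have "(0, complex_of_real s) \<notin> B'" using B' by auto
  ultimately have inA': "(0, complex_of_real s) \<in> A'" using eq by blast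
  then obtain r' s' where rs': "r' > 0" "s' > 0" "A' = cball 0 r' \<times> sphere 0 s'" using A' by blast
  have ss: "s' = s" using inA' rs rs' by simp
  have "r \<le> r'"
  proof (rule ccontr)
    assume "\<not> r \<le> r'"
    then have lt: "r' < (r + r') / 2" "(r + r') / 2 < r" by auto
    have inB: "(complex_of_real x, complex_of_real s) \<in> B'" if "r' < x" "x \<le> r" for x
    proof -
      have "x > 0" using that rs'(1) by simp
      then have "(complex_of_real x, complex_of_real s) \<in> A" "(complex_of_real x, complex_of_real s) \<notin> A'"
        using that rs rs' by auto
      then show ?thesis using eq by blast
    qed
    have "(complex_of_real r, complex_of_real s) \<in> B'" "(complex_of_real ((r + r') / 2), complex_of_real s) \<in> B'"
      using inB[of r] inB[of "(r + r') / 2"] lt by auto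
    then obtain s2 where "norm (complex_of_real r) = s2" "norm (complex_of_real ((r + r') / 2)) = s2"
      using B' by auto
    then have "\<bar>r\<bar> = \<bar>(r + r') / 2\<bar>" by (simp only: norm_of_real)
    then show False using lt rs(1) rs'(1) by linarith
  qed
  then show ?thesis using rs(3) rs'(3) ss by auto
qed simp

lemma sphere_times_cball_determined:
  fixes A B A' B' :: "complex2 set"
  assumes eq: "A \<union> B = A' \<union> B'"
    and B: "B = {} \<or> (\<exists>r>0. \<exists>s>0. B = sphere 0 s \<times> cball 0 r)"
    and A': "A' = {} \<or> (\<exists>r>0. \<exists>s>0. A' = cball 0 r \<times> sphere 0 s)"
    and B': "B' = {} \<or> (\<exists>r>0. \<exists>s>0. B' = sphere 0 s \<times> cball 0 r)"
  shows "B \<subseteq> B'"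
proof -
  have swap: "X = sphere 0 s \<times> cball 0 r \<Longrightarrow> prod.swap ` X = cball 0 r \<times> sphere 0 s"
    "X = cball 0 r \<times> sphere 0 s \<Longrightarrow> prod.swap ` X = sphere 0 s \<times> cball 0 r" for X :: "complex2 set" and r s
    by (simp_all add: product_swap)
  have "prod.swap ` B \<subseteq> prod.swap ` B'"
  proof (rule cball_times_sphere_determined)
    have "B \<union> A = B' \<union> A'" using eq by blast
    then show "prod.swap ` B \<union> prod.swap ` A = prod.swap ` B' \<union> prod.swap ` A'"
      by (simp only: image_Un[symmetric])
    show "prod.swap ` B = {} \<or> (\<exists>r>0. \<exists>s>0. prod.swap ` B = cball 0 r \<times> sphere 0 s)"
      using B swap(1)[of B] by (cases "B = {}") blast+
    show "prod.swap ` B' = {} \<or> (\<exists>r>0. \<exists>s>0. prod.swap ` B' = cball 0 r \<times> sphere 0 s)"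
      using B' swap(1)[of B'] by (cases "B' = {}") blast+
    show "prod.swap ` A' = {} \<or> (\<exists>r>0. \<exists>s>0. prod.swap ` A' = sphere 0 s \<times> cball 0 r)"
      using A' swap(2)[of A'] by (cases "A' = {}") blast+
  qed
  then show ?thesis by (simp add: inj_image_subset_iff)
qed

lemma Gamma_decomposition_unique:
  assumes "Gamma_decomposition \<Omega> G1 G2" "Gamma_decomposition \<Omega> G1' G2'"
  shows "G1 = G1'" "G2 = G2'"
proof -
  note d = assms(1)[unfolded Gamma_decomposition_def] and d' = assms(2)[unfolded Gamma_decomposition_def]
  note G = conjunct1[OF d] conjunct1[OF conjunct2[OF d]] conjunct2[OF conjunct2[OF d]]
  note G' = conjunct1[OF d'] conjunct1[OF conjunct2[OF d']] conjunct2[OF conjunct2[OF d']]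
  have eq: "G1 \<union> G2 = G1' \<union> G2'" using G(1) G'(1) by simp
  show "G1 = G1'"
    by (rule antisym[OF cball_times_sphere_determined[OF eq G(2) G'(2,3)] cball_times_sphere_determined[OF eq[symmetric] G'(2) G(2,3)]])
  show "G2 = G2'"
    by (rule antisym[OF sphere_times_cball_determined[OF eq G(3) G'(2,3)] sphere_times_cball_determined[OF eq[symmetric] G'(3) G(2,3)]])
qed

context bounded_complete_reinhardt
begin

lemma Gamma_decomposition_Gamma1_Gamma2:
  assumes "convex \<Omega>"
  shows "Gamma_decomposition \<Omega> (Gamma1 \<Omega>) (Gamma2 \<Omega>)"
proof -
  obtain G1 G2 where G: "Gamma_decomposition \<Omega> G1 G2" using Gamma_decomposition_exists[OF assms] by blast
  have "Gamma1 \<Omega> = G1"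
    unfolding Gamma1_def
    by (rule the_equality) (use G in blast, elim exE, rule Gamma_decomposition_unique(1)[OF _ G])
  moreover have "Gamma2 \<Omega> = G2"
    unfolding Gamma2_def
    by (rule the_equality) (use G in blast, elim exE, rule Gamma_decomposition_unique(2)[OF _ G])
  ultimately show ?thesis using G by simp
qed

lemma Gamma_subset_frontier: "Gamma \<Omega> \<subseteq> frontier \<Omega>"
  unfolding Gamma_def by (rule closure_minimal) (auto simp: analytic_disc_in_def)

text \<open>For \<open>s/2 \<le> |q x| < s\<close> scale \<open>x\<close> by \<open>s / |q x| \<le> 2\<close> onto the face; points of the segment from
  there to the interior point \<open>0\<close> are interior. The bound \<open>|p x| < r / 2\<close> leaves room for the
  scaling.\<close>

lemma flat_face_imp_box:
  fixes p q :: "complex2 \<Rightarrow> complex"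
  assumes conv: "convex \<Omega>" and pq: "p = fst \<and> q = snd \<or> p = snd \<and> q = fst"
    and rs: "r > 0" "s > 0" and face: "{x. norm (p x) \<le> r \<and> norm (q x) = s} \<subseteq> frontier \<Omega>"
  shows "x \<in> \<Omega> \<Longrightarrow> norm (q x) < s"
    and "norm (p x) \<in> {r / 2 / 2..<r / 2} \<Longrightarrow> norm (q x) \<in> {s / 2..<s} \<Longrightarrow> x \<in> \<Omega>"
proof -
  have fr: "frontier \<Omega> = closure \<Omega> - \<Omega>" using open_domain by (simp add: frontier_def interior_open)
  show "norm (q x) < s" if x: "x \<in> \<Omega>"
  proof (rule ccontr)
    assume "\<not> norm (q x) < s"
    then have "s \<le> norm (q x)" by simp
    have "\<exists>y\<in>\<Omega>. p y = 0 \<and> q y = of_real s"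
      using pq
    proof
      assume pq: "p = fst \<and> q = snd"
      then have "(0, of_real s) \<in> \<Omega>"
        using complete[of "fst x" "snd x" 0 "of_real s"] x rs \<open>s \<le> norm (q x)\<close> by simp
      then show ?thesis using pq by (intro bexI[of _ "(0, of_real s)"]) auto
    next
      assume pq: "p = snd \<and> q = fst"
      then have "(of_real s, 0) \<in> \<Omega>"
        using complete[of "fst x" "snd x" "of_real s" 0] x rs \<open>s \<le> norm (q x)\<close> by simp
      then show ?thesis using pq by (intro bexI[of _ "(of_real s, 0)"]) auto
    qed
    then obtain y where y: "y \<in> \<Omega>" "p y = 0" "q y = of_real s" by blast
    then have "y \<in> {x. norm (p x) \<le> r \<and> norm (q x) = s}" using rs by simp
    then show False using y(1) face fr by blast
  qed
  show "x \<in> \<Omega>" if px: "norm (p x) \<in> {r / 2 / 2..<r / 2}" and qx: "norm (q x) \<in> {s / 2..<s}"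
  proof -
    define t where "t = norm (q x) / s"
    have t: "1 / 2 \<le> t" "t < 1" using qx rs by (auto simp: t_def field_simps)
    define y where "y = (1 / t) *\<^sub>R x"
    have py: "norm (p y) = norm (p x) / t" and qy: "norm (q y) = norm (q x) / t"
      using pq t by (auto simp: y_def)
    have "norm (p x) / t \<le> norm (p x) / (1 / 2)" using t by (intro divide_left_mono) auto
    also have "\<dots> \<le> r" using px by simp
    finally have "norm (p y) \<le> r" unfolding py .
    moreover have "norm (q y) = s"
    proof -
      have "norm (q x) > 0" using qx rs by auto
      then show ?thesis unfolding qy t_def using rs by simp
    qed
    ultimately have "y \<in> closure \<Omega>" using face fr by blast
    moreover have "0 \<in> interior \<Omega>" using zero_mem open_domain by (simp add: interior_open zero_prod_def)
    ultimately have "y - (1 - t) *\<^sub>R (y - 0) \<in> interior \<Omega>"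
      using t by (intro mem_interior_closure_convex_shrink conv) auto
    moreover have "y - (1 - t) *\<^sub>R (y - 0) = t *\<^sub>R y" by (simp add: scaleR_left_diff_distrib)
    moreover have "t *\<^sub>R y = x" using t by (simp add: y_def)
    ultimately show ?thesis using open_domain by (simp add: interior_open)
  qed
qed

text \<open>The product of annuli next to the face supplies the lower bound \<open>\<kappa>\<close> on the norms of
  monomials, uniformly in \<open>n\<close>.\<close>

lemma flat_face_imp_taylor_coeff_eq_0:
  fixes p q :: "complex2 \<Rightarrow> complex"
  assumes pq: "p = fst \<and> q = snd \<and> N = monomial_norm2 \<and> c = taylor_coeff2 \<or>
      p = snd \<and> q = fst \<and> N = (\<lambda>a b. monomial_norm2 b a) \<and> c = (\<lambda>F j k. taylor_coeff2 F k j)"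
    and conv: "convex \<Omega>" and rs: "r > 0" "s > 0" and face: "{x. norm (p x) \<le> r \<and> norm (q x) = s} \<subseteq> frontier \<Omega>"
    and f: "f \<in> bergman_space \<Omega>" and H: "hankel_compact \<Omega> (\<lambda>z. cnj (f z))"
    and j: "j \<ge> 1"
  shows "c f j k = 0"
proof -
  have pq': "p = fst \<and> q = snd \<or> p = snd \<and> q = fst" using pq by blast
  note box = flat_face_imp_box[OF conv pq' rs face]
  have lower: "annulus_moment (r / 2) a * annulus_moment s b \<le> N a b" for a b
    using pq
  proof
    assume *: "p = fst \<and> q = snd \<and> N = monomial_norm2 \<and> c = taylor_coeff2"
    have "annulus_moment (r / 2) a * annulus_moment s b \<le> monomial_norm2 a b"
      by (rule monomial_norm2_ge_moments) (use * box(2) in simp)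
    then show ?thesis using * by simp
  next
    assume *: "p = snd \<and> q = fst \<and> N = (\<lambda>a b. monomial_norm2 b a) \<and> c = (\<lambda>F j k. taylor_coeff2 F k j)"
    have "annulus_moment s b * annulus_moment (r / 2) a \<le> monomial_norm2 b a"
      by (rule monomial_norm2_ge_moments) (use * box(2) in simp)
    then show ?thesis using * by (simp add: mult.commute)
  qed
  have "\<exists>V>0. \<forall>n. N 0 n \<le> V * annulus_moment s n"
  proof (rule monomial_norm2_le_moment)
    fix V :: real
    assume V: "V > 0"
      "\<And>s n. \<lbrakk>s > 0; \<And>z w. (z, w) \<in> \<Omega> \<Longrightarrow> norm w < s\<rbrakk> \<Longrightarrow> monomial_norm2 0 n \<le> V * annulus_moment s n"
      "\<And>s n. \<lbrakk>s > 0; \<And>z w. (z, w) \<in> \<Omega> \<Longrightarrow> norm z < s\<rbrakk> \<Longrightarrow> monomial_norm2 n 0 \<le> V * annulus_moment s n"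
    have "N 0 n \<le> V * annulus_moment s n" for n
      using pq
    proof
      assume *: "p = fst \<and> q = snd \<and> N = monomial_norm2 \<and> c = taylor_coeff2"
      have "monomial_norm2 0 n \<le> V * annulus_moment s n"
        by (rule V(2)[OF rs(2)]) (use * box(1) in force)
      then show ?thesis using * by simp
    next
      assume *: "p = snd \<and> q = fst \<and> N = (\<lambda>a b. monomial_norm2 b a) \<and> c = (\<lambda>F j k. taylor_coeff2 F k j)"
      have "monomial_norm2 n 0 \<le> V * annulus_moment s n"
        by (rule V(3)[OF rs(2)]) (use * box(1) in force)
      then show ?thesis using * by simp
    qed
    with V(1) show ?thesis by blast
  qed
  then obtain V where V: "V > 0" and upper: "\<And>n. N 0 n \<le> V * annulus_moment s n" by blast
  have apos: "annulus_moment (r / 2) a > 0" "annulus_moment s a > 0" for a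
    using rs by (auto intro!: annulus_moment_pos)
  define \<kappa> where "\<kappa> = annulus_moment (r / 2) j * (s / 2) ^ (2 * k) / V"
  show ?thesis
  proof (rule hankel_compact_imp_taylor_coeff_eq_0[OF pq _ _ _ f H j])
    show "\<kappa> > 0" using apos V rs by (simp add: \<kappa>_def)
    show "N 0 n > 0" for n using lower[of 0 n] apos by (meson mult_pos_pos less_le_trans)
    show "\<kappa> * N 0 n \<le> N j (k + n)" for n
    proof -
      have "\<kappa> * N 0 n \<le> \<kappa> * (V * annulus_moment s n)"
        using \<open>\<kappa> > 0\<close> by (intro mult_left_mono upper) simp
      also have "\<dots> = annulus_moment (r / 2) j * ((s / 2) ^ (2 * k) * annulus_moment s n)"
        using V by (simp add: \<kappa>_def)
      also have "\<dots> \<le> annulus_moment (r / 2) j * annulus_moment s (k + n)"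
        using apos(1)[of j] by (intro mult_left_mono annulus_moment_add_ge rs) simp
      also have "\<dots> \<le> N j (k + n)" by (rule lower)
      finally show ?thesis .
    qed
  qed
qed

end

section \<open>Dependence on a single variable\<close>

theorem theorem1:
  fixes \<Omega> :: "(complex \<times> complex) set" and f :: "complex \<times> complex \<Rightarrow> complex"
  assumes "is_domain \<Omega>" and "bounded \<Omega>" and "convex \<Omega>" and "reinhardt \<Omega>"
    and "f \<in> bergman_space \<Omega>"
    and "hankel_compact \<Omega> (\<lambda>z. cnj (f z))"
  shows "(Gamma1 \<Omega> \<noteq> {} \<longrightarrow>
           (\<forall>z1 z1' z2. (z1, z2) \<in> \<Omega> \<and> (z1', z2) \<in> \<Omega> \<longrightarrow> f (z1, z2) = f (z1', z2))) \<and>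
         (Gamma2 \<Omega> \<noteq> {} \<longrightarrow>
           (\<forall>z1 z2 z2'. (z1, z2) \<in> \<Omega> \<and> (z1, z2') \<in> \<Omega> \<longrightarrow> f (z1, z2) = f (z1, z2')))"
proof -
  interpret bounded_complete_reinhardt \<Omega>
    using assms(1-4) by (rule convex_reinhardt_imp_complete)
  note dec = Gamma_decomposition_Gamma1_Gamma2[OF assms(3), unfolded Gamma_decomposition_def]
  have hol: "holomorphic2_on f \<Omega>" using assms(5) by (rule bergman_space_holomorphic)
  show ?thesis
  proof (intro conjI impI allI; elim conjE)
    fix z z' w assume "Gamma1 \<Omega> \<noteq> {}" and zw: "(z, w) \<in> \<Omega>" "(z', w) \<in> \<Omega>"
    then obtain r s where rs: "r > 0" "s > 0" "Gamma1 \<Omega> = cball 0 r \<times> sphere 0 s" using dec by blast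
    have "{x. norm (fst x) \<le> r \<and> norm (snd x) = s} = Gamma1 \<Omega>" unfolding rs(3) by auto
    also have "\<dots> \<subseteq> frontier \<Omega>" using dec Gamma_subset_frontier by blast
    finally have face: "{x. norm (fst x) \<le> r \<and> norm (snd x) = s} \<subseteq> frontier \<Omega>" .
    have "taylor_coeff2 f j k = 0" if "j \<ge> 1" for j k
      by (rule flat_face_imp_taylor_coeff_eq_0[OF _ assms(3) rs(1,2) face assms(5,6) that]) blast
    then show "f (z, w) = f (z', w)" by (rule independent_fst[OF hol _ zw])
  next
    fix z w w' assume "Gamma2 \<Omega> \<noteq> {}" and zw: "(z, w) \<in> \<Omega>" "(z, w') \<in> \<Omega>"
    then obtain r s where rs: "r > 0" "s > 0" "Gamma2 \<Omega> = sphere 0 s \<times> cball 0 r" using dec by blast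
    have "{x. norm (snd x) \<le> r \<and> norm (fst x) = s} = Gamma2 \<Omega>" unfolding rs(3) by auto
    also have "\<dots> \<subseteq> frontier \<Omega>" using dec Gamma_subset_frontier by blast
    finally have face: "{x. norm (snd x) \<le> r \<and> norm (fst x) = s} \<subseteq> frontier \<Omega>" .
    have "taylor_coeff2 f k j = 0" if "j \<ge> 1" for j k
      using flat_face_imp_taylor_coeff_eq_0[where p = snd and q = fst and c = "\<lambda>F j k. taylor_coeff2 F k j"
        and N = "\<lambda>a b. monomial_norm2 b a", OF _ assms(3) rs(1,2) face assms(5,6) that] by blast
    then show "f (z, w) = f (z, w')" by (rule independent_snd[OF hol _ zw])
  qed
qed

end
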